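(* Let $d\in\{2,3\}$. Consider a magnetic field $\mathbf B=\mathrm{curl}\,\mathbf A$ with magnetic potential $\mathbf A\in\mathrm L^2_{\mathrm{loc}}(\mathbb R^d;\mathbb R^d)$ and assume that $\|\nabla_{\mathbf A}\psi\|_2^2\ge\Lambda\|\psi\|_2^2$ for all $\psi\in\mathrm H^1_{\mathbf A}(\mathbb R^d)$ for some $\Lambda=\Lambda[\mathbf B]>0$, with equality for some nonzero $\psi\in\mathrm H^1_{\mathbf A}(\mathbb R^d)$. For any $p\in(1,2)$ and any $\beta>0$, let $\nu_{\mathbf B}(\beta)$ be the largest constant such that $$\|\nabla_{\mathbf A}\psi\|_2^2+\beta\|\psi\|_p^2\ge\nu_{\mathbf B}(\beta)\,\|\psi\|_2^2\quad\forall\,\psi\in\mathrm H^1_{\mathbf A}(\mathbb R^d).$$ Then $$\nu_{\mathbf B}(\beta)\ge\nu_{\mathrm{interp}}(\beta),$$ where, with $\beta_\star:=\Big(\frac{2p+d(2-p)}{d(2-p)}\,\Lambda\,\mathsf C_p^{-1}\Big)^{\frac{2p+d(2-p)}{2p}}$, $$\nu_{\mathrm{interp}}(\beta):=\begin{cases}\mathsf C_p\,\beta^{\frac{2p}{2p+d(2-p)}}&\text{if }\beta\ge\beta_\star,\\[6pt]\Lambda+\beta\,\Lambda^{\frac{d(p-2)}{2p}}\,\frac{2p}{d(2-p)}\,\Big(\frac{d(2-p)}{2p+d(2-p)}\Big)^{\frac{2p+d(2-p)}{2p}}\,\mathsf C_p^{\frac{2p+d(2-p)}{2p}}&\text{if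 }\beta\in[0,\beta_\star].\end{cases}$$
   Context: $\|\cdot\|_q$ is the norm of $\mathrm L^q(\mathbb R^d)$, with $\|\psi\|_q=+\infty$ if $\psi\notin\mathrm L^q(\mathbb R^d)$. $\nabla_{\mathbf A}:=\nabla+i\mathbf A$ and $\mathrm H^1_{\mathbf A}(\mathbb R^d):=\{\psi\in\mathrm L^2(\mathbb R^d;\mathbb C):\nabla_{\mathbf A}\psi\in\mathrm L^2(\mathbb R^d)\}$. For $p\in(1,2)$, $\mathsf C_p$ is the optimal constant in $\|\nabla u\|_2^2+\|u\|_p^2\ge\mathsf C_p\,\|u\|_2^2$ for all $u\in\mathrm H^1(\mathbb R^d)\cap\mathrm L^p(\mathbb R^d)$, i.e. $\mathsf C_p:=\min_{u\in\mathrm H^1(\mathbb R^d)\setminus\{0\}}\frac{\|\nabla u\|_2^2+\|u\|_p^2}{\|u\|_2^2}$. *)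

theory Defs
  imports "HOL-Analysis.Analysis"
begin

section \<open>Lebesgue spaces\<close>

text \<open>
  Elements are functions, not classes of functions; ``nonzero in \<open>L\<^sup>q\<close>'' is written out
  below as ``not almost everywhere zero''.
\<close>

definition Lq_space :: "real \<Rightarrow> ('a::euclidean_space \<Rightarrow> 'b::real_normed_vector) set" where
  "Lq_space q = {f. f \<in> borel_measurable lebesgue \<and> integrable lebesgue (\<lambda>x. norm (f x) powr q)}"

definition Lq_loc :: "real \<Rightarrow> ('a::euclidean_space \<Rightarrow> 'b::real_normed_vector) set" where
  "Lq_loc q = {f. f \<in> borel_measurable lebesgue \<and>
     (\<forall>K. compact K \<longrightarrow> set_integrable lebesgue K (\<lambda>x. norm (f x) powr q))}"

text \<open>The convention is that the norm is \<open>+\<infinity>\<close> off \<open>L\<^sup>q\<close>; hence the type \<^typ>\<open>ereal\<close>.\<close>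

definition Lq_norm :: "real \<Rightarrow> ('a::euclidean_space \<Rightarrow> 'b::real_normed_vector) \<Rightarrow> ereal" where
  "Lq_norm q f =
     (if f \<in> Lq_space q then ereal ((LINT x|lebesgue. norm (f x) powr q) powr (1 / q)) else \<infinity>)"


section \<open>Test functions\<close>

definition pderiv_at :: "'n \<Rightarrow> (real ^ 'n \<Rightarrow> real) \<Rightarrow> real ^ 'n \<Rightarrow> real" where
  "pderiv_at j \<phi> x = frechet_derivative \<phi> (at x) (axis j 1)"

primrec C_order :: "nat \<Rightarrow> (real ^ 'n \<Rightarrow> real) \<Rightarrow> bool" where
  "C_order 0 \<phi> \<longleftrightarrow> continuous_on UNIV \<phi>"
| "C_order (Suc k) \<phi> \<longleftrightarrow> (\<forall>x. \<phi> differentiable at x) \<and> (\<forall>j. C_order k (pderiv_at j \<phi>))"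

definition test_functions :: "(real ^ 'n \<Rightarrow> real) set" where
  "test_functions = {\<phi>. (\<forall>k. C_order k \<phi>) \<and> compact (closure {x. \<phi> x \<noteq> 0})}"


section \<open>Magnetic gradient and magnetic Sobolev space\<close>

text \<open>
  \<open>\<nabla>\<psi> + i A \<psi>\<close>, taken in the sense of distributions, is represented by the locally integrable
  function \<open>g\<close>.  Real test functions suffice by linearity.
\<close>

definition is_magnetic_gradient ::
    "(real ^ 'n \<Rightarrow> real ^ 'n) \<Rightarrow> (real ^ 'n \<Rightarrow> complex) \<Rightarrow> (real ^ 'n \<Rightarrow> complex ^ 'n) \<Rightarrow> bool" where
  "is_magnetic_gradient A \<psi> g \<longleftrightarrow> g \<in> Lq_loc 1 \<and>
     (\<forall>\<phi>\<in>test_functions. \<forall>j.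
        (LINT x|lebesgue. g x $ j * of_real (\<phi> x)) =
        - (LINT x|lebesgue. \<psi> x * of_real (pderiv_at j \<phi> x))
        + (LINT x|lebesgue. \<i> * of_real (A x $ j) * \<psi> x * of_real (\<phi> x)))"

text \<open>The choice of representative is immaterial: \<open>g\<close> above is unique almost everywhere.\<close>

definition mgrad ::
    "(real ^ 'n \<Rightarrow> real ^ 'n) \<Rightarrow> (real ^ 'n \<Rightarrow> complex) \<Rightarrow> real ^ 'n \<Rightarrow> complex ^ 'n" where
  "mgrad A \<psi> = (SOME g. is_magnetic_gradient A \<psi> g)"

definition H1_mag :: "(real ^ 'n \<Rightarrow> real ^ 'n) \<Rightarrow> (real ^ 'n \<Rightarrow> complex) set" where
  "H1_mag A =
     {\<psi> \<in> Lq_space 2. (\<exists>g. is_magnetic_gradient A \<psi> g) \<and> mgrad A \<psi> \<in> Lq_space 2}"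

abbreviation grad :: "(real ^ 'n \<Rightarrow> complex) \<Rightarrow> real ^ 'n \<Rightarrow> complex ^ 'n" where
  "grad \<equiv> mgrad (\<lambda>_. 0)"

abbreviation H1 :: "(real ^ 'n \<Rightarrow> complex) set" where
  "H1 \<equiv> H1_mag (\<lambda>_. 0)"

text \<open>
  For \<open>A\<close> merely locally integrable, \<open>curl A\<close> is a distribution, given here as the matrix of its
  components \<open>\<partial>\<^sub>j A\<^sub>k - \<partial>\<^sub>k A\<^sub>j\<close> tested against \<open>\<phi>\<close>.  In dimension 2 the scalar
  field is the entry \<open>(1,2)\<close>; in dimension 3 the vector field has the entries
  \<open>(2,3)\<close>, \<open>(3,1)\<close>, \<open>(1,2)\<close> as components.
\<close>

definition curl :: "(real ^ 'n \<Rightarrow> real ^ 'n) \<Rightarrow> (real ^ 'n \<Rightarrow> real) \<Rightarrow> real ^ 'n ^ 'n" where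
  "curl A \<phi> =
     (\<chi> j k. LINT x|lebesgue. A x $ j * pderiv_at k \<phi> x - A x $ k * pderiv_at j \<phi> x)"


section \<open>The constants\<close>

text \<open>
  The quotient is \<open>+\<infinity>\<close> when \<open>u \<notin> L\<^sup>p\<close>, so the infimum is taken in \<^typ>\<open>ereal\<close>; its value
  is finite.
\<close>

definition C_opt :: "'n::finite itself \<Rightarrow> real \<Rightarrow> real" where
  "C_opt _ p = real_of_ereal
     (INF u \<in> {u \<in> H1 :: (real ^ 'n \<Rightarrow> complex) set. \<not> (AE x in lebesgue. u x = 0)}.
        ((Lq_norm 2 (grad u))\<^sup>2 + (Lq_norm p u)\<^sup>2) / (Lq_norm 2 u)\<^sup>2)"

definition nu_mag :: "(real ^ 'n \<Rightarrow> real ^ 'n) \<Rightarrow> real \<Rightarrow> real \<Rightarrow> real" where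
  "nu_mag A p \<beta> = (GREATEST c. \<forall>\<psi>\<in>H1_mag A.
     (Lq_norm 2 (mgrad A \<psi>))\<^sup>2 + ereal \<beta> * (Lq_norm p \<psi>)\<^sup>2 \<ge> ereal c * (Lq_norm 2 \<psi>)\<^sup>2)"

definition beta_star :: "real \<Rightarrow> real \<Rightarrow> real \<Rightarrow> real \<Rightarrow> real" where
  "beta_star d p \<Lambda> C =
     ((2 * p + d * (2 - p)) / (d * (2 - p)) * \<Lambda> * inverse C) powr ((2 * p + d * (2 - p)) / (2 * p))"

text \<open>Meant for \<open>\<beta> \<ge> 0\<close>; the two expressions agree at \<open>\<beta> = beta_star d p \<Lambda> C\<close>.\<close>

definition nu_interp :: "real \<Rightarrow> real \<Rightarrow> real \<Rightarrow> real \<Rightarrow> real \<Rightarrow> real" where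
  "nu_interp d p \<Lambda> C \<beta> =
     (if \<beta> \<ge> beta_star d p \<Lambda> C
      then C * \<beta> powr (2 * p / (2 * p + d * (2 - p)))
      else \<Lambda> + \<beta> * \<Lambda> powr (d * (p - 2) / (2 * p)) * (2 * p / (d * (2 - p)))
             * (d * (2 - p) / (2 * p + d * (2 - p))) powr ((2 * p + d * (2 - p)) / (2 * p))
             * C powr ((2 * p + d * (2 - p)) / (2 * p)))"

end

theory Submission
  imports Defs
begin

text \<open>
  By the diamagnetic inequality, \<open>u = |\<psi>|\<close> satisfies \<open>\<parallel>\<nabla>u\<parallel> \<le> \<parallel>\<nabla>\<^sub>A \<psi>\<parallel>\<close>.  Dilating \<open>u\<close> in the
  inequality that defines \<open>C\<^sub>p\<close> gives \<open>\<parallel>\<nabla>\<^sub>A \<psi>\<parallel>\<^sup>2 + \<mu> \<parallel>\<psi>\<parallel>\<^sub>p\<^sup>2 \<ge> C\<^sub>p \<mu> powr \<theta> \<parallel>\<psi>\<parallel>\<^sup>2\<close> with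
  \<open>\<theta> = 2 p / (2 p + d (2 - p))\<close>, for every \<open>\<mu> > 0\<close>.  Adding \<open>t\<close> times this with \<open>\<mu> = \<beta> / t\<close> to \<open>1 - t\<close> times
  the spectral gap inequality yields the lower bound \<open>(1 - t) \<Lambda> + t C\<^sub>p (\<beta> / t) powr \<theta>\<close>, whose maximum over
  \<open>0 < t \<le> 1\<close> is attained at \<open>t = min 1 (\<beta> / \<beta>\<^sub>\<star>)\<close>.

  For the diamagnetic inequality, a weak derivative of \<open>\<psi>\<close> turns difference quotients of \<open>\<psi>\<close> into
  averages along segments, which converge in \<open>L\<^sup>1\<close>; the chain rule for \<open>sqrt (|\<psi>|\<^sup>2 + \<epsilon>\<^sup>2)\<close> then follows from an
  explicit formula for its difference quotients.
\<close>

section \<open>Smooth functions\<close>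

text \<open>As \<open>A\<close> is only locally square integrable, \<open>A \<psi>\<close>, and with
  it the plain gradient of \<open>\<psi>\<close>, is merely locally integrable; square integrability
  returns only after pairing with the phase of \<open>\<psi>\<close> and taking real parts. This is
  why the calculus of weak derivatives runs in L^1 on compact sets. It uses Borel representatives,
  for which translates and product integrals are measurable. Three constants of the statement carry
  a default: \<open>mgrad\<close> is a choice, so weak gradients are shown to be unique almost
  everywhere; \<open>C_opt\<close> is the real value of an extended infimum, hence 0 if that infimum
  is 0 or infinite, and then the interpolated bound collapses to 0; \<open>nu_mag\<close> is a
  greatest element, whose existence requires a nonzero competitor of finite energy. The exponent
  \<theta> < 1 is forced by scaling. The curve C \<beta>^\<theta> is concave, and
  \<open>beta_star\<close> is the abscissa at which the line through (0, \<Lambda>) is tangent to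
  it; below that point the bound follows this line.\<close>

text \<open>The polynomial is a parameter because this family is closed under differentiation, so
  smoothness of exp(-1/t), extended by 0, is an induction with \<open>P\<close> arbitrary.\<close>

definition flat_exp :: "real poly \<Rightarrow> real \<Rightarrow> real" where
  "flat_exp P t = (if t > 0 then poly P (1 / t) * exp (- (1 / t)) else 0)"

lemma poly_times_exp_minus_tendsto_0:
  fixes P :: "real poly"
  shows "((\<lambda>s. poly P s * exp (- s)) \<longlongrightarrow> 0) at_top"
proof -
  have "((\<lambda>s. \<Sum>i\<le>degree P. coeff P i * (s ^ i / exp s)) \<longlongrightarrow> (\<Sum>i\<le>degree P. coeff P i * 0)) at_top"
    by (intro tendsto_sum tendsto_mult tendsto_const tendsto_power_div_exp_0)
  moreover have "(\<Sum>i\<le>degree P. coeff P i * (s ^ i / exp s)) = poly P s * exp (- s)" for s :: real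
    by (simp add: poly_altdef sum_distrib_right exp_minus divide_inverse mult.assoc)
  ultimately show ?thesis by simp
qed

text \<open>With s = 1/t, the factor \<open>[:0,0,1:]\<close> is s^2, the inner derivative up to
  sign, and \<open>P - pderiv P\<close> comes from the product rule. Only t = 0 needs a
  limit.\<close>

lemma flat_exp_deriv:
  "(flat_exp P has_field_derivative flat_exp ([:0,0,1:] * (P - pderiv P)) t) (at t)"
proof (cases t "0::real" rule: linorder_cases)
  case less
  have "((\<lambda>_. 0) has_field_derivative 0) (at t)" by simp
  then have "(flat_exp P has_field_derivative 0) (at t)"
    by (rule DERIV_cong_ev[OF refl _ refl, THEN iffD1, rotated])
      (auto simp: flat_exp_def eventually_nhds intro!: exI[of _ "{..<0}"] less)
  then show ?thesis using less by (simp add: flat_exp_def)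
next
  case greater
  have "((\<lambda>t. poly P (1 / t) * exp (- (1 / t))) has_field_derivative
     poly ([:0,0,1:] * (P - pderiv P)) (1 / t) * exp (- (1 / t))) (at t)"
    using greater
    by (auto intro!: derivative_eq_intros simp: field_simps power2_eq_square)
  then have "(flat_exp P has_field_derivative
     poly ([:0,0,1:] * (P - pderiv P)) (1 / t) * exp (- (1 / t))) (at t)"
    by (rule DERIV_cong_ev[OF refl _ refl, THEN iffD1, rotated])
      (auto simp: flat_exp_def eventually_nhds intro!: exI[of _ "{0<..}"] greater)
  then show ?thesis using greater by (simp add: flat_exp_def)
next
  case equal
  have right: "((\<lambda>h. flat_exp P h / h) \<longlongrightarrow> 0) (at_right 0)"
  proof -
    \<comment> \<open>\<open>pCons 0 P\<close> is s P(s); with s = 1/h it absorbs the division by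
      h.\<close>
    have "((\<lambda>h. poly (pCons 0 P) (inverse h) * exp (- inverse h)) \<longlongrightarrow> 0) (at_right (0::real))"
      by (rule filterlim_compose[OF poly_times_exp_minus_tendsto_0 filterlim_inverse_at_top_right])
    then show ?thesis
      by (rule Lim_transform_eventually)
        (auto simp: eventually_at_filter flat_exp_def field_simps)
  qed
  have left: "((\<lambda>h. flat_exp P h / h) \<longlongrightarrow> 0) (at_left 0)"
    by (rule Lim_transform_eventually[OF tendsto_const])
      (auto simp: eventually_at_filter flat_exp_def)
  have "((\<lambda>h. flat_exp P h / h) \<longlongrightarrow> 0) (at 0)"
    using left right by (rule filterlim_split_at)
  then show ?thesis using equal by (simp add: has_field_derivative_iff flat_exp_def)
qed

section \<open>Partial derivatives and functions of class C^k\<close>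

lemma pderiv_at_eq:
  assumes "(\<phi> has_derivative D) (at x)"
  shows "pderiv_at j \<phi> x = D (axis j 1)"
  unfolding pderiv_at_def using frechet_derivative_at[OF assms] by simp

lemma C_order_imp_continuous: "C_order k \<phi> \<Longrightarrow> continuous_on UNIV \<phi>"
  by (cases k) (auto simp: continuous_on_eq_continuous_at intro: differentiable_imp_continuous_within)

text \<open>\<open>C_order (Suc k)\<close> asks for differentiability rather than for
  \<open>C_order k\<close>, so monotonicity in k is an induction whose base is continuity of
  differentiable functions.\<close>

lemma C_order_SucD: "C_order (Suc k) \<phi> \<Longrightarrow> C_order k \<phi>"
proof (induction k arbitrary: \<phi>)
  case 0
  then show ?case using C_order_imp_continuous[OF 0] by simp
next
  case (Suc k)
  from Suc.prems have "\<forall>x. \<phi> differentiable at x" "\<forall>j. C_order (Suc k) (pderiv_at j \<phi>)" by auto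
  then show ?case using Suc.IH by simp
qed

lemma C_order_const: "C_order k (\<lambda>_. c)"
proof (induction k arbitrary: c)
  case (Suc k)
  have "pderiv_at j (\<lambda>_. c) = (\<lambda>_. 0)" for j :: 'a
    by (rule ext) (subst pderiv_at_eq[OF has_derivative_const], simp)
  then show ?case using Suc by simp
qed simp

lemma pderiv_at_add:
  assumes "f differentiable at x" "g differentiable at x"
  shows "pderiv_at j (\<lambda>x. f x + g x) x = pderiv_at j f x + pderiv_at j g x"
  unfolding pderiv_at_def[of j f] pderiv_at_def[of j g]
  by (subst pderiv_at_eq[OF has_derivative_add[OF assms[unfolded frechet_derivative_works]]]) simp

lemma pderiv_at_mult:
  assumes "f differentiable at x" "g differentiable at x"
  shows "pderiv_at j (\<lambda>x. f x * g x) x = f x * pderiv_at j g x + pderiv_at j f x * g x"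
  unfolding pderiv_at_def[of j f] pderiv_at_def[of j g]
  by (subst pderiv_at_eq[OF has_derivative_mult[OF assms[unfolded frechet_derivative_works]]]) simp

lemma C_order_add: "C_order k f \<Longrightarrow> C_order k g \<Longrightarrow> C_order k (\<lambda>x. f x + g x)"
proof (induction k arbitrary: f g)
  case (Suc k)
  then have d: "\<And>x. f differentiable at x" "\<And>x. g differentiable at x" by auto
  have "pderiv_at j (\<lambda>x. f x + g x) = (\<lambda>x. pderiv_at j f x + pderiv_at j g x)" for j
    by (rule ext) (rule pderiv_at_add[OF d])
  then show ?case using Suc d by simp
qed (simp add: continuous_on_add)

lemma C_order_mult: "C_order k f \<Longrightarrow> C_order k g \<Longrightarrow> C_order k (\<lambda>x. f x * g x)"
proof (induction k arbitrary: f g)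
  case (Suc k)
  then have d: "\<And>x. f differentiable at x" "\<And>x. g differentiable at x" by auto
  have "pderiv_at j (\<lambda>x. f x * g x) = (\<lambda>x. f x * pderiv_at j g x + pderiv_at j f x * g x)" for j
    by (rule ext) (rule pderiv_at_mult[OF d])
  then show ?case using Suc d C_order_SucD[OF Suc.prems(1)] C_order_SucD[OF Suc.prems(2)]
    by (simp add: C_order_add)
qed (simp add: continuous_on_mult)

lemma C_order_prod:
  "finite I \<Longrightarrow> (\<And>i. i \<in> I \<Longrightarrow> C_order k (f i)) \<Longrightarrow> C_order k (\<lambda>x. \<Prod>i\<in>I. f i x)"
  by (induction I rule: finite_induct) (auto intro: C_order_const C_order_mult)

lemma pderiv_at_affine:
  fixes \<phi> :: "real ^ 'n \<Rightarrow> real"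
  assumes "\<phi> differentiable at (c *\<^sub>R x + v)"
  shows "pderiv_at j (\<lambda>x. \<phi> (c *\<^sub>R x + v)) x = c * pderiv_at j \<phi> (c *\<^sub>R x + v)"
proof -
  let ?D = "frechet_derivative \<phi> (at (c *\<^sub>R x + v))"
  have D: "(\<phi> has_derivative ?D) (at (c *\<^sub>R x + v))"
    using assms by (simp add: frechet_derivative_works)
  have "((\<lambda>x. c *\<^sub>R x + v) has_derivative (\<lambda>h. c *\<^sub>R h)) (at x)"
    by (auto intro!: derivative_eq_intros)
  from has_derivative_compose[OF this D]
  have "pderiv_at j (\<lambda>x. \<phi> (c *\<^sub>R x + v)) x = ?D (c *\<^sub>R axis j 1)"
    by (rule pderiv_at_eq)
  also have "\<dots> = c *\<^sub>R ?D (axis j 1)"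
    using D has_derivative_bounded_linear linear_cmul bounded_linear.linear by blast
  finally show ?thesis by (simp add: pderiv_at_def)
qed

lemma C_order_affine:
  fixes \<phi> :: "real ^ 'n \<Rightarrow> real"
  shows "C_order k \<phi> \<Longrightarrow> C_order k (\<lambda>x. \<phi> (c *\<^sub>R x + v))"
proof (induction k arbitrary: \<phi>)
  case 0
  then show ?case
    by (auto intro!: continuous_on_compose2[of UNIV \<phi>] continuous_intros)
next
  case (Suc k)
  then have d: "\<And>x. \<phi> differentiable at x" by auto
  have "(\<lambda>x. \<phi> (c *\<^sub>R x + v)) differentiable at x" for x
    by (rule differentiable_compose[of \<phi>]) (auto intro: d derivative_intros)
  moreover have "pderiv_at j (\<lambda>x. \<phi> (c *\<^sub>R x + v)) = (\<lambda>x. c * pderiv_at j \<phi> (c *\<^sub>R x + v))" for j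
    by (rule ext) (rule pderiv_at_affine[OF d])
  moreover have "C_order k (\<lambda>x. pderiv_at j \<phi> (c *\<^sub>R x + v))" for j
    using Suc by auto
  ultimately show ?case by (simp add: C_order_mult[OF C_order_const])
qed

lemma C_order_flat_exp: "C_order k (\<lambda>x :: real ^ 'n. flat_exp P (a * x $ i + b))"
proof -
  have D: "((\<lambda>x :: real ^ 'n. flat_exp P (a * x $ i + b)) has_derivative
      (\<lambda>h. flat_exp ([:0,0,1:] * (P - pderiv P)) (a * x $ i + b) * (a * h $ i))) (at x)" for x P
    by (rule has_derivative_compose[OF _ flat_exp_deriv[unfolded has_field_derivative_def]])
      (auto intro!: derivative_eq_intros bounded_linear_imp_has_derivative bounded_linear_vec_nth)
  show ?thesis
  proof (induction k arbitrary: P)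
    case 0
    show ?case
      unfolding C_order.simps continuous_on_eq_continuous_at[OF open_UNIV]
      using D has_derivative_continuous by blast
  next
    case (Suc k)
    have "pderiv_at j (\<lambda>x :: real ^ 'n. flat_exp P (a * x $ i + b)) =
        (\<lambda>x. flat_exp ([:0,0,1:] * (P - pderiv P)) (a * x $ i + b) * (a * axis j 1 $ i))" for j
      by (rule ext) (rule pderiv_at_eq[OF D])
    then show ?case using D
      by (auto simp: differentiable_def simp del: mult_pCons_left intro!: C_order_mult C_order_const Suc)
  qed
qed

section \<open>Test functions and smooth approximations of indicators of boxes\<close>

lemma test_functionsI:
  fixes \<phi> :: "real ^ 'n \<Rightarrow> real"
  assumes "\<And>k. C_order k \<phi>" "\<And>x. \<phi> x \<noteq> 0 \<Longrightarrow> x \<in> S" "bounded S"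
  shows "\<phi> \<in> test_functions"
proof -
  have "bounded {x. \<phi> x \<noteq> 0}"
    by (rule bounded_subset[OF assms(3)]) (use assms(2) in auto)
  then show ?thesis using assms(1) by (simp add: test_functions_def)
qed

text \<open>Used with c = 1 for translations in difference quotients and with c = 1/l for
  dilations.\<close>

lemma test_functions_affine:
  fixes \<phi> :: "real ^ 'n \<Rightarrow> real"
  assumes "\<phi> \<in> test_functions" "c \<noteq> 0"
  shows "(\<lambda>x. \<phi> (c *\<^sub>R x + v)) \<in> test_functions"
proof (rule test_functionsI)
  show "C_order k (\<lambda>x. \<phi> (c *\<^sub>R x + v))" for k
    using assms by (intro C_order_affine) (simp add: test_functions_def)
  show "bounded ((\<lambda>y. (1 / c) *\<^sub>R (y - v)) ` {y. \<phi> y \<noteq> 0})"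
    using bounded_scaling[OF bounded_translation_minus, of "{y. \<phi> y \<noteq> 0}" "1 / c" v] assms
    by (simp add: test_functions_def image_image)
  fix x assume "\<phi> (c *\<^sub>R x + v) \<noteq> 0"
  then show "x \<in> (\<lambda>y. (1 / c) *\<^sub>R (y - v)) ` {y. \<phi> y \<noteq> 0}"
    using assms(2) by (intro image_eqI[of _ _ "c *\<^sub>R x + v"]) auto
qed

lemma test_functions_differentiable: "\<phi> \<in> test_functions \<Longrightarrow> \<phi> differentiable at x"
  by (auto simp: test_functions_def dest: spec[of _ "Suc 0"])

lemma test_functions_continuous: "\<phi> \<in> test_functions \<Longrightarrow> continuous_on UNIV \<phi>"
  by (auto simp: test_functions_def intro: C_order_imp_continuous)

lemma pderiv_test_function:
  fixes \<phi> :: "real ^ 'n \<Rightarrow> real"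
  assumes "\<phi> \<in> test_functions"
  shows "pderiv_at j \<phi> \<in> test_functions"
proof (rule test_functionsI)
  show "C_order k (pderiv_at j \<phi>)" for k
    using assms C_order.simps(2)[of k \<phi>] by (auto simp: test_functions_def simp del: C_order.simps)
  show "bounded (closure {x. \<phi> x \<noteq> 0})"
    using assms by (auto simp: test_functions_def simp del: compact_closure intro: compact_imp_bounded)
  fix x assume nz: "pderiv_at j \<phi> x \<noteq> 0"
  show "x \<in> closure {x. \<phi> x \<noteq> 0}"
  proof (rule ccontr)
    assume x: "x \<notin> closure {x. \<phi> x \<noteq> 0}"
    have "((\<lambda>_. 0) has_derivative (\<lambda>_. 0)) (at x)" by simp
    then have "(\<phi> has_derivative (\<lambda>_. 0)) (at x)"
      by (rule has_derivative_transform_within_open[of _ _ _ _ "- closure {x. \<phi> x \<noteq> 0}"])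
        (use x closure_subset[of "{x. \<phi> x \<noteq> 0}"] in auto)
    from pderiv_at_eq[OF this] nz show False by simp
  qed
qed

text \<open>For t > 0, exp(-1/(n t)) tends to 1, and the function vanishes for every n when t <= 0.
  A product of such factors, one for each face of the box, is therefore positive exactly inside the
  box and converges to its indicator.\<close>

lemma bump_function:
  fixes a b :: "real ^ 'n"
  obtains \<phi> :: "nat \<Rightarrow> real ^ 'n \<Rightarrow> real"
  where "\<And>n. \<phi> n \<in> test_functions" "\<And>n x. 0 \<le> \<phi> n x \<and> \<phi> n x \<le> 1"
    "\<And>n x. \<phi> n x \<noteq> 0 \<longleftrightarrow> x \<in> box a b" "\<And>x. (\<lambda>n. \<phi> n x) \<longlonglongrightarrow> indicator (box a b) x"
proof
  define e where "e = flat_exp 1"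
  have e01: "0 \<le> e t" "e t \<le> 1" for t by (auto simp: e_def flat_exp_def)
  have e0: "e t = 0 \<longleftrightarrow> t \<le> 0" for t by (auto simp: e_def flat_exp_def)
  have elim: "(\<lambda>n. e (real (Suc n) * t)) \<longlonglongrightarrow> (if t > 0 then 1 else 0)" for t
  proof (cases "t > 0")
    case True
    have "(\<lambda>n. exp (- ((1 / t) * inverse (real (Suc n))))) \<longlonglongrightarrow> exp (- ((1 / t) * 0))"
      by (intro tendsto_intros LIMSEQ_inverse_real_of_nat)
    then show ?thesis using True by (simp add: e_def flat_exp_def divide_inverse mult.commute)
  next
    case False
    then have "e (real (Suc n) * t) = 0" for n
      by (subst e0) (auto intro: mult_nonneg_nonpos)
    then show ?thesis using False by simp
  qed
  define \<phi> where "\<phi> n x = (\<Prod>i\<in>UNIV. e (real (Suc n) * (x $ i - a $ i)) * e (real (Suc n) * (b $ i - x $ i)))"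
    for n :: nat and x :: "real ^ 'n"
  show nz: "\<phi> n x \<noteq> 0 \<longleftrightarrow> x \<in> box a b" for n x
    by (auto simp: \<phi>_def e0 mem_box_cart mult_le_0_iff not_le)
  show "\<phi> n \<in> test_functions" for n
  proof (rule test_functionsI)
    show "bounded (box a b)" by (rule bounded_box)
    show "x \<in> box a b" if "\<phi> n x \<noteq> 0" for x using that nz by simp
    \<comment> \<open>The arguments are expanded into the shape \<open>a * x $ i + b\<close> that
      \<open>C_order_flat_exp\<close> expects.\<close>
    have "C_order k (\<lambda>x. (\<Prod>i\<in>UNIV. e (real (Suc n) * x $ i + - real (Suc n) * a $ i) * 
       e (- real (Suc n) * x $ i + real (Suc n) * b $ i)))" for k
      unfolding e_def by (intro C_order_prod C_order_mult C_order_flat_exp) auto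
    then show "C_order k (\<phi> n)" for k
      by (simp add: \<phi>_def[abs_def] algebra_simps)
  qed
  show "0 \<le> \<phi> n x \<and> \<phi> n x \<le> 1" for n x
    unfolding \<phi>_def by (auto intro!: prod_nonneg prod_le_1 mult_le_one simp: e01)
  show "(\<lambda>n. \<phi> n x) \<longlonglongrightarrow> indicator (box a b) x" for x
  proof -
    have "(\<lambda>n. \<phi> n x) \<longlonglongrightarrow> (\<Prod>i\<in>UNIV. (if x $ i - a $ i > 0 then 1 else 0) * (if b $ i - x $ i > 0 then 1 else 0))"
      unfolding \<phi>_def by (intro tendsto_prod tendsto_mult elim)
    also have "(\<Prod>i\<in>UNIV. (if x $ i - a $ i > 0 then 1 else 0) * (if b $ i - x $ i > 0 then 1 else (0::real)))
       = indicator (box a b) x"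
    proof (cases "x \<in> box a b")
      case True
      then show ?thesis by (simp add: mem_box_cart)
    next
      case False
      then obtain i where "\<not> (a $ i < x $ i \<and> x $ i < b $ i)" by (auto simp: mem_box_cart)
      then show ?thesis using False by (intro trans[OF prod_zero]) auto
    qed
    finally show ?thesis .
  qed
qed

section \<open>Translations and dilations in Lebesgue measure\<close>

lemma nn_integral_lborel_affine:
  fixes f :: "'a::euclidean_space \<Rightarrow> ennreal"
  assumes [measurable]: "f \<in> borel_measurable borel" and c: "c \<noteq> 0"
  shows "(\<integral>\<^sup>+x. f x \<partial>lborel) = ennreal (\<bar>c\<bar> ^ DIM('a)) * (\<integral>\<^sup>+x. f (c *\<^sub>R x + v) \<partial>lborel)"
  by (subst lborel_affine[OF c, of v])
    (simp add: nn_integral_density nn_integral_distr nn_integral_cmult add.commute)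

lemma integrable_lborel_affine:
  fixes f :: "'a::euclidean_space \<Rightarrow> 'b::{banach, second_countable_topology}"
  assumes f: "integrable lborel f" and c: "c \<noteq> 0"
  shows "integrable lborel (\<lambda>x. f (c *\<^sub>R x + v))"
proof -
  have [measurable]: "f \<in> borel_measurable borel" using f by (simp add: borel_measurable_integrable[of lborel, simplified])
  have "(\<integral>\<^sup>+x. norm (f x) \<partial>lborel) < \<infinity>" using f by (simp add: integrable_iff_bounded)
  then have "(\<integral>\<^sup>+x. norm (f (c *\<^sub>R x + v)) \<partial>lborel) < \<infinity>"
    using c by (subst (asm) nn_integral_lborel_affine[OF _ c, of _ v]) (auto simp: ennreal_mult_less_top)
  then show ?thesis by (simp add: integrable_iff_bounded)
qed

lemma integral_lborel_affine:
  fixes f :: "'a::euclidean_space \<Rightarrow> 'b::{banach, second_countable_topology}"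
  assumes [measurable]: "f \<in> borel_measurable borel" and c: "c \<noteq> 0"
  shows "(\<integral>x. f x \<partial>lborel) = \<bar>c\<bar> ^ DIM('a) *\<^sub>R (\<integral>x. f (c *\<^sub>R x + v) \<partial>lborel)"
  by (subst lborel_affine[OF c, of v])
    (simp add: integral_density integral_distr add.commute)

lemma integral_lborel_translate:
  fixes f :: "'a::euclidean_space \<Rightarrow> 'b::{banach, second_countable_topology}"
  assumes "f \<in> borel_measurable borel"
  shows "(\<integral>x. f (x + v) \<partial>lborel) = (\<integral>x. f x \<partial>lborel)"
  using integral_lborel_affine[OF assms, of 1 v] by simp

lemma integrable_lborel_translate:
  fixes f :: "'a::euclidean_space \<Rightarrow> 'b::{banach, second_countable_topology}"
  assumes "integrable lborel f"
  shows "integrable lborel (\<lambda>x. f (x + v))"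
  using integrable_lborel_affine[OF assms, of 1 v] by simp

section \<open>Continuity of translations in L^1\<close>

text \<open>Phrased with sequences of shifts, the form in which dominated convergence produces it
  and later consumes it.\<close>

definition translation_continuous :: "('a::euclidean_space \<Rightarrow> 'b::{banach, second_countable_topology}) \<Rightarrow> bool" where
  "translation_continuous f \<longleftrightarrow>
     (\<forall>h. h \<longlonglongrightarrow> 0 \<longrightarrow> (\<lambda>n. \<integral>x. norm (f (x + h n) - f x) \<partial>lborel) \<longlonglongrightarrow> 0)"

text \<open>Translation is an isometry of L^1, so the error of approximating f by g occurs twice,
  and three errors of size r/3 suffice.\<close>

lemma translation_continuous_approx:
  fixes f :: "'a::euclidean_space \<Rightarrow> 'b::{banach, second_countable_topology}"
  assumes f: "integrable lborel f"
    and appr: "\<And>e. e > 0 \<Longrightarrow> \<exists>g. integrable lborel g \<and> translation_continuous g \<and>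
      (\<integral>x. norm (f x - g x) \<partial>lborel) < e"
  shows "translation_continuous f"
  unfolding translation_continuous_def
proof (intro allI impI LIMSEQ_I)
  fix h :: "nat \<Rightarrow> 'a" and r :: real assume h: "h \<longlonglongrightarrow> 0" and r: "0 < r"
  obtain g where g: "integrable lborel g" "translation_continuous g"
    "(\<integral>x. norm (f x - g x) \<partial>lborel) < r / 3" using appr[of "r / 3"] r by auto
  then have "(\<lambda>n. \<integral>x. norm (g (x + h n) - g x) \<partial>lborel) \<longlonglongrightarrow> 0"
    using h by (auto simp: translation_continuous_def)
  from LIMSEQ_D[OF this, of "r / 3"] r obtain N where
    N: "\<And>n. n \<ge> N \<Longrightarrow> norm (\<integral>x. norm (g (x + h n) - g x) \<partial>lborel) < r / 3" by auto
  have "norm (\<integral>x. norm (f (x + h n) - f x) \<partial>lborel) < r" if "n \<ge> N" for n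
  proof -
    note ft = integrable_lborel_translate[OF f, of "h n"] and gt = integrable_lborel_translate[OF g(1), of "h n"]
    note i1 = integrable_norm[OF Bochner_Integration.integrable_diff[OF ft gt]]
      and i2 = integrable_norm[OF Bochner_Integration.integrable_diff[OF gt g(1)]]
      and i3 = integrable_norm[OF Bochner_Integration.integrable_diff[OF f g(1)]]
      and i4 = integrable_norm[OF Bochner_Integration.integrable_diff[OF ft f]]
    have [measurable]: "f \<in> borel_measurable borel" "g \<in> borel_measurable borel"
      using f g by (simp_all add: borel_measurable_integrable[of lborel, simplified])
    have "(\<integral>x. norm (f (x + h n) - f x) \<partial>lborel) \<le>
      (\<integral>x. norm (f (x + h n) - g (x + h n)) + norm (g (x + h n) - g x) + norm (f x - g x) \<partial>lborel)"
    proof (rule integral_mono)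
      show "norm (f (x + h n) - f x) \<le>
        norm (f (x + h n) - g (x + h n)) + norm (g (x + h n) - g x) + norm (f x - g x)" for x
        by norm
    qed (intro Bochner_Integration.integrable_add i1 i2 i3 i4)+
    also have "\<dots> = (\<integral>x. norm (f (x + h n) - g (x + h n)) \<partial>lborel) +
        (\<integral>x. norm (g (x + h n) - g x) \<partial>lborel) + (\<integral>x. norm (f x - g x) \<partial>lborel)"
      by (simp only: Bochner_Integration.integral_add[OF Bochner_Integration.integrable_add[OF i1 i2] i3]
          Bochner_Integration.integral_add[OF i1 i2])
    also have "(\<integral>x. norm (f (x + h n) - g (x + h n)) \<partial>lborel) = (\<integral>x. norm (f x - g x) \<partial>lborel)"
      by (rule integral_lborel_translate) measurable
    finally show ?thesis using g(3) N[OF that] by (simp add: integral_nonneg_AE)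
  qed
  then show "\<exists>no. \<forall>n\<ge>no. norm ((\<integral>x. norm (f (x + h n) - f x) \<partial>lborel) - 0) < r" by auto
qed

text \<open>Openness gives 1_U(x + h) -> 1 only for x in U. That is enough: for indicator values |a
  - b| = a + b - 2ab, so translation invariance reduces the claim to the integral of the product
  1_U(x + h) 1_U(x).\<close>

lemma translation_continuous_indicator_open:
  fixes U :: "'a::euclidean_space set" and c :: "'b::{banach, second_countable_topology}"
  assumes U: "open U" "emeasure lborel U < \<infinity>"
  shows "translation_continuous (\<lambda>x. indicator U x *\<^sub>R c)"
  unfolding translation_continuous_def
proof (intro allI impI)
  fix h :: "nat \<Rightarrow> 'a" assume h: "h \<longlonglongrightarrow> 0"
  have [measurable]: "U \<in> sets borel" using U by simp
  let ?i = "indicator U :: 'a \<Rightarrow> real"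
  have int: "integrable lborel ?i" using U by (simp add: integrable_indicator_iff)
  have int2: "integrable lborel (\<lambda>x. ?i (x + v))" for v by (rule integrable_lborel_translate[OF int])
  have int3: "integrable lborel (\<lambda>x. ?i (x + v) * ?i x)" for v
    by (rule Bochner_Integration.integrable_bound[OF int]) (auto split: split_indicator)
  have "(\<lambda>n. \<integral>x. ?i (x + h n) * ?i x \<partial>lborel) \<longlonglongrightarrow> (\<integral>x. ?i x \<partial>lborel)"
  proof (rule integral_dominated_convergence[where w="?i"])
    show "AE x in lborel. (\<lambda>n. ?i (x + h n) * ?i x) \<longlonglongrightarrow> ?i x"
    proof (rule AE_I2)
      fix x
      show "(\<lambda>n. ?i (x + h n) * ?i x) \<longlonglongrightarrow> ?i x"
      proof (cases "x \<in> U")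
        case True
        have "(\<lambda>n. x + h n) \<longlonglongrightarrow> x" using tendsto_add[OF tendsto_const h, of x] by simp
        then have "\<forall>\<^sub>F n in sequentially. x + h n \<in> U"
          using U(1) True by (rule topological_tendstoD)
        then show ?thesis
          by (intro tendsto_eventually) (auto elim!: eventually_mono simp: True)
      qed simp
    qed
  qed (use int in \<open>auto split: split_indicator\<close>)
  then have "(\<lambda>n. norm c * (2 * (\<integral>x. ?i x \<partial>lborel) - 2 * (\<integral>x. ?i (x + h n) * ?i x \<partial>lborel)))
     \<longlonglongrightarrow> norm c * (2 * (\<integral>x. ?i x \<partial>lborel) - 2 * (\<integral>x. ?i x \<partial>lborel))"
    by (intro tendsto_intros)
  moreover have "(\<integral>x. norm (?i (x + h n) *\<^sub>R c - ?i x *\<^sub>R c) \<partial>lborel) =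
     norm c * (2 * (\<integral>x. ?i x \<partial>lborel) - 2 * (\<integral>x. ?i (x + h n) * ?i x \<partial>lborel))" for n
  proof -
    have "(\<integral>x. norm (?i (x + h n) *\<^sub>R c - ?i x *\<^sub>R c) \<partial>lborel) =
       (\<integral>x. norm c * (?i (x + h n) + ?i x - 2 * (?i (x + h n) * ?i x)) \<partial>lborel)"
      by (intro Bochner_Integration.integral_cong) (auto split: split_indicator)
    also have "\<dots> = norm c * ((\<integral>x. ?i (x + h n) \<partial>lborel) + (\<integral>x. ?i x \<partial>lborel) -
        2 * (\<integral>x. ?i (x + h n) * ?i x \<partial>lborel))"
      using int int2 int3 by simp
    also have "(\<integral>x. ?i (x + h n) \<partial>lborel) = (\<integral>x. ?i x \<partial>lborel)"
      by (rule integral_lborel_translate) measurable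
    finally show ?thesis by simp
  qed
  ultimately show "(\<lambda>n. \<integral>x. norm (?i (x + h n) *\<^sub>R c - ?i x *\<^sub>R c) \<partial>lborel) \<longlonglongrightarrow> 0" by simp
qed

text \<open>Measurable sets are reduced to open ones by outer regularity; sums and dominated limits
  then give all integrable functions.\<close>

lemma integrable_imp_translation_continuous:
  fixes f :: "'a::euclidean_space \<Rightarrow> 'b::{banach, second_countable_topology}"
  assumes "integrable lborel f"
  shows "translation_continuous f"
  using assms
proof (induction rule: integrable_induct)
  case (base A c)
  then have A[measurable]: "A \<in> sets borel" by simp
  show ?case
  proof (rule translation_continuous_approx)
    show "integrable lborel (\<lambda>x. indicator A x *\<^sub>R c)"
      using base by (intro integrable_scaleR_left integrable_real_indicator) auto
    fix e :: real assume e: "e > 0"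
    \<comment> \<open>The summand 1 keeps the quotient meaningful when c = 0.\<close>
    define e' where "e' = e / (norm c + 1)"
    have e': "e' > 0" "norm c * e' < e"
      using e add_nonneg_pos[OF norm_ge_zero[of c] zero_less_one] by (simp_all add: e'_def field_simps)
    obtain U where U: "open U" "A \<subseteq> U" "emeasure lborel (U - A) < e'"
      using outer_regular_lborel[OF A e'(1)] by metis
    have [measurable]: "U \<in> sets borel" using U by simp
    have "emeasure lborel U \<le> emeasure lborel A + emeasure lborel (U - A)"
      using emeasure_subadditive[of A lborel "U - A"] U(2) by (simp add: Un_absorb1)
    also have "\<dots> < \<infinity>" using base U(3) order.strict_trans[OF U(3) ennreal_less_top] by simp
    finally have fin: "emeasure lborel U < \<infinity>" .
    have "(\<integral>x. norm (indicator A x *\<^sub>R c - indicator U x *\<^sub>R c) \<partial>lborel) =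
      (\<integral>x. indicator (U - A) x * norm c \<partial>lborel)"
      using U(2) by (intro Bochner_Integration.integral_cong) (auto split: split_indicator)
    also have "\<dots> = measure lborel (U - A) * norm c" by simp
    also have "\<dots> \<le> e' * norm c"
      using U(3) e' by (intro mult_right_mono) (auto simp: measure_def intro!: enn2real_leI)
    also have "\<dots> < e" using e'(2) by (simp add: mult.commute)
    finally have "(\<integral>x. norm (indicator A x *\<^sub>R c - indicator U x *\<^sub>R c) \<partial>lborel) < e" .
    moreover have "integrable lborel (\<lambda>x. indicator U x *\<^sub>R c)"
      using fin by (intro integrable_scaleR_left integrable_real_indicator) auto
    ultimately show "\<exists>g. integrable lborel g \<and> translation_continuous g \<and>
      (\<integral>x. norm (indicator A x *\<^sub>R c - g x) \<partial>lborel) < e"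
      using translation_continuous_indicator_open[OF U(1) fin] by blast
  qed
next
  case (add f g)
  show ?case unfolding translation_continuous_def
  proof (intro allI impI)
    fix h :: "nat \<Rightarrow> 'a" assume h: "h \<longlonglongrightarrow> 0"
    have *: "(\<lambda>n. (\<integral>x. norm (f (x + h n) - f x) \<partial>lborel) + (\<integral>x. norm (g (x + h n) - g x) \<partial>lborel)) \<longlonglongrightarrow> 0"
      using tendsto_add[of _ 0 sequentially _ 0] add h by (auto simp: translation_continuous_def)
    show "(\<lambda>n. \<integral>x. norm (f (x + h n) + g (x + h n) - (f x + g x)) \<partial>lborel) \<longlonglongrightarrow> 0"
    proof (rule tendsto_sandwich[OF _ _ tendsto_const *])
      show "\<forall>\<^sub>F n in sequentially. (\<integral>x. norm (f (x + h n) + g (x + h n) - (f x + g x)) \<partial>lborel) \<le>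
        (\<integral>x. norm (f (x + h n) - f x) \<partial>lborel) + (\<integral>x. norm (g (x + h n) - g x) \<partial>lborel)"
      proof (intro always_eventually allI)
        fix n
        note ft = integrable_lborel_translate[OF add(1), of "h n"]
          and gt = integrable_lborel_translate[OF add(2), of "h n"]
        note i1 = integrable_norm[OF Bochner_Integration.integrable_diff[OF ft add(1)]]
          and i2 = integrable_norm[OF Bochner_Integration.integrable_diff[OF gt add(2)]]
        show "(\<integral>x. norm (f (x + h n) + g (x + h n) - (f x + g x)) \<partial>lborel) \<le>
          (\<integral>x. norm (f (x + h n) - f x) \<partial>lborel) + (\<integral>x. norm (g (x + h n) - g x) \<partial>lborel)"
          unfolding Bochner_Integration.integral_add[OF i1 i2, symmetric]
          by (rule integral_mono) (intro integrable_norm Bochner_Integration.integrable_diff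
               Bochner_Integration.integrable_add ft gt add(1,2) norm_diff_triangle_ineq)+
      qed
    qed (simp add: integral_nonneg_AE)
  qed
next
  case (lim f s)
  show ?case
  proof (rule translation_continuous_approx[OF lim.hyps(4)])
    fix e :: real assume e: "e > 0"
    have [measurable]: "f \<in> borel_measurable borel" "\<And>i. s i \<in> borel_measurable borel"
      using lim.hyps(1,4) by (simp_all add: borel_measurable_integrable[of lborel, simplified])
    have "(\<lambda>i. \<integral>x. norm (f x - s i x) \<partial>lborel) \<longlonglongrightarrow> (\<integral>x. 0 \<partial>(lborel :: 'a measure))"
    proof (rule integral_dominated_convergence[where w="\<lambda>x. 3 * norm (f x)"])
      show "AE x in lborel. (\<lambda>i. norm (f x - s i x)) \<longlonglongrightarrow> 0"
        using lim.hyps(2) by (auto intro!: tendsto_norm_zero LIM_zero_cancel simp: tendsto_iff dist_norm norm_minus_commute)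
      show "AE x in lborel. norm (norm (f x - s i x)) \<le> 3 * norm (f x)" for i
      proof (rule AE_I2)
        fix x
        have "norm (f x - s i x) \<le> norm (f x) + norm (s i x)" by (rule norm_triangle_ineq4)
        also have "norm (s i x) \<le> 2 * norm (f x)" using lim.hyps(3) by simp
        finally show "norm (norm (f x - s i x)) \<le> 3 * norm (f x)" by simp
      qed
    qed (use lim.hyps in auto)
    from LIMSEQ_D[OF this e] obtain i where "norm (\<integral>x. norm (f x - s i x) \<partial>lborel) < e" by auto
    then show "\<exists>g. integrable lborel g \<and> translation_continuous g \<and>
      (\<integral>x. norm (f x - g x) \<partial>lborel) < e" using lim.hyps(1) lim.IH by auto
  qed
qed

section \<open>Locally integrable functions\<close>

text \<open>Borel rather than Lebesgue measurability is built in: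
  \<open>f (x + s *\<^sub>R v)\<close> is then jointly measurable in s and x, as the uses of Fubini
  require.\<close>

definition loc_integrable :: "('a::euclidean_space \<Rightarrow> 'b::{banach, second_countable_topology}) \<Rightarrow> bool" where
  "loc_integrable f \<longleftrightarrow> f \<in> borel_measurable borel \<and> (\<forall>K. compact K \<longrightarrow> set_integrable lborel K f)"

lemma loc_integrable_measurable: "loc_integrable f \<Longrightarrow> f \<in> borel_measurable borel"
  by (simp add: loc_integrable_def)

lemma loc_integrable_scaleR:
  fixes f :: "'a::euclidean_space \<Rightarrow> 'b::{banach, second_countable_topology}"
  assumes f: "loc_integrable f" and [measurable]: "g \<in> borel_measurable borel"
    and bound: "\<And>x. \<bar>g x\<bar> \<le> B" and supp: "\<And>x. x \<notin> K \<Longrightarrow> g x = 0" and K: "compact K"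
  shows "integrable lborel (\<lambda>x. g x *\<^sub>R f x)"
  supply loc_integrable_measurable[OF f, measurable]
proof (rule Bochner_Integration.integrable_bound)
  show "integrable lborel (\<lambda>x. B *\<^sub>R (indicator K x *\<^sub>R f x))"
    using f K by (intro integrable_scaleR_right) (auto simp: loc_integrable_def set_integrable_def)
  show "AE x in lborel. norm (g x *\<^sub>R f x) \<le> norm (B *\<^sub>R (indicator K x *\<^sub>R f x))"
  proof (rule AE_I2)
    fix x show "norm (g x *\<^sub>R f x) \<le> norm (B *\<^sub>R (indicator K x *\<^sub>R f x))"
      using bound[of x] supp[of x] by (cases "x \<in> K") (auto intro!: mult_right_mono)
  qed
qed measurable

lemma loc_integrable_bound:
  fixes f :: "'a::euclidean_space \<Rightarrow> 'b::{banach, second_countable_topology}"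
    and g :: "'a \<Rightarrow> 'c::{banach, second_countable_topology}"
  assumes f: "loc_integrable f" and [measurable]: "g \<in> borel_measurable borel"
    and bound: "\<And>x. norm (g x) \<le> norm (f x)"
  shows "loc_integrable g"
  supply loc_integrable_measurable[OF f, measurable]
  unfolding loc_integrable_def set_integrable_def
proof (intro conjI allI impI)
  fix K :: "'a set" assume K: "compact K"
  then have [measurable]: "K \<in> sets borel" by (simp add: borel_compact)
  show "integrable lborel (\<lambda>x. indicator K x *\<^sub>R g x)"
    by (rule Bochner_Integration.integrable_bound[of _ "\<lambda>x. indicator K x *\<^sub>R f x"])
      (use f K bound in \<open>auto simp: loc_integrable_def set_integrable_def intro!: mult_left_mono\<close>)
qed measurable

lemma continuous_loc_integrable:
  fixes f :: "'a::euclidean_space \<Rightarrow> 'b::{banach, second_countable_topology}"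
  assumes f: "continuous_on UNIV f"
  shows "loc_integrable f"
  unfolding loc_integrable_def
  using f continuous_on_subset[OF f]
  by (auto intro: borel_integrable_compact borel_measurable_continuous_onI simp: set_integrable_def)

lemma loc_integrable_add:
  fixes f :: "'a::euclidean_space \<Rightarrow> 'b::{banach, second_countable_topology}"
  shows "loc_integrable f \<Longrightarrow> loc_integrable g \<Longrightarrow> loc_integrable (\<lambda>x. f x + g x)"
  by (auto simp: loc_integrable_def)

lemma loc_integrable_translate:
  fixes f :: "'a::euclidean_space \<Rightarrow> 'b::{banach, second_countable_topology}"
  assumes f: "loc_integrable f"
  shows "loc_integrable (\<lambda>x. f (x + v))"
  unfolding loc_integrable_def set_integrable_def
proof (intro conjI allI impI)
  note [measurable] = loc_integrable_measurable[OF f]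
  show "(\<lambda>x. f (x + v)) \<in> borel_measurable borel" by measurable
  fix K :: "'a set" assume "compact K"
  then have "compact ((+) v ` K)" by (rule compact_translation)
  then have "integrable lborel (\<lambda>x. indicator ((+) v ` K) x *\<^sub>R f x)"
    using f by (auto simp: loc_integrable_def set_integrable_def)
  then have "integrable lborel (\<lambda>x. indicator ((+) v ` K) (x + v) *\<^sub>R f (x + v))"
    by (rule integrable_lborel_translate)
  moreover have "indicator ((+) v ` K) (x + v) = (indicator K x :: real)" for x
    by (auto simp: indicator_def)
  ultimately show "integrable lborel (\<lambda>x. indicator K x *\<^sub>R f (x + v))" by simp
qed

section \<open>Pairing with test functions and the fundamental lemma of the calculus of
  variations\<close>

lemma test_function_bound:
  fixes \<phi> :: "real ^ 'n \<Rightarrow> real"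
  assumes "\<phi> \<in> test_functions"
  obtains B where "B > 0" "\<And>x. \<bar>\<phi> x\<bar> \<le> B"
proof -
  let ?K = "closure {x. \<phi> x \<noteq> 0}"
  have "compact ?K" using assms unfolding test_functions_def by blast
  then have "compact (\<phi> ` ?K)"
    by (rule compact_continuous_image[OF continuous_on_subset[OF test_functions_continuous[OF assms] subset_UNIV]])
  then have "bounded (\<phi> ` ?K)" by (rule compact_imp_bounded)
  then obtain B where B: "B > 0" "\<forall>y \<in> \<phi> ` ?K. norm y \<le> B"
    unfolding bounded_pos by metis
  have "\<bar>\<phi> x\<bar> \<le> B" for x
  proof (cases "\<phi> x = 0")
    case False
    then show ?thesis using B(2) subsetD[OF closure_subset, of x "{x. \<phi> x \<noteq> 0}"] by simp
  qed (use B(1) in simp)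
  with B(1) show ?thesis by (rule that)
qed

lemma test_function_support:
  assumes "\<phi> \<in> test_functions"
  obtains K where "compact K" "\<And>x. x \<notin> K \<Longrightarrow> \<phi> x = 0"
proof (rule that)
  show "compact (closure {x. \<phi> x \<noteq> 0})" using assms unfolding test_functions_def by blast
  show "\<phi> x = 0" if "x \<notin> closure {x. \<phi> x \<noteq> 0}" for x
    using that closure_subset[of "{x. \<phi> x \<noteq> 0}"] by blast
qed

lemma test_functions_measurable: "\<phi> \<in> test_functions \<Longrightarrow> \<phi> \<in> borel_measurable borel"
  by (intro borel_measurable_continuous_onI test_functions_continuous)

lemma integrable_test_scaleR:
  fixes f :: "real ^ 'n \<Rightarrow> 'b::{banach, second_countable_topology}"
  assumes "loc_integrable f" "\<phi> \<in> test_functions"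
  shows "integrable lborel (\<lambda>x. \<phi> x *\<^sub>R f x)"
proof -
  obtain B where B: "\<And>x. \<bar>\<phi> x\<bar> \<le> B" using test_function_bound[OF assms(2)] by metis
  obtain K where K: "compact K" "\<And>x. x \<notin> K \<Longrightarrow> \<phi> x = 0" using test_function_support[OF assms(2)] by metis
  show ?thesis
    by (rule loc_integrable_scaleR[OF assms(1) test_functions_measurable[OF assms(2)] B K(2) K(1)])
qed

text \<open>Bump functions converge boundedly to the indicator of a box, so the integral of f over
  every box vanishes; by Lebesgue differentiation f is almost everywhere the limit of its averages
  over shrinking cubes.\<close>

lemma test_functions_separate:
  fixes f :: "real ^ 'n \<Rightarrow> 'b::euclidean_space"
  assumes f: "loc_integrable f"
    and zero: "\<And>\<phi>. \<phi> \<in> test_functions \<Longrightarrow> (\<integral>x. \<phi> x *\<^sub>R f x \<partial>lborel) = 0"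
  shows "AE x in lborel. f x = 0"
proof -
  note [measurable] = loc_integrable_measurable[OF f]
  have si: "set_integrable lborel (cbox a b) f" for a b using f by (auto simp: loc_integrable_def)
  have si': "set_integrable lborel (box a b) f" for a b
    by (rule set_integrable_subset[OF si[of a b]]) (auto simp: box_subset_cbox)
  have int0: "integral (cbox a b) f = 0" for a b
  proof -
    obtain \<phi> :: "nat \<Rightarrow> real ^ 'n \<Rightarrow> real" where \<phi>: "\<And>n. \<phi> n \<in> test_functions"
      "\<And>n x. 0 \<le> \<phi> n x \<and> \<phi> n x \<le> 1" "\<And>n x. \<phi> n x \<noteq> 0 \<longleftrightarrow> x \<in> box a b"
      "\<And>x. (\<lambda>n. \<phi> n x) \<longlonglongrightarrow> indicator (box a b) x" using bump_function[of a b] by metis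
    note [measurable] = test_functions_measurable[OF \<phi>(1)]
    have "(\<lambda>n. \<integral>x. \<phi> n x *\<^sub>R f x \<partial>lborel) \<longlonglongrightarrow> (\<integral>x. indicator (box a b) x *\<^sub>R f x \<partial>lborel)"
    proof (rule integral_dominated_convergence[where w="\<lambda>x. norm (indicator (box a b) x *\<^sub>R f x)"])
      show "integrable lborel (\<lambda>x. norm (indicator (box a b) x *\<^sub>R f x))"
        using si'[of a b] unfolding set_integrable_def by (rule integrable_norm)
      show "AE x in lborel. (\<lambda>n. \<phi> n x *\<^sub>R f x) \<longlonglongrightarrow> indicator (box a b) x *\<^sub>R f x"
        by (intro AE_I2 tendsto_scaleR \<phi>(4) tendsto_const)
      show "AE x in lborel. norm (\<phi> n x *\<^sub>R f x) \<le> norm (indicator (box a b) x *\<^sub>R f x)" for n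
      proof (rule AE_I2)
        fix x show "norm (\<phi> n x *\<^sub>R f x) \<le> norm (indicator (box a b) x *\<^sub>R f x)"
          using \<phi>(2)[of n x] \<phi>(3)[of n x] by (cases "x \<in> box a b") (auto intro!: mult_left_le_one_le)
      qed
    qed measurable
    then have "(\<integral>x. indicator (box a b) x *\<^sub>R f x \<partial>lborel) = 0"
      using zero[OF \<phi>(1)] by (simp add: LIMSEQ_const_iff)
    then have "integral (box a b) f = 0"
      using set_borel_integral_eq_integral(2)[OF si'[of a b]] by (simp add: set_lebesgue_integral_def)
    then show ?thesis by (simp add: integral_open_interval)
  qed
  \<comment> \<open>Lebesgue differentiation along cubes with lower corner x.\<close>
  obtain N where N: "negligible N" "\<And>x e. \<lbrakk>x \<notin> N; 0 < e\<rbrakk> \<Longrightarrow> \<exists>d>0. \<forall>h. 0 < h \<and> h < d \<longrightarrow>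
      norm (integral (cbox x (x + h *\<^sub>R One)) f /\<^sub>R h ^ DIM(real ^ 'n) - f x) < e"
    using integrable_ccontinuous_explicit[of f] set_borel_integral_eq_integral(1)[OF si] by blast
  have "f x = 0" if x: "x \<notin> N" for x
  proof (rule ccontr)
    assume "f x \<noteq> 0"
    then obtain d where d: "d > 0" "\<forall>h. 0 < h \<and> h < d \<longrightarrow>
      norm (integral (cbox x (x + h *\<^sub>R One)) f /\<^sub>R h ^ DIM(real ^ 'n) - f x) < norm (f x)"
      using N(2)[OF x, of "norm (f x)"] by auto
    \<comment> \<open>The average over the cube is 0, so the estimate would read norm (f x) < norm
      (f x).\<close>
    from d(2)[rule_format, of "d / 2"] d(1) int0 show False by simp
  qed
  then have "AE x in lebesgue. f x = 0"
    using N(1) by (intro AE_I'[of N]) (auto simp: negligible_iff_null_sets)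
  then show ?thesis by (simp add: AE_completion_iff)
qed

section \<open>Weak derivatives\<close>

lemma test_function_line_deriv:
  fixes \<phi> :: "real ^ 'n \<Rightarrow> real"
  assumes "\<phi> \<in> test_functions"
  shows "((\<lambda>t. \<phi> (x + t *\<^sub>R axis j 1)) has_field_derivative pderiv_at j \<phi> (x + t *\<^sub>R axis j 1)) (at t)"
proof -
  let ?y = "x + t *\<^sub>R axis j 1"
  let ?D = "frechet_derivative \<phi> (at ?y)"
  have D: "(\<phi> has_derivative ?D) (at ?y)"
    using test_functions_differentiable[OF assms] by (simp add: frechet_derivative_works)
  have "((\<lambda>t. x + t *\<^sub>R axis j 1) has_derivative (\<lambda>h. h *\<^sub>R axis j 1)) (at t)"
    by (auto intro!: derivative_eq_intros)
  from has_derivative_compose[OF this D]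
  have "((\<lambda>t. \<phi> (x + t *\<^sub>R axis j 1)) has_derivative (\<lambda>h. ?D (h *\<^sub>R axis j 1))) (at t)" .
  moreover have "?D (h *\<^sub>R axis j 1) = pderiv_at j \<phi> ?y * h" for h
    using linear_cmul[OF bounded_linear.linear[OF has_derivative_bounded_linear[OF D]], of h "axis j 1"]
    by (simp add: pderiv_at_def)
  ultimately show ?thesis by (simp add: has_field_derivative_def)
qed

lemma test_function_lipschitz:
  fixes \<phi> :: "real ^ 'n \<Rightarrow> real"
  assumes "\<phi> \<in> test_functions" "\<And>x. \<bar>pderiv_at j \<phi> x\<bar> \<le> B"
  shows "\<bar>\<phi> (x + h *\<^sub>R axis j 1) - \<phi> x\<bar> \<le> B * \<bar>h\<bar>"
  using field_differentiable_bound[of UNIV "\<lambda>t. \<phi> (x + t *\<^sub>R axis j 1)" "\<lambda>t. pderiv_at j \<phi> (x + t *\<^sub>R axis j 1)" B h 0]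
    test_function_line_deriv[OF assms(1)] assms(2) by simp

text \<open>Differentiation under the integral: the quotients of \<open>\<phi>\<close> are bounded
  by the supremum of its partial derivative and live in one compact set, where f is
  integrable.\<close>

lemma test_function_difference_quotient:
  fixes f :: "real ^ 'n \<Rightarrow> 'b::{banach, second_countable_topology}"
  assumes f: "loc_integrable f" and \<phi>: "\<phi> \<in> test_functions"
  shows "((\<lambda>h. \<integral>x. ((\<phi> (x + h *\<^sub>R axis j 1) - \<phi> x) / h) *\<^sub>R f x \<partial>lborel) \<longlongrightarrow>
    (\<integral>x. pderiv_at j \<phi> x *\<^sub>R f x \<partial>lborel)) (at 0)"
  unfolding tendsto_at_iff_sequentially
proof (intro allI impI)
  fix X :: "nat \<Rightarrow> real" assume X: "\<forall>i. X i \<in> UNIV - {0}" "X \<longlonglongrightarrow> 0"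
  note [measurable] = loc_integrable_measurable[OF f] test_functions_measurable[OF \<phi>]
    test_functions_measurable[OF pderiv_test_function[OF \<phi>]]
  obtain M where M: "\<And>n. \<bar>X n\<bar> \<le> M"
    using convergent_imp_Bseq[OF convergentI[OF X(2)]] by (auto simp: Bseq_def)
  obtain B where B: "B > 0" "\<And>x. \<bar>pderiv_at j \<phi> x\<bar> \<le> B"
    using test_function_bound[OF pderiv_test_function[OF \<phi>]] by metis
  obtain K where K: "compact K" "\<And>x. x \<notin> K \<Longrightarrow> \<phi> x = 0" using test_function_support[OF \<phi>] by metis
  \<comment> \<open>M bounds all steps \<open>X n\<close>, so \<open>K'\<close> contains the
    supports of \<open>\<phi>\<close> and of all the translates involved.\<close>
  define K' where "K' = (\<Union>x\<in>K. \<Union>y\<in>cball 0 M. {x + y})"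
  have K': "compact K'" unfolding K'_def by (rule compact_sums'[OF K(1) compact_cball])
  have K'_meas[measurable]: "K' \<in> sets borel" using K' by (rule borel_compact)
  have supp: "\<phi> (x + X n *\<^sub>R axis j 1) - \<phi> x = 0" if x: "x \<notin> K'" for x n
  proof -
    have "M \<ge> 0" using M[of 0] by linarith
    then have "y \<in> K'" if "y \<in> K" for y
      unfolding K'_def using that by (intro UN_I[where a=y] UN_I[where a=0]) auto
    then have "x \<notin> K" using x by blast
    moreover have "x + X n *\<^sub>R axis j 1 \<notin> K"
    proof
      assume "x + X n *\<^sub>R axis j 1 \<in> K"
      then have "(x + X n *\<^sub>R axis j 1) + (- X n *\<^sub>R axis j 1) \<in> K'"
        unfolding K'_def using M[of n] by (intro UN_I[where a="x + X n *\<^sub>R axis j 1"] UN_I[where a="- X n *\<^sub>R axis j 1"]) auto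
      with x show False by simp
    qed
    ultimately show ?thesis using K(2) by simp
  qed
  show "((\<lambda>h. \<integral>x. ((\<phi> (x + h *\<^sub>R axis j 1) - \<phi> x) / h) *\<^sub>R f x \<partial>lborel) \<circ> X) \<longlonglongrightarrow>
    (\<integral>x. pderiv_at j \<phi> x *\<^sub>R f x \<partial>lborel)"
    unfolding o_def
  proof (rule integral_dominated_convergence[where w="\<lambda>x. B * norm (indicator K' x *\<^sub>R f x)"])
    have "integrable lborel (\<lambda>x. indicator K' x *\<^sub>R f x)"
      using f K' by (auto simp: loc_integrable_def set_integrable_def)
    then show "integrable lborel (\<lambda>x. B * norm (indicator K' x *\<^sub>R f x))"
      by (intro integrable_mult_right integrable_norm)
    show "AE x in lborel. (\<lambda>n. ((\<phi> (x + X n *\<^sub>R axis j 1) - \<phi> x) / X n) *\<^sub>R f x) \<longlonglongrightarrow> pderiv_at j \<phi> x *\<^sub>R f x"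
    proof (intro AE_I2 tendsto_scaleR tendsto_const)
      fix x
      have "((\<lambda>h. (\<phi> (x + h *\<^sub>R axis j 1) - \<phi> x) / h) \<longlongrightarrow> pderiv_at j \<phi> x) (at 0)"
        using test_function_line_deriv[OF \<phi>, of x j 0] by (simp add: has_field_derivative_iff)
      from this[unfolded tendsto_at_iff_sequentially, rule_format, OF _ X(2)] X(1)
      show "(\<lambda>n. (\<phi> (x + X n *\<^sub>R axis j 1) - \<phi> x) / X n) \<longlonglongrightarrow> pderiv_at j \<phi> x"
        by (simp add: o_def)
    qed
    show "AE x in lborel. norm (((\<phi> (x + X n *\<^sub>R axis j 1) - \<phi> x) / X n) *\<^sub>R f x) \<le> B * norm (indicator K' x *\<^sub>R f x)" for n
    proof (rule AE_I2)
      fix x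
      show "norm (((\<phi> (x + X n *\<^sub>R axis j 1) - \<phi> x) / X n) *\<^sub>R f x) \<le> B * norm (indicator K' x *\<^sub>R f x)"
      proof (cases "x \<in> K'")
        case True
        have "\<bar>\<phi> (x + X n *\<^sub>R axis j 1) - \<phi> x\<bar> / \<bar>X n\<bar> \<le> B"
          using test_function_lipschitz[OF \<phi> B(2), of x "X n"] X(1) by (simp add: field_simps)
        then have "\<bar>\<phi> (x + X n *\<^sub>R axis j 1) - \<phi> x\<bar> / \<bar>X n\<bar> * norm (f x) \<le> B * norm (f x)"
          by (rule mult_right_mono) simp
        then show ?thesis using True by simp
      qed (simp add: supp)
    qed
  qed measurable
qed

section \<open>Weak derivatives and averages along segments\<close>

text \<open>The values lie in a general Banach space so that one notion serves both the complex
  function and its real modulus. Local integrability is assumed separately where it is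
  needed.\<close>

definition weak_deriv :: "'n \<Rightarrow> (real ^ 'n \<Rightarrow> 'b::{banach, second_countable_topology}) \<Rightarrow> (real ^ 'n \<Rightarrow> 'b) \<Rightarrow> bool" where
  "weak_deriv j u w \<longleftrightarrow> (\<forall>\<phi>\<in>test_functions.
     (\<integral>x. \<phi> x *\<^sub>R w x \<partial>lborel) = - (\<integral>x. pderiv_at j \<phi> x *\<^sub>R u x \<partial>lborel))"

lemma test_functions_translate:
  fixes \<phi> :: "real ^ 'n \<Rightarrow> real"
  assumes "\<phi> \<in> test_functions"
  shows "(\<lambda>x. \<phi> (x + v)) \<in> test_functions"
  using test_functions_affine[OF assms, of 1 v] by simp

text \<open>The shift sits on the test function, so the s-derivative falls on something smooth; the
  weak derivative then moves it over to u. No regularity of u along lines enters.\<close>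

lemma translated_pairing_deriv:
  fixes u :: "real ^ 'n \<Rightarrow> 'b::{banach, second_countable_topology}"
  assumes u: "loc_integrable u" and \<phi>: "\<phi> \<in> test_functions" and w: "weak_deriv j u w"
  shows "((\<lambda>s. \<integral>x. \<phi> (x - (s * h) *\<^sub>R axis j 1) *\<^sub>R u x \<partial>lborel) has_vector_derivative
     h *\<^sub>R (\<integral>x. \<phi> (x - (s * h) *\<^sub>R axis j 1) *\<^sub>R w x \<partial>lborel)) (at s)"
proof -
  let ?e = "axis j 1 :: real ^ 'n"
  let ?a = "\<lambda>t. \<integral>x. \<phi> (x - t *\<^sub>R ?e) *\<^sub>R u x \<partial>lborel"
  have a: "(?a has_vector_derivative (\<integral>x. \<phi> (x - t *\<^sub>R ?e) *\<^sub>R w x \<partial>lborel)) (at t)" for t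
  proof -
    define \<eta> where "\<eta> = (\<lambda>x. \<phi> (x + (- (t *\<^sub>R ?e))))"
    have \<eta>: "\<eta> \<in> test_functions" unfolding \<eta>_def by (rule test_functions_translate[OF \<phi>])
    have shift: "(\<lambda>x. \<phi> (x - t *\<^sub>R ?e - h *\<^sub>R ?e)) \<in> test_functions" for h
      using test_functions_translate[OF \<phi>, of "- (t *\<^sub>R ?e) - h *\<^sub>R ?e"] by (simp add: algebra_simps)
    have lim: "((\<lambda>h. \<integral>x. ((\<eta> (x + h *\<^sub>R ?e) - \<eta> x) / h) *\<^sub>R u x \<partial>lborel) \<longlongrightarrow>
      (\<integral>x. pderiv_at j \<eta> x *\<^sub>R u x \<partial>lborel)) (at 0)"
      by (rule test_function_difference_quotient[OF u \<eta>])
    \<comment> \<open>Increasing t shifts \<open>\<phi>\<close> backwards, so the quotient is taken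
      with step -h; the resulting minus sign cancels the one in \<open>weak_deriv\<close>.\<close>
    have "((\<lambda>h. \<integral>x. ((\<eta> (x + (- h) *\<^sub>R ?e) - \<eta> x) / (- h)) *\<^sub>R u x \<partial>lborel) \<longlongrightarrow>
      (\<integral>x. pderiv_at j \<eta> x *\<^sub>R u x \<partial>lborel)) (at 0)"
      by (rule filterlim_compose[OF lim])
        (auto simp: filterlim_at eventually_at_filter intro!: tendsto_eq_intros)
    from tendsto_minus[OF this]
    have "((\<lambda>h. - (\<integral>x. ((\<eta> (x + (- h) *\<^sub>R ?e) - \<eta> x) / (- h)) *\<^sub>R u x \<partial>lborel)) \<longlongrightarrow>
      (\<integral>x. \<eta> x *\<^sub>R w x \<partial>lborel)) (at 0)"
      using w \<eta> by (simp add: weak_deriv_def)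
    moreover have "- (\<integral>x. ((\<eta> (x + (- h) *\<^sub>R ?e) - \<eta> x) / (- h)) *\<^sub>R u x \<partial>lborel) =
      (?a (t + h) - ?a t) /\<^sub>R h" for h
    proof -
      have "- (\<integral>x. ((\<eta> (x + (- h) *\<^sub>R ?e) - \<eta> x) / (- h)) *\<^sub>R u x \<partial>lborel) =
        (\<integral>x. (1 / h) *\<^sub>R (\<phi> (x - t *\<^sub>R ?e - h *\<^sub>R ?e) *\<^sub>R u x - \<eta> x *\<^sub>R u x) \<partial>lborel)"
      proof -
        have "\<eta> (x + (- h) *\<^sub>R ?e) = \<phi> (x - t *\<^sub>R ?e - h *\<^sub>R ?e)" for x
          by (simp add: \<eta>_def algebra_simps)
        then show ?thesis
          unfolding Bochner_Integration.integral_minus[symmetric]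
          by (intro Bochner_Integration.integral_cong) (simp_all flip: scaleR_diff_left)
      qed
      also have "\<dots> = (1 / h) *\<^sub>R ((\<integral>x. \<phi> (x - t *\<^sub>R ?e - h *\<^sub>R ?e) *\<^sub>R u x \<partial>lborel) - (\<integral>x. \<eta> x *\<^sub>R u x \<partial>lborel))"
        by (simp add: Bochner_Integration.integral_diff[OF integrable_test_scaleR[OF u shift] integrable_test_scaleR[OF u \<eta>]])
      finally show ?thesis by (simp add: \<eta>_def divide_inverse algebra_simps)
    qed
    ultimately have "((\<lambda>h. (?a (t + h) - ?a t) /\<^sub>R h) \<longlongrightarrow> (\<integral>x. \<eta> x *\<^sub>R w x \<partial>lborel)) (at 0)"
      by simp
    then have "((\<lambda>h. norm ((?a (t + h) - ?a t) /\<^sub>R h - (\<integral>x. \<eta> x *\<^sub>R w x \<partial>lborel))) \<longlongrightarrow> 0) (at 0)"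
      by (intro tendsto_norm_zero LIM_zero)
    then have "((\<lambda>h. norm (?a (t + h) - ?a t - h *\<^sub>R (\<integral>x. \<eta> x *\<^sub>R w x \<partial>lborel)) / norm h) \<longlongrightarrow> 0) (at 0)"
    proof (rule Lim_transform_eventually)
      have "norm ((?a (t + h) - ?a t) /\<^sub>R h - L) = norm (?a (t + h) - ?a t - h *\<^sub>R L) / norm h"
        if "h \<noteq> 0" for h L
      proof -
        have "(?a (t + h) - ?a t) /\<^sub>R h - L = (?a (t + h) - ?a t - h *\<^sub>R L) /\<^sub>R h"
          using that by (simp add: scaleR_diff_right)
        then show ?thesis by (simp add: divide_inverse mult.commute)
      qed
      then show "\<forall>\<^sub>F h in at 0. norm ((?a (t + h) - ?a t) /\<^sub>R h - (\<integral>x. \<eta> x *\<^sub>R w x \<partial>lborel)) =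
         norm (?a (t + h) - ?a t - h *\<^sub>R (\<integral>x. \<eta> x *\<^sub>R w x \<partial>lborel)) / norm h"
        by (auto simp: eventually_at_filter)
    qed
    then show ?thesis
      by (simp add: has_vector_derivative_def has_derivative_at \<eta>_def bounded_linear_scaleR_left)
  qed
  have "((\<lambda>s. s * h) has_vector_derivative h) (at s)"
    by (auto intro!: derivative_eq_intros simp: has_real_derivative_iff_has_vector_derivative[symmetric])
  from vector_diff_chain_at[OF this a] show ?thesis by (simp add: o_def)
qed

text \<open>The average of f over the segment from x to x + v. Where f is not integrable along the
  segment the integral defaults to 0, which matters only on a null set of x for locally integrable
  f.\<close>

definition line_average :: "'a::euclidean_space \<Rightarrow> ('a \<Rightarrow> 'b::{banach, second_countable_topology}) \<Rightarrow> 'a \<Rightarrow> 'b" where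
  "line_average v f x = (\<integral>s. indicator {0..1::real} s *\<^sub>R f (x + s *\<^sub>R v) \<partial>lborel)"

text \<open>The hypothesis of Fubini for exchanging a bounded, compactly supported weight in x with
  the averaging in s.\<close>

lemma integrable_translates:
  fixes f :: "'a::euclidean_space \<Rightarrow> 'b::{banach, second_countable_topology}"
  assumes f: "loc_integrable f" and [measurable]: "k \<in> borel_measurable borel"
    and bound: "\<And>x. \<bar>k x\<bar> \<le> B" and supp: "\<And>x. x \<notin> K \<Longrightarrow> k x = 0" and K: "compact K"
  shows "integrable (lborel \<Otimes>\<^sub>M lborel) (\<lambda>(s, x). indicator {0..1::real} s *\<^sub>R k x *\<^sub>R f (x + s *\<^sub>R v))"
proof (rule lborel_pair.Fubini_integrable)
  note [measurable] = loc_integrable_measurable[OF f]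
  show "(\<lambda>(s, x). indicator {0..1::real} s *\<^sub>R k x *\<^sub>R f (x + s *\<^sub>R v)) \<in> borel_measurable (lborel \<Otimes>\<^sub>M lborel)"
    by measurable
  have int: "integrable lborel (\<lambda>x. k x *\<^sub>R f (x + s *\<^sub>R v))" for s
    by (rule loc_integrable_scaleR[OF loc_integrable_translate[OF f] _ bound supp K]) measurable
  then show "AE s in lborel. integrable lborel
      (\<lambda>x. case (s, x) of (s, x) \<Rightarrow> indicator {0..1::real} s *\<^sub>R k x *\<^sub>R f (x + s *\<^sub>R v))"
    by (intro AE_I2) (simp del: scaleR_scaleR add: integrable_scaleR_right)
  have B: "B \<ge> 0" using bound[of undefined] by linarith
  \<comment> \<open>Every segment of direction v that starts in K stays in \<open>K'\<close>, so the
    inner integrals are bounded uniformly in s by an integral of f over \<open>K'\<close>.\<close>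
  define K' where "K' = (\<Union>x\<in>K. \<Union>y\<in>cball 0 (norm v). {x + y})"
  have K': "compact K'" unfolding K'_def by (rule compact_sums'[OF K compact_cball])
  have [measurable]: "K' \<in> sets borel" using K' by (rule borel_compact)
  have intK': "integrable lborel (\<lambda>x. B * norm (indicator K' x *\<^sub>R f x))"
    using f K' unfolding loc_integrable_def set_integrable_def
    by (intro integrable_mult_right integrable_norm) auto
  let ?g = "\<lambda>s. \<integral>x. norm (indicator {0..1::real} s *\<^sub>R k x *\<^sub>R f (x + s *\<^sub>R v)) \<partial>lborel"
  have "integrable lborel ?g"
  proof (rule integrableI_bounded_set[of "{0..1}"])
    show "AE s in lborel. s \<in> {0..1} \<longrightarrow> norm (?g s) \<le> (\<integral>x. B * norm (indicator K' x *\<^sub>R f x) \<partial>lborel)"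
    proof (intro AE_I2 impI)
      fix s :: real assume s: "s \<in> {0..1}"
      have "?g s \<le> (\<integral>x. B * norm (indicator K' (x + s *\<^sub>R v) *\<^sub>R f (x + s *\<^sub>R v)) \<partial>lborel)"
      proof (rule integral_mono)
        show "integrable lborel (\<lambda>x. norm (indicator {0..1::real} s *\<^sub>R k x *\<^sub>R f (x + s *\<^sub>R v)))"
          by (intro integrable_norm integrable_scaleR_right int)
        show "integrable lborel (\<lambda>x. B * norm (indicator K' (x + s *\<^sub>R v) *\<^sub>R f (x + s *\<^sub>R v)))"
          by (rule integrable_lborel_translate[OF intK'])
        fix x
        show "norm (indicator {0..1::real} s *\<^sub>R k x *\<^sub>R f (x + s *\<^sub>R v)) \<le>
          B * norm (indicator K' (x + s *\<^sub>R v) *\<^sub>R f (x + s *\<^sub>R v))"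
        proof (cases "x \<in> K")
          case True
          have "x + s *\<^sub>R v \<in> K'" unfolding K'_def using s True
            by (intro UN_I[where a=x] UN_I[where a="s *\<^sub>R v"]) (auto intro: mult_left_le_one_le)
          then show ?thesis using s bound[of x] by (auto intro!: mult_right_mono)
        qed (use supp B in simp)
      qed
      also have "\<dots> = (\<integral>x. B * norm (indicator K' x *\<^sub>R f x) \<partial>lborel)"
        by (rule integral_lborel_translate) measurable
      finally show "norm (?g s) \<le> (\<integral>x. B * norm (indicator K' x *\<^sub>R f x) \<partial>lborel)"
        by (simp add: integral_nonneg_AE)
    qed
    show "?g \<in> borel_measurable lborel" by measurable
  qed auto
  then show "integrable lborel (\<lambda>s. \<integral>x. norm (case (s, x) of (s, x) \<Rightarrow>
      indicator {0..1::real} s *\<^sub>R k x *\<^sub>R f (x + s *\<^sub>R v)) \<partial>lborel)"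
    by simp
qed

lemma line_average_measurable:
  fixes f :: "'a::euclidean_space \<Rightarrow> 'b::{banach, second_countable_topology}"
  assumes [measurable]: "f \<in> borel_measurable borel"
  shows "line_average v f \<in> borel_measurable borel"
proof -
  have "(\<lambda>x. \<integral>s. indicator {0..1::real} s *\<^sub>R f (x + s *\<^sub>R v) \<partial>lborel) \<in> borel_measurable lborel"
    by measurable
  then show ?thesis by (simp add: line_average_def[abs_def])
qed

lemma loc_integrable_line_average:
  fixes f :: "'a::euclidean_space \<Rightarrow> 'b::{banach, second_countable_topology}"
  assumes f: "loc_integrable f"
  shows "loc_integrable (line_average v f)"
  unfolding loc_integrable_def set_integrable_def
proof (intro conjI allI impI)
  show "line_average v f \<in> borel_measurable borel"
    by (rule line_average_measurable[OF loc_integrable_measurable[OF f]])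
  fix K :: "'a set" assume K: "compact K"
  then have [measurable]: "K \<in> sets borel" by (rule borel_compact)
  have "integrable (lborel \<Otimes>\<^sub>M lborel) (\<lambda>(s, x). indicator {0..1::real} s *\<^sub>R indicator K x *\<^sub>R f (x + s *\<^sub>R v))"
    by (rule integrable_translates[OF f _ _ _ K, of _ 1]) (auto simp: indicator_def)
  from lborel_pair.integrable_snd[OF this]
  have "integrable lborel (\<lambda>x. \<integral>s. indicator K x *\<^sub>R indicator {0..1::real} s *\<^sub>R f (x + s *\<^sub>R v) \<partial>lborel)"
    by (simp add: mult.commute)
  then show "integrable lborel (\<lambda>x. indicator K x *\<^sub>R line_average v f x)"
    by (simp only: Bochner_Integration.integral_scaleR_right line_average_def)
qed

text \<open>A weak form of the fundamental theorem of calculus: after pairing with a test function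
  the identity concerns a differentiable function of one real parameter, and test functions separate
  locally integrable functions. The exceptional null set depends on h.\<close>

lemma weak_deriv_difference:
  fixes u w :: "real ^ 'n \<Rightarrow> 'b::euclidean_space"
  assumes u: "loc_integrable u" and w: "loc_integrable w" and uw: "weak_deriv j u w"
  shows "AE x in lborel. u (x + h *\<^sub>R axis j 1) - u x = h *\<^sub>R line_average (h *\<^sub>R axis j 1) w x"
proof -
  let ?e = "axis j 1 :: real ^ 'n"
  let ?W = "line_average (h *\<^sub>R ?e) w"
  have ut: "loc_integrable (\<lambda>x. u (x + h *\<^sub>R ?e))" by (rule loc_integrable_translate[OF u])
  have W: "loc_integrable ?W" by (rule loc_integrable_line_average[OF w])
  note [measurable] = loc_integrable_measurable[OF u] loc_integrable_measurable[OF w] loc_integrable_measurable[OF W]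
  have "AE x in lborel. u (x + h *\<^sub>R ?e) + ((- 1) *\<^sub>R u x + (- h) *\<^sub>R ?W x) = 0"
  proof (rule test_functions_separate)
    have sc: "loc_integrable (\<lambda>x. c *\<^sub>R v x)" if "loc_integrable v" for c and v :: "real ^ 'n \<Rightarrow> 'b"
      using that by (auto simp: loc_integrable_def intro: set_integrable_scaleR_right)
    show "loc_integrable (\<lambda>x. u (x + h *\<^sub>R ?e) + ((- 1) *\<^sub>R u x + (- h) *\<^sub>R ?W x))"
      by (intro loc_integrable_add sc ut u W)
    fix \<phi> :: "real ^ 'n \<Rightarrow> real" assume \<phi>: "\<phi> \<in> test_functions"
    note [measurable] = test_functions_measurable[OF \<phi>]
    let ?b = "\<lambda>s. \<integral>x. \<phi> (x - (s * h) *\<^sub>R ?e) *\<^sub>R w x \<partial>lborel"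
    let ?a = "\<lambda>s. \<integral>x. \<phi> (x - (s * h) *\<^sub>R ?e) *\<^sub>R u x \<partial>lborel"
    have shift: "(\<integral>x. \<phi> (x - t *\<^sub>R ?e) *\<^sub>R v x \<partial>lborel) = (\<integral>x. \<phi> x *\<^sub>R v (x + t *\<^sub>R ?e) \<partial>lborel)"
      if [measurable]: "v \<in> borel_measurable borel" for v :: "real ^ 'n \<Rightarrow> 'b" and t
      using integral_lborel_translate[of "\<lambda>x. \<phi> (x - t *\<^sub>R ?e) *\<^sub>R v x" "t *\<^sub>R ?e"] by simp
    obtain B where B: "\<And>x. \<bar>\<phi> x\<bar> \<le> B" using test_function_bound[OF \<phi>] by metis
    obtain K where K: "compact K" "\<And>x. x \<notin> K \<Longrightarrow> \<phi> x = 0" using test_function_support[OF \<phi>] by metis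
    have int: "integrable (lborel \<Otimes>\<^sub>M lborel) (\<lambda>(s, x). indicator {0..1::real} s *\<^sub>R \<phi> x *\<^sub>R w (x + s *\<^sub>R h *\<^sub>R ?e))"
      by (rule integrable_translates[OF w _ B K(2) K(1)]) measurable
    \<comment> \<open>The classical theorem is applied to the pairing as a function of s, not to u
      itself.\<close>
    have "((\<lambda>s. h *\<^sub>R ?b s) has_integral ?a 1 - ?a 0) {0..1}"
      by (rule fundamental_theorem_of_calculus)
        (auto intro!: has_vector_derivative_at_within translated_pairing_deriv[OF u \<phi> uw])
    then have "integral {0..1} (\<lambda>s. h *\<^sub>R ?b s) = ?a 1 - ?a 0" by (rule integral_unique)
    also have "integral {0..1} (\<lambda>s. h *\<^sub>R ?b s) = h *\<^sub>R integral {0..1} ?b" by simp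
    also have "integral {0..1} ?b = (LINT s:{0..1}|lborel. ?b s)"
    proof (rule set_borel_integral_eq_integral(2)[symmetric])
      show "set_integrable lborel {0..1} ?b"
        using lborel_pair.integrable_fst[OF int] unfolding set_integrable_def
        by (simp add: shift del: Bochner_Integration.integral_scaleR_right
            flip: Bochner_Integration.integral_scaleR_right)
    qed
    also have "\<dots> = (\<integral>s. (\<integral>x. indicator {0..1::real} s *\<^sub>R \<phi> x *\<^sub>R w (x + s *\<^sub>R h *\<^sub>R ?e) \<partial>lborel) \<partial>lborel)"
      unfolding set_lebesgue_integral_def
      by (simp add: shift del: Bochner_Integration.integral_scaleR_right
          flip: Bochner_Integration.integral_scaleR_right)
    also have "\<dots> = (\<integral>x. (\<integral>s. indicator {0..1::real} s *\<^sub>R \<phi> x *\<^sub>R w (x + s *\<^sub>R h *\<^sub>R ?e) \<partial>lborel) \<partial>lborel)"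
      using lborel_pair.Fubini_integral[OF int] by simp
    also have "\<dots> = (\<integral>x. \<phi> x *\<^sub>R ?W x \<partial>lborel)"
    proof -
      have "(\<integral>s. indicator {0..1::real} s *\<^sub>R \<phi> x *\<^sub>R w (x + s *\<^sub>R h *\<^sub>R ?e) \<partial>lborel) = \<phi> x *\<^sub>R ?W x" for x
        unfolding line_average_def Bochner_Integration.integral_scaleR_right[symmetric]
        by (simp add: mult.commute)
      then show ?thesis by simp
    qed
    finally have eq: "h *\<^sub>R (\<integral>x. \<phi> x *\<^sub>R ?W x \<partial>lborel) = ?a 1 - ?a 0" .
    have a: "?a 1 = (\<integral>x. \<phi> x *\<^sub>R u (x + h *\<^sub>R ?e) \<partial>lborel)" "?a 0 = (\<integral>x. \<phi> x *\<^sub>R u x \<partial>lborel)"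
      using shift[of u h] by simp_all
    have "(\<integral>x. \<phi> x *\<^sub>R (u (x + h *\<^sub>R ?e) + ((- 1) *\<^sub>R u x + (- h) *\<^sub>R ?W x)) \<partial>lborel) =
      (\<integral>x. \<phi> x *\<^sub>R u (x + h *\<^sub>R ?e) - \<phi> x *\<^sub>R u x - h *\<^sub>R (\<phi> x *\<^sub>R ?W x) \<partial>lborel)"
      by (intro Bochner_Integration.integral_cong) (auto simp: algebra_simps)
    also have "\<dots> = ?a 1 - ?a 0 - h *\<^sub>R (\<integral>x. \<phi> x *\<^sub>R ?W x \<partial>lborel)"
      unfolding a
      using integrable_test_scaleR[OF ut \<phi>] integrable_test_scaleR[OF u \<phi>] integrable_test_scaleR[OF W \<phi>]
      by (simp del: scaleR_scaleR)
    finally show "(\<integral>x. \<phi> x *\<^sub>R (u (x + h *\<^sub>R ?e) + ((- 1) *\<^sub>R u x + (- h) *\<^sub>R ?W x)) \<partial>lborel) = 0"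
      using eq by simp
  qed
  then show ?thesis by eventually_elim (simp add: algebra_simps)
qed

text \<open>By Fubini the L^1 distance to f is at most the mean over s in [0,1] of the distance of f
  to its translate by s v. These distances are bounded by twice the L^1 norm of f and tend to 0 by
  continuity of translations.\<close>

lemma line_average_tendsto_L1:
  fixes f :: "'a::euclidean_space \<Rightarrow> 'b::{banach, second_countable_topology}"
  assumes f: "integrable lborel f" and v: "v \<longlonglongrightarrow> 0"
  shows "integrable lborel (line_average (v n) f)"
    "(\<lambda>n. \<integral>x. norm (line_average (v n) f x - f x) \<partial>lborel) \<longlonglongrightarrow> 0"
proof -
  have [measurable]: "f \<in> borel_measurable borel"
    using f by (simp add: borel_measurable_integrable[of lborel, simplified])
  let ?I = "indicator {0..1} :: real \<Rightarrow> real"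
  note ft = integrable_lborel_translate[OF f]
  define T where "T u = (\<integral>x. norm (f (x + u) - f x) \<partial>lborel)" for u
  have [measurable]: "T \<in> borel_measurable borel"
  proof -
    have "T \<in> borel_measurable lborel" unfolding T_def by measurable
    then show ?thesis by simp
  qed
  have T_bound: "\<bar>T u\<bar> \<le> 2 * (\<integral>x. norm (f x) \<partial>lborel)" for u
  proof -
    have "T u \<le> (\<integral>x. norm (f (x + u)) + norm (f x) \<partial>lborel)"
      unfolding T_def
      by (rule integral_mono) (intro integrable_norm Bochner_Integration.integrable_diff
          Bochner_Integration.integrable_add ft f norm_triangle_ineq4)+
    also have "\<dots> = (\<integral>x. norm (f (x + u)) \<partial>lborel) + (\<integral>x. norm (f x) \<partial>lborel)"
      by (intro Bochner_Integration.integral_add integrable_norm ft f)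
    also have "(\<integral>x. norm (f (x + u)) \<partial>lborel) = (\<integral>x. norm (f x) \<partial>lborel)"
      by (rule integral_lborel_translate) measurable
    finally show ?thesis by (simp add: T_def integral_nonneg_AE)
  qed
  \<comment> \<open>The parameter c covers two uses: c = 0 for the translate alone and c = 1 for its
    difference with f.\<close>
  have joint: "integrable (lborel \<Otimes>\<^sub>M lborel) (\<lambda>(s, x). ?I s *\<^sub>R (f (x + s *\<^sub>R u) - c *\<^sub>R f x))" for u and c :: real
  proof (rule lborel_pair.Fubini_integrable)
    show "AE s in lborel. integrable lborel (\<lambda>x. case (s, x) of (s, x) \<Rightarrow> ?I s *\<^sub>R (f (x + s *\<^sub>R u) - c *\<^sub>R f x))"
      by (intro AE_I2) (simp, intro integrable_scaleR_right Bochner_Integration.integrable_diff ft f)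
    have "integrable lborel (\<lambda>s. \<integral>x. norm (?I s *\<^sub>R (f (x + s *\<^sub>R u) - c *\<^sub>R f x)) \<partial>lborel)"
    proof (rule integrableI_bounded_set[of "{0..1}"])
      show "AE s in lborel. s \<in> {0..1} \<longrightarrow> norm (\<integral>x. norm (?I s *\<^sub>R (f (x + s *\<^sub>R u) - c *\<^sub>R f x)) \<partial>lborel) \<le>
        (1 + \<bar>c\<bar>) * (\<integral>x. norm (f x) \<partial>lborel)"
      proof (intro AE_I2 impI)
        fix s :: real assume s: "s \<in> {0..1}"
        have "(\<integral>x. norm (?I s *\<^sub>R (f (x + s *\<^sub>R u) - c *\<^sub>R f x)) \<partial>lborel) \<le>
          (\<integral>x. norm (f (x + s *\<^sub>R u)) + norm (c *\<^sub>R f x) \<partial>lborel)"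
        proof (rule integral_mono)
          show "integrable lborel (\<lambda>x. norm (?I s *\<^sub>R (f (x + s *\<^sub>R u) - c *\<^sub>R f x)))"
            by (intro integrable_norm integrable_scaleR_right Bochner_Integration.integrable_diff ft f)
          show "integrable lborel (\<lambda>x. norm (f (x + s *\<^sub>R u)) + norm (c *\<^sub>R f x))"
            by (intro integrable_norm integrable_scaleR_right Bochner_Integration.integrable_add ft f)
          show "norm (?I s *\<^sub>R (f (x + s *\<^sub>R u) - c *\<^sub>R f x)) \<le> norm (f (x + s *\<^sub>R u)) + norm (c *\<^sub>R f x)" for x
            using s norm_triangle_ineq4[of "f (x + s *\<^sub>R u)" "c *\<^sub>R f x"] by simp
        qed
        also have "\<dots> = (\<integral>x. norm (f (x + s *\<^sub>R u)) \<partial>lborel) + (\<integral>x. norm (c *\<^sub>R f x) \<partial>lborel)"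
          by (intro Bochner_Integration.integral_add integrable_norm integrable_scaleR_right ft f)
        also have "(\<integral>x. norm (f (x + s *\<^sub>R u)) \<partial>lborel) = (\<integral>x. norm (f x) \<partial>lborel)"
          by (rule integral_lborel_translate) measurable
        finally show "norm (\<integral>x. norm (?I s *\<^sub>R (f (x + s *\<^sub>R u) - c *\<^sub>R f x)) \<partial>lborel) \<le>
          (1 + \<bar>c\<bar>) * (\<integral>x. norm (f x) \<partial>lborel)" by (simp add: integral_nonneg_AE algebra_simps)
      qed
      show "(\<lambda>s. \<integral>x. norm (?I s *\<^sub>R (f (x + s *\<^sub>R u) - c *\<^sub>R f x)) \<partial>lborel) \<in> borel_measurable lborel"
        by measurable
    qed auto
    then show "integrable lborel (\<lambda>s. \<integral>x. norm (case (s, x) of (s, x) \<Rightarrow> ?I s *\<^sub>R (f (x + s *\<^sub>R u) - c *\<^sub>R f x)) \<partial>lborel)"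
      by simp
  qed measurable
  have avg_int: "integrable lborel (line_average u f)" for u
    using lborel_pair.integrable_snd[OF joint[of u 0]] by (simp add: line_average_def[abs_def])
  then show "integrable lborel (line_average (v n) f)" .
  have le: "(\<integral>x. norm (line_average u f x - f x) \<partial>lborel) \<le> (\<integral>s. ?I s * T (s *\<^sub>R u) \<partial>lborel)" for u
  proof -
    note J = joint[of u 1, simplified]
    have one: "(\<integral>s. ?I s *\<^sub>R f x \<partial>lborel) = f x" for x
      by (subst Bochner_Integration.integral_scaleR_left) auto
    have "(\<integral>x. norm (line_average u f x - f x) \<partial>lborel) \<le>
      (\<integral>x. (\<integral>s. norm (?I s *\<^sub>R (f (x + s *\<^sub>R u) - f x)) \<partial>lborel) \<partial>lborel)"
    proof (rule integral_mono_AE)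
      show "integrable lborel (\<lambda>x. norm (line_average u f x - f x))"
        by (intro integrable_norm Bochner_Integration.integrable_diff avg_int f)
      have J': "integrable (lborel \<Otimes>\<^sub>M lborel) (\<lambda>(s, x). norm (?I s *\<^sub>R (f (x + s *\<^sub>R u) - f x)))"
        using integrable_norm[OF J] by (simp add: case_prod_beta')
      show "integrable lborel (\<lambda>x. \<integral>s. norm (?I s *\<^sub>R (f (x + s *\<^sub>R u) - f x)) \<partial>lborel)"
        using lborel_pair.integrable_snd[OF J'] by simp
      have "AE x in lborel. integrable lborel (\<lambda>s. ?I s *\<^sub>R (f (x + s *\<^sub>R u) - f x))"
        using lborel_pair.AE_integrable_snd[OF J] by simp
      moreover have "AE x in lborel. integrable lborel (\<lambda>s. ?I s *\<^sub>R (f (x + s *\<^sub>R u)))"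
        using lborel_pair.AE_integrable_snd[OF joint[of u 0]] by simp
      ultimately show "AE x in lborel. norm (line_average u f x - f x) \<le>
        (\<integral>s. norm (?I s *\<^sub>R (f (x + s *\<^sub>R u) - f x)) \<partial>lborel)"
      proof eventually_elim
        case (elim x)
        have "line_average u f x - f x = (\<integral>s. ?I s *\<^sub>R (f (x + s *\<^sub>R u)) \<partial>lborel) - (\<integral>s. ?I s *\<^sub>R f x \<partial>lborel)"
          by (simp only: line_average_def one)
        also have "\<dots> = (\<integral>s. ?I s *\<^sub>R (f (x + s *\<^sub>R u)) - ?I s *\<^sub>R f x \<partial>lborel)"
          by (rule Bochner_Integration.integral_diff[symmetric, OF elim(2)]) (auto intro!: integrable_scaleR_left)
        finally have "line_average u f x - f x = (\<integral>s. ?I s *\<^sub>R (f (x + s *\<^sub>R u) - f x) \<partial>lborel)"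
          by (simp add: scaleR_diff_right)
        then show ?case using integral_norm_bound[of lborel "\<lambda>s. ?I s *\<^sub>R (f (x + s *\<^sub>R u) - f x)"] by (simp del: norm_scaleR)
      qed
    qed
    also have "\<dots> = (\<integral>s. (\<integral>x. norm (?I s *\<^sub>R (f (x + s *\<^sub>R u) - f x)) \<partial>lborel) \<partial>lborel)"
      using lborel_pair.Fubini_integral[of "\<lambda>s x. norm (?I s *\<^sub>R (f (x + s *\<^sub>R u) - f x))"] integrable_norm[OF J]
      by (simp add: case_prod_beta')
    also have "\<dots> = (\<integral>s. ?I s * T (s *\<^sub>R u) \<partial>lborel)" by (simp add: T_def)
    finally show ?thesis .
  qed
  have "(\<lambda>n. \<integral>s. ?I s * T (s *\<^sub>R v n) \<partial>lborel) \<longlonglongrightarrow> (\<integral>s. 0 \<partial>(lborel :: real measure))"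
  proof (rule integral_dominated_convergence[where w="\<lambda>s. ?I s * (2 * (\<integral>x. norm (f x) \<partial>lborel))"])
    show "AE s in lborel. (\<lambda>n. ?I s * T (s *\<^sub>R v n)) \<longlonglongrightarrow> 0"
    proof (rule AE_I2)
      fix s :: real
      have "(\<lambda>n. s *\<^sub>R v n) \<longlonglongrightarrow> 0" using tendsto_scaleR[OF tendsto_const v, of s] by simp
      then have "(\<lambda>n. T (s *\<^sub>R v n)) \<longlonglongrightarrow> 0"
        using integrable_imp_translation_continuous[OF f] by (simp add: translation_continuous_def T_def)
      then show "(\<lambda>n. ?I s * T (s *\<^sub>R v n)) \<longlonglongrightarrow> 0" by (rule tendsto_mult_right_zero)
    qed
    show "AE s in lborel. norm (?I s * T (s *\<^sub>R v n)) \<le> ?I s * (2 * (\<integral>x. norm (f x) \<partial>lborel))" for n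
      using T_bound by (auto simp: abs_mult intro!: AE_I2 mult_left_mono)
  qed auto
  then have lim: "(\<lambda>n. \<integral>s. ?I s * T (s *\<^sub>R v n) \<partial>lborel) \<longlonglongrightarrow> 0" by simp
  show "(\<lambda>n. \<integral>x. norm (line_average (v n) f x - f x) \<partial>lborel) \<longlonglongrightarrow> 0"
    by (rule tendsto_sandwich[OF _ _ tendsto_const lim])
      (auto intro!: always_eventually le integral_nonneg_AE)
qed

section \<open>Chain rule for the modulus of a complex function\<close>

definition reg_norm :: "real \<Rightarrow> complex \<Rightarrow> real" where
  "reg_norm e z = sqrt ((norm z)\<^sup>2 + e\<^sup>2)"

lemma reg_norm_ge: "norm z \<le> reg_norm e z"
  unfolding reg_norm_def by (rule real_le_rsqrt) simp

lemma reg_norm_pos: "e \<noteq> 0 \<Longrightarrow> reg_norm e z > 0"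
  unfolding reg_norm_def by (simp add: add_nonneg_pos)

lemma reg_norm_le: "reg_norm e z \<le> norm z + \<bar>e\<bar>"
  unfolding reg_norm_def using sqrt_sum_squares_le_sum_abs[of "norm z" e] by simp

lemma continuous_on_reg_norm: "continuous_on UNIV (reg_norm e)"
  unfolding reg_norm_def by (intro continuous_intros)

lemma reg_norm_measurable[measurable]: "reg_norm e \<in> borel_measurable borel"
  by (rule borel_measurable_continuous_onI[OF continuous_on_reg_norm])

lemma complex_measurable[measurable]:
  "cnj \<in> borel_measurable borel" "complex_of_real \<in> borel_measurable borel"
  by (intro borel_measurable_continuous_onI continuous_intros)+

text \<open>Difference of squares: the e^2 cancel, and |a|^2 - |b|^2 is the real part of (cnj a +
  cnj b)(a - b). Thus a difference of regularized moduli is an explicit bounded multiplier times a -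
  b, which replaces any appeal to a mean value theorem.\<close>

lemma reg_norm_diff:
  assumes "e \<noteq> 0"
  shows "reg_norm e a - reg_norm e b = Re ((cnj a + cnj b) / of_real (reg_norm e a + reg_norm e b) * (a - b))"
proof -
  have pos: "reg_norm e a + reg_norm e b > 0" using reg_norm_pos[OF assms] by (simp add: add_pos_pos)
  have "(reg_norm e a - reg_norm e b) * (reg_norm e a + reg_norm e b) = (norm a)\<^sup>2 - (norm b)\<^sup>2"
    by (simp add: algebra_simps reg_norm_def flip: power2_eq_square)
  also have "\<dots> = Re ((cnj a + cnj b) * (a - b))"
    unfolding cmod_power2 by (simp add: algebra_simps power2_eq_square)
  finally have "reg_norm e a - reg_norm e b = Re ((cnj a + cnj b) * (a - b)) / (reg_norm e a + reg_norm e b)"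
    using pos by (simp add: field_simps)
  also have "\<dots> = Re ((cnj a + cnj b) * (a - b) / of_real (reg_norm e a + reg_norm e b))"
    by (simp only: Re_divide_of_real)
  finally show ?thesis by (simp add: mult.commute)
qed

lemma reg_norm_quotient_bound:
  assumes "e \<noteq> 0"
  shows "norm ((cnj a + cnj b) / complex_of_real (reg_norm e a + reg_norm e b)) \<le> 1"
proof -
  have pos: "reg_norm e a + reg_norm e b > 0" using reg_norm_pos[OF assms] by (simp add: add_pos_pos)
  have "norm (cnj a + cnj b) \<le> norm a + norm b" using norm_triangle_ineq[of "cnj a" "cnj b"] by simp
  also have "\<dots> \<le> reg_norm e a + reg_norm e b" by (intro add_mono reg_norm_ge)
  finally have "norm (cnj a + cnj b) \<le> reg_norm e a + reg_norm e b" .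
  then show ?thesis using pos by (simp only: norm_divide norm_of_real divide_le_eq_1 abs_of_pos) simp
qed

text \<open>The difference quotients of the regularized modulus are Re (m W), with multipliers m of
  norm at most 1 and W convergent to w in L^1 near the support of the test function. Writing m W = m
  (W - w) + m w, the first part vanishes in L^1, and the second converges by dominated convergence
  once m converges almost everywhere.\<close>

lemma weak_deriv_reg_norm:
  fixes u w :: "real ^ 'n \<Rightarrow> complex"
  assumes u: "loc_integrable u" and w: "loc_integrable w" and uw: "weak_deriv j u w" and e: "e \<noteq> 0"
  shows "weak_deriv j (\<lambda>x. reg_norm e (u x)) (\<lambda>x. Re (cnj (u x) / of_real (reg_norm e (u x)) * w x))"
  unfolding weak_deriv_def
proof
  fix \<phi> :: "real ^ 'n \<Rightarrow> real" assume \<phi>: "\<phi> \<in> test_functions"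
  note [measurable] = loc_integrable_measurable[OF u] loc_integrable_measurable[OF w] test_functions_measurable[OF \<phi>]
  let ?e = "axis j 1 :: real ^ 'n"
  define F where "F x = reg_norm e (u x)" for x
  have [measurable]: "F \<in> borel_measurable borel" unfolding F_def by measurable
  have F: "loc_integrable F"
  proof (rule loc_integrable_bound)
    have nu: "loc_integrable (\<lambda>x. norm (u x))" by (rule loc_integrable_bound[OF u]) auto
    show "loc_integrable (\<lambda>x. norm (u x) + \<bar>e\<bar>)"
      by (rule loc_integrable_add[OF nu continuous_loc_integrable]) simp
    show "norm (F x) \<le> norm (norm (u x) + \<bar>e\<bar>)" for x
      using reg_norm_le[of e "u x"] reg_norm_pos[OF e, of "u x"] by (simp add: F_def)
  qed measurable
  obtain B where B: "B > 0" "\<And>x. \<bar>\<phi> x\<bar> \<le> B" using test_function_bound[OF \<phi>] by metis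
  obtain K where K: "compact K" "\<And>x. x \<notin> K \<Longrightarrow> \<phi> x = 0" using test_function_support[OF \<phi>] by metis
  have [measurable]: "K \<in> sets borel" using K(1) by (rule borel_compact)
  \<comment> \<open>The steps \<open>h n\<close> are at most 1, so segments starting in K stay in
    \<open>K'\<close>. Cutting w off outside \<open>K'\<close> makes it integrable without changing
    its averages at points of K.\<close>
  define K' where "K' = (\<Union>x\<in>K. \<Union>y\<in>cball 0 1. {x + y})"
  have K': "compact K'" unfolding K'_def by (rule compact_sums'[OF K(1) compact_cball])
  have [measurable]: "K' \<in> sets borel" using K' by (rule borel_compact)
  define w' where "w' x = indicator K' x *\<^sub>R w x" for x
  have w': "integrable lborel w'"
    using w K' by (simp add: w'_def[abs_def] loc_integrable_def set_integrable_def)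
  have [measurable]: "w' \<in> borel_measurable borel" unfolding w'_def by measurable
  define h where "h n = inverse (real (Suc n))" for n
  have h: "h n \<noteq> 0" "0 < h n" "h n \<le> 1" for n by (auto simp: h_def inverse_le_1_iff)
  have h0: "h \<longlonglongrightarrow> 0" unfolding h_def by (rule LIMSEQ_inverse_real_of_nat)
  define W where "W n = line_average (h n *\<^sub>R ?e) w'" for n
  have [measurable]: "W n \<in> borel_measurable borel" for n
    unfolding W_def by (rule line_average_measurable) measurable
  have v0: "(\<lambda>n. h n *\<^sub>R ?e) \<longlonglongrightarrow> 0" using tendsto_scaleR[OF h0 tendsto_const, of ?e] by simp
  have W_int: "integrable lborel (W n)" for n
    unfolding W_def by (rule line_average_tendsto_L1(1)[OF w' v0])
  have W_lim: "(\<lambda>n. \<integral>x. norm (W n x - w' x) \<partial>lborel) \<longlonglongrightarrow> 0"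
    unfolding W_def by (rule line_average_tendsto_L1(2)[OF w' v0])
  have W_eq: "line_average (h n *\<^sub>R ?e) w x = W n x" if "x \<in> K" for x n
    unfolding W_def line_average_def
  proof (intro Bochner_Integration.integral_cong refl)
    fix s :: real
    have "x + s *\<^sub>R h n *\<^sub>R ?e \<in> K'" if "s \<in> {0..1}"
      unfolding K'_def using \<open>x \<in> K\<close> that h[of n]
      by (intro UN_I[where a=x] UN_I[where a="s *\<^sub>R h n *\<^sub>R ?e"]) (auto intro!: mult_le_one)
    then show "indicator {0..1} s *\<^sub>R w (x + s *\<^sub>R h n *\<^sub>R ?e) = indicator {0..1} s *\<^sub>R w' (x + s *\<^sub>R h n *\<^sub>R ?e)"
      by (auto simp: w'_def split: split_indicator)
  qed
  \<comment> \<open>Restricting to the sequence \<open>h n\<close> leaves countably many exceptional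
    null sets.\<close>
  have diff: "AE x in lborel. \<forall>n. u (x + h n *\<^sub>R ?e) - u x = h n *\<^sub>R line_average (h n *\<^sub>R ?e) w x"
    unfolding AE_all_countable using weak_deriv_difference[OF u w uw] by blast
  \<comment> \<open>Along this subsequence \<open>W\<close> converges pointwise; multiplied by
    \<open>h (r n)\<close>, it shows that the translates of u converge to u, and hence that the
    multipliers converge.\<close>
  obtain r :: "nat \<Rightarrow> nat" where r: "strict_mono r" "AE x in lborel. (\<lambda>n. W (r n) x - w' x) \<longlonglongrightarrow> 0"
    using tendsto_L1_AE_subseq[OF Bochner_Integration.integrable_diff[OF W_int w'] W_lim] by blast
  have hr0: "(\<lambda>n. h (r n)) \<longlonglongrightarrow> 0" using LIMSEQ_subseq_LIMSEQ[OF h0 r(1)] by (simp add: o_def)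
  define m where "m n x = (cnj (u (x + h n *\<^sub>R ?e)) + cnj (u x)) /
     complex_of_real (reg_norm e (u (x + h n *\<^sub>R ?e)) + reg_norm e (u x))" for n x
  define m0 where "m0 x = cnj (u x) / complex_of_real (reg_norm e (u x))" for x
  have m_bound: "norm (m n x) \<le> 1" for n x unfolding m_def by (rule reg_norm_quotient_bound[OF e])
  have [measurable]: "m n \<in> borel_measurable borel" for n unfolding m_def by measurable
  have [measurable]: "m0 \<in> borel_measurable borel" unfolding m0_def by measurable
  have \<phi>_w: "\<phi> x * Re (z * w x) = \<phi> x * Re (z * w' x)" for x z
  proof (cases "x \<in> K")
    case True
    then have "x \<in> K'" unfolding K'_def by (intro UN_I[where a=x] UN_I[where a=0]) auto
    then show ?thesis by (simp add: w'_def)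
  qed (simp add: K(2))
  have \<phi>_eq: "AE x in lborel. \<forall>n. \<phi> x * ((F (x + h n *\<^sub>R ?e) - F x) / h n) = \<phi> x * Re (m n x * W n x)"
    using diff
  proof eventually_elim
    case (elim x)
    show ?case
    proof
      fix n
      show "\<phi> x * ((F (x + h n *\<^sub>R ?e) - F x) / h n) = \<phi> x * Re (m n x * W n x)"
      proof (cases "x \<in> K")
        case True
        then have "u (x + h n *\<^sub>R ?e) - u x = h n *\<^sub>R W n x" using elim W_eq by simp
        then have "F (x + h n *\<^sub>R ?e) - F x = Re (m n x * (h n *\<^sub>R W n x))"
          unfolding F_def m_def by (simp only: reg_norm_diff[OF e])
        then show ?thesis using h(1)[of n] by (simp add: mult.left_commute)
      qed (simp add: K(2))
    qed
  qed
  have m_lim: "AE x in lborel. x \<in> K \<longrightarrow> (\<lambda>n. m (r n) x) \<longlonglongrightarrow> m0 x"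
    using diff r(2)
  proof eventually_elim
    case (elim x)
    show ?case
    proof
      assume x: "x \<in> K"
      have "(\<lambda>n. W (r n) x) \<longlonglongrightarrow> w' x" using elim(2) by (rule LIM_zero_cancel)
      then have "(\<lambda>n. u x + h (r n) *\<^sub>R W (r n) x) \<longlonglongrightarrow> u x + 0 *\<^sub>R w' x"
        by (intro tendsto_intros hr0)
      moreover have "u (x + h n *\<^sub>R ?e) = u x + h n *\<^sub>R W n x" for n
        using elim(1)[rule_format, of n] W_eq[OF x] by (simp add: algebra_simps)
      ultimately have ut: "(\<lambda>n. u (x + h (r n) *\<^sub>R ?e)) \<longlonglongrightarrow> u x" by simp
      have "isCont (reg_norm e) (u x)" using continuous_on_reg_norm by (simp add: continuous_on_eq_continuous_at)
      from isCont_tendsto_compose[OF this ut]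
      have "(\<lambda>n. m (r n) x) \<longlonglongrightarrow> (cnj (u x) + cnj (u x)) / complex_of_real (reg_norm e (u x) + reg_norm e (u x))"
        unfolding m_def using reg_norm_pos[OF e, of "u x"]
        by (intro tendsto_intros ut) (auto simp flip: of_real_add)
      then show "(\<lambda>n. m (r n) x) \<longlonglongrightarrow> m0 x"
        by (simp add: m0_def flip: mult_2)
    qed
  qed
  define I where "I n = (\<integral>x. \<phi> x * ((F (x + h n *\<^sub>R ?e) - F x) / h n) \<partial>lborel)" for n
  have I_lim: "I \<longlonglongrightarrow> - (\<integral>x. pderiv_at j \<phi> x *\<^sub>R F x \<partial>lborel)"
  proof -
    have Q: "((\<lambda>h. \<integral>x. ((\<phi> (x + h *\<^sub>R ?e) - \<phi> x) / h) *\<^sub>R F x \<partial>lborel) \<longlongrightarrow>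
      (\<integral>x. pderiv_at j \<phi> x *\<^sub>R F x \<partial>lborel)) (at 0)"
      by (rule test_function_difference_quotient[OF F \<phi>])
    \<comment> \<open>With step \<open>- h n\<close>, translating the integration variable moves the
      quotient from \<open>\<phi>\<close> to \<open>F\<close>: summation by parts, with the sign of
      the weak derivative.\<close>
    have "filterlim (\<lambda>n. - h n) (at 0) sequentially"
      using h(1) tendsto_minus[OF h0] by (auto simp: filterlim_at)
    from tendsto_minus[OF filterlim_compose[OF Q this]]
    have "(\<lambda>n. - (\<integral>x. ((\<phi> (x + (- h n) *\<^sub>R ?e) - \<phi> x) / (- h n)) *\<^sub>R F x \<partial>lborel)) \<longlonglongrightarrow>
       - (\<integral>x. pderiv_at j \<phi> x *\<^sub>R F x \<partial>lborel)" .
    moreover have "- (\<integral>x. ((\<phi> (x + (- h n) *\<^sub>R ?e) - \<phi> x) / (- h n)) *\<^sub>R F x \<partial>lborel) = I n" for n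
    proof -
      have i1: "integrable lborel (\<lambda>x. \<phi> x * F x)" using integrable_test_scaleR[OF F \<phi>] by simp
      have i2: "integrable lborel (\<lambda>x. \<phi> (x - h n *\<^sub>R ?e) * F x)"
        using integrable_test_scaleR[OF F test_functions_translate[OF \<phi>, of "- h n *\<^sub>R ?e"]] by simp
      have i3: "integrable lborel (\<lambda>x. \<phi> x * F (x + h n *\<^sub>R ?e))"
        using integrable_test_scaleR[OF loc_integrable_translate[OF F] \<phi>] by simp
      have "- (\<integral>x. ((\<phi> (x + (- h n) *\<^sub>R ?e) - \<phi> x) / (- h n)) *\<^sub>R F x \<partial>lborel) =
        (\<integral>x. (\<phi> (x - h n *\<^sub>R ?e) * F x - \<phi> x * F x) / h n \<partial>lborel)"
        unfolding Bochner_Integration.integral_minus[symmetric]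
        by (intro Bochner_Integration.integral_cong) (simp_all add: algebra_simps)
      also have "\<dots> = ((\<integral>x. \<phi> (x - h n *\<^sub>R ?e) * F x \<partial>lborel) - (\<integral>x. \<phi> x * F x \<partial>lborel)) / h n"
        using i1 i2 by simp
      also have "(\<integral>x. \<phi> (x - h n *\<^sub>R ?e) * F x \<partial>lborel) = (\<integral>x. \<phi> x * F (x + h n *\<^sub>R ?e) \<partial>lborel)"
        using integral_lborel_translate[of "\<lambda>x. \<phi> (x - h n *\<^sub>R ?e) * F x" "h n *\<^sub>R ?e"] by simp
      also have "((\<integral>x. \<phi> x * F (x + h n *\<^sub>R ?e) \<partial>lborel) - (\<integral>x. \<phi> x * F x \<partial>lborel)) / h n =
        (\<integral>x. (\<phi> x * F (x + h n *\<^sub>R ?e) - \<phi> x * F x) / h n \<partial>lborel)"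
        using i1 i3 by simp
      also have "\<dots> = I n" unfolding I_def
        by (intro Bochner_Integration.integral_cong) (simp_all add: right_diff_distrib)
      finally show ?thesis .
    qed
    ultimately show ?thesis by simp
  qed
  have bnd: "norm (\<phi> x * Re (m n x * z)) \<le> B * norm z" for n x z
  proof -
    have "\<bar>Re (m n x * z)\<bar> \<le> norm (m n x) * norm z" using abs_Re_le_cmod[of "m n x * z"] by (simp only: norm_mult)
    also have "\<dots> \<le> norm z" by (intro mult_left_le_one_le m_bound) auto
    finally show ?thesis unfolding real_norm_def abs_mult using B by (intro mult_mono) (auto simp: less_imp_le)
  qed
  have bnd': "norm (\<phi> x * Re (m n x * z)) \<le> norm (B *\<^sub>R z)" for n x z
    using bnd[of x n z] B(1) by simp
  have int_A: "integrable lborel (\<lambda>x. \<phi> x * Re (m n x * (W n x - w' x)))" for n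
    by (rule Bochner_Integration.integrable_bound[OF integrable_scaleR_right[OF Bochner_Integration.integrable_diff[OF W_int w']] _ AE_I2[OF bnd']])
      measurable
  have int_B: "integrable lborel (\<lambda>x. \<phi> x * Re (m n x * w' x))" for n
    by (rule Bochner_Integration.integrable_bound[OF integrable_scaleR_right[OF w'] _ AE_I2[OF bnd']]) measurable
  have I_split: "I n = (\<integral>x. \<phi> x * Re (m n x * (W n x - w' x)) \<partial>lborel) + (\<integral>x. \<phi> x * Re (m n x * w' x) \<partial>lborel)" for n
  proof -
    have "I n = (\<integral>x. \<phi> x * Re (m n x * W n x) \<partial>lborel)"
      unfolding I_def by (rule integral_cong_AE) (use \<phi>_eq in \<open>auto elim: eventually_mono\<close>)
    also have "\<dots> = (\<integral>x. \<phi> x * Re (m n x * (W n x - w' x)) + \<phi> x * Re (m n x * w' x) \<partial>lborel)"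
      by (intro Bochner_Integration.integral_cong) (simp_all add: algebra_simps)
    finally show ?thesis using int_A int_B by simp
  qed
  have A_lim: "(\<lambda>n. \<integral>x. \<phi> x * Re (m n x * (W n x - w' x)) \<partial>lborel) \<longlonglongrightarrow> 0"
  proof (rule Lim_null_comparison)
    show "\<forall>\<^sub>F n in sequentially. norm (\<integral>x. \<phi> x * Re (m n x * (W n x - w' x)) \<partial>lborel) \<le>
        B * (\<integral>x. norm (W n x - w' x) \<partial>lborel)"
    proof (intro always_eventually allI)
      fix n
      have "norm (\<integral>x. \<phi> x * Re (m n x * (W n x - w' x)) \<partial>lborel) \<le>
        (\<integral>x. B * norm (W n x - w' x) \<partial>lborel)"
        by (rule order_trans[OF integral_norm_bound integral_mono[OF integrable_norm[OF int_A] _ bnd]])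
          (intro integrable_mult_right integrable_norm Bochner_Integration.integrable_diff W_int w')
      then show "norm (\<integral>x. \<phi> x * Re (m n x * (W n x - w' x)) \<partial>lborel) \<le>
        B * (\<integral>x. norm (W n x - w' x) \<partial>lborel)" by simp
    qed
    show "(\<lambda>n. B * (\<integral>x. norm (W n x - w' x) \<partial>lborel)) \<longlonglongrightarrow> 0"
      using tendsto_mult_right_zero[OF W_lim] .
  qed
  have B_lim: "(\<lambda>n. \<integral>x. \<phi> x * Re (m (r n) x * w' x) \<partial>lborel) \<longlonglongrightarrow> (\<integral>x. \<phi> x * Re (m0 x * w' x) \<partial>lborel)"
  proof (rule integral_dominated_convergence[where w="\<lambda>x. B * norm (w' x)"])
    show "AE x in lborel. (\<lambda>n. \<phi> x * Re (m (r n) x * w' x)) \<longlonglongrightarrow> \<phi> x * Re (m0 x * w' x)"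
      using m_lim
    proof eventually_elim
      case (elim x)
      show ?case
      proof (cases "x \<in> K")
        case True
        then show ?thesis using elim by (intro tendsto_intros) auto
      qed (simp add: K(2))
    qed
    show "AE x in lborel. norm (\<phi> x * Re (m (r n) x * w' x)) \<le> B * norm (w' x)" for n
      by (rule AE_I2[OF bnd])
  qed (use w' in auto)
  have "(\<lambda>n. I (r n)) \<longlonglongrightarrow> 0 + (\<integral>x. \<phi> x * Re (m0 x * w' x) \<partial>lborel)"
    unfolding I_split using LIMSEQ_subseq_LIMSEQ[OF A_lim r(1)]
    by (intro tendsto_add B_lim) (simp add: o_def)
  moreover have "(\<lambda>n. I (r n)) \<longlonglongrightarrow> - (\<integral>x. pderiv_at j \<phi> x *\<^sub>R F x \<partial>lborel)"
    using LIMSEQ_subseq_LIMSEQ[OF I_lim r(1)] by (simp add: o_def)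
  ultimately have "0 + (\<integral>x. \<phi> x * Re (m0 x * w' x) \<partial>lborel) = - (\<integral>x. pderiv_at j \<phi> x *\<^sub>R F x \<partial>lborel)"
    by (rule LIMSEQ_unique)
  then show "(\<integral>x. \<phi> x *\<^sub>R Re (cnj (u x) / of_real (reg_norm e (u x)) * w x) \<partial>lborel) =
      - (\<integral>x. pderiv_at j \<phi> x *\<^sub>R reg_norm e (u x) \<partial>lborel)"
    by (simp only: F_def m0_def real_scaleR_def \<phi>_w)
qed

text \<open>The convention \<open>z / 0 = 0\<close> makes the formula below give \<open>0\<close> on the zero set of \<open>u\<close>.\<close>

lemma weak_deriv_norm:
  fixes u w :: "real ^ 'n \<Rightarrow> complex"
  assumes u: "loc_integrable u" and w: "loc_integrable w" and uw: "weak_deriv j u w"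
  shows "weak_deriv j (\<lambda>x. norm (u x)) (\<lambda>x. Re (cnj (u x) / of_real (norm (u x)) * w x))"
  unfolding weak_deriv_def
proof
  fix \<phi> :: "real ^ 'n \<Rightarrow> real" assume \<phi>: "\<phi> \<in> test_functions"
  note [measurable] = loc_integrable_measurable[OF u] loc_integrable_measurable[OF w]
    test_functions_measurable[OF \<phi>] test_functions_measurable[OF pderiv_test_function[OF \<phi>]]
  define h where "h n = inverse (real (Suc n))" for n
  have h: "h n \<noteq> 0" "0 < h n" "h n \<le> 1" for n by (auto simp: h_def inverse_le_1_iff)
  have h0: "h \<longlonglongrightarrow> 0" unfolding h_def by (rule LIMSEQ_inverse_real_of_nat)
  have F_lim: "(\<lambda>n. reg_norm (h n) z) \<longlonglongrightarrow> norm z" for z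
  proof -
    have "(\<lambda>n. reg_norm (h n) z) \<longlonglongrightarrow> sqrt ((norm z)\<^sup>2 + 0\<^sup>2)"
      unfolding reg_norm_def by (intro tendsto_intros h0)
    then show ?thesis by simp
  qed
  have m_bound: "norm (cnj z / complex_of_real (reg_norm (h n) z)) \<le> 1" for z n
    using reg_norm_quotient_bound[OF h(1), of z z n] by (simp flip: mult_2)
  have L: "(\<lambda>n. \<integral>x. \<phi> x *\<^sub>R Re (cnj (u x) / of_real (reg_norm (h n) (u x)) * w x) \<partial>lborel) \<longlonglongrightarrow>
    (\<integral>x. \<phi> x *\<^sub>R Re (cnj (u x) / of_real (norm (u x)) * w x) \<partial>lborel)"
  proof (rule integral_dominated_convergence[where w="\<lambda>x. norm (\<phi> x *\<^sub>R w x)"])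
    show "integrable lborel (\<lambda>x. norm (\<phi> x *\<^sub>R w x))"
      by (rule integrable_norm[OF integrable_test_scaleR[OF w \<phi>]])
    show "AE x in lborel. (\<lambda>n. \<phi> x *\<^sub>R Re (cnj (u x) / of_real (reg_norm (h n) (u x)) * w x))
       \<longlonglongrightarrow> \<phi> x *\<^sub>R Re (cnj (u x) / of_real (norm (u x)) * w x)"
    proof (rule AE_I2)
      fix x
      show "(\<lambda>n. \<phi> x *\<^sub>R Re (cnj (u x) / of_real (reg_norm (h n) (u x)) * w x))
       \<longlonglongrightarrow> \<phi> x *\<^sub>R Re (cnj (u x) / of_real (norm (u x)) * w x)"
        \<comment> \<open>At a zero of u the factor \<open>cnj (u x)\<close> makes both sides 0, so
          the vanishing denominator in the limit does no harm.\<close>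
        by (cases "u x = 0") (auto intro!: tendsto_intros F_lim)
    qed
    show "AE x in lborel. norm (\<phi> x *\<^sub>R Re (cnj (u x) / of_real (reg_norm (h n) (u x)) * w x)) \<le> norm (\<phi> x *\<^sub>R w x)" for n
    proof (rule AE_I2)
      fix x
      have "\<bar>Re (cnj (u x) / of_real (reg_norm (h n) (u x)) * w x)\<bar> \<le> norm (cnj (u x) / of_real (reg_norm (h n) (u x)) * w x)"
        by (rule abs_Re_le_cmod)
      also have "\<dots> \<le> norm (w x)" unfolding norm_mult by (intro mult_left_le_one_le m_bound) auto
      finally show "norm (\<phi> x *\<^sub>R Re (cnj (u x) / of_real (reg_norm (h n) (u x)) * w x)) \<le> norm (\<phi> x *\<^sub>R w x)"
        unfolding norm_scaleR real_scaleR_def real_norm_def abs_mult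
        by (rule mult_left_mono[OF _ abs_ge_zero])
    qed
  qed measurable
  \<comment> \<open>A common majorant of all the regularized moduli, because \<open>h n\<close> is
    at most 1.\<close>
  have nu: "loc_integrable (\<lambda>x. norm (u x) + 1)"
    by (intro loc_integrable_add continuous_loc_integrable loc_integrable_bound[OF u]) auto
  have R: "(\<lambda>n. \<integral>x. pderiv_at j \<phi> x *\<^sub>R reg_norm (h n) (u x) \<partial>lborel) \<longlonglongrightarrow>
    (\<integral>x. pderiv_at j \<phi> x *\<^sub>R norm (u x) \<partial>lborel)"
  proof (rule integral_dominated_convergence[where w="\<lambda>x. norm (pderiv_at j \<phi> x *\<^sub>R (norm (u x) + 1))"])
    show "integrable lborel (\<lambda>x. norm (pderiv_at j \<phi> x *\<^sub>R (norm (u x) + 1)))"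
      by (rule integrable_norm[OF integrable_test_scaleR[OF nu pderiv_test_function[OF \<phi>]]])
    show "AE x in lborel. (\<lambda>n. pderiv_at j \<phi> x *\<^sub>R reg_norm (h n) (u x)) \<longlonglongrightarrow> pderiv_at j \<phi> x *\<^sub>R norm (u x)"
      by (intro AE_I2 tendsto_intros F_lim)
    show "AE x in lborel. norm (pderiv_at j \<phi> x *\<^sub>R reg_norm (h n) (u x)) \<le> norm (pderiv_at j \<phi> x *\<^sub>R (norm (u x) + 1))" for n
    proof (rule AE_I2)
      fix x
      have "\<bar>reg_norm (h n) (u x)\<bar> \<le> norm (u x) + 1"
        using reg_norm_le[of "h n" "u x"] reg_norm_pos[OF h(1), of n "u x"] h[of n] by simp
      then show "norm (pderiv_at j \<phi> x *\<^sub>R reg_norm (h n) (u x)) \<le> norm (pderiv_at j \<phi> x *\<^sub>R (norm (u x) + 1))"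
        by (simp add: abs_mult mult_left_mono)
    qed
  qed measurable
  show "(\<integral>x. \<phi> x *\<^sub>R Re (cnj (u x) / of_real (norm (u x)) * w x) \<partial>lborel) = - (\<integral>x. pderiv_at j \<phi> x *\<^sub>R norm (u x) \<partial>lborel)"
    using LIMSEQ_unique[OF L] tendsto_minus[OF R] weak_deriv_reg_norm[OF u w uw h(1)] \<phi>
    by (simp add: weak_deriv_def)
qed

section \<open>Magnetic gradients\<close>

text \<open>The passage from the Lebesgue measurable functions of the statement to the Borel
  functions used for weak derivatives; real and imaginary parts are treated separately.\<close>

lemma borel_representative:
  fixes f :: "'a::euclidean_space \<Rightarrow> complex"
  assumes f: "f \<in> borel_measurable lebesgue"
  obtains f' where "f' \<in> borel_measurable borel" "AE x in lebesgue. f x = f' x"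
proof -
  have "(\<lambda>x. Re (f x)) \<in> borel_measurable lebesgue" "(\<lambda>x. Im (f x)) \<in> borel_measurable lebesgue"
    using f by measurable
  then obtain a b where ab: "a \<in> borel_measurable lborel" "AE x in lborel. Re (f x) = a x"
    "b \<in> borel_measurable lborel" "AE x in lborel. Im (f x) = b x"
    using completion_ex_borel_measurable_real by metis
  have [measurable]: "a \<in> borel_measurable borel" "b \<in> borel_measurable borel" using ab by simp_all
  show ?thesis
  proof
    show "(\<lambda>x. of_real (a x) + \<i> * of_real (b x)) \<in> borel_measurable borel" by measurable
    have "AE x in lborel. f x = of_real (a x) + \<i> * of_real (b x)"
      using ab(2,4) by eventually_elim (simp add: complex_eq_iff)
    then show "AE x in lebesgue. f x = of_real (a x) + \<i> * of_real (b x)" by (rule AE_completion)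
  qed
qed

lemma borel_measurable_lebesgueI: "f \<in> borel_measurable borel \<Longrightarrow> f \<in> borel_measurable lebesgue"
  by (simp add: measurable_completion)

lemma integral_lebesgue_eq_lborel:
  fixes f :: "'a::euclidean_space \<Rightarrow> 'b::{banach, second_countable_topology}"
  shows "f \<in> borel_measurable borel \<Longrightarrow> integral\<^sup>L lebesgue f = integral\<^sup>L lborel f"
  by (simp add: integral_completion)

lemma loc_integrable_representative:
  fixes f :: "'a::euclidean_space \<Rightarrow> complex"
  assumes f: "f \<in> borel_measurable lebesgue" "\<And>K. compact K \<Longrightarrow> set_integrable lebesgue K f"
  obtains f' where "loc_integrable f'" "AE x in lebesgue. f x = f' x"
proof -
  obtain f' where f': "f' \<in> borel_measurable borel" "AE x in lebesgue. f x = f' x"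
    using borel_representative[OF f(1)] .
  have "integrable lborel (\<lambda>x. indicator K x *\<^sub>R f' x)" if K: "compact K" for K
  proof -
    have [measurable]: "K \<in> sets borel" "f' \<in> borel_measurable borel" using borel_compact[OF K] f' by auto
    have "integrable lebesgue (\<lambda>x. indicator K x *\<^sub>R f x)" using f(2)[OF K] by (simp add: set_integrable_def)
    moreover have "AE x in lebesgue. indicator K x *\<^sub>R f x = indicator K x *\<^sub>R f' x"
      using f'(2) by eventually_elim simp
    moreover have "(\<lambda>x. indicator K x *\<^sub>R f' x) \<in> borel_measurable lebesgue"
      by (rule borel_measurable_lebesgueI) measurable
    ultimately have "integrable lebesgue (\<lambda>x. indicator K x *\<^sub>R f' x)"
      by (intro integrable_cong_AE_imp[where f="\<lambda>x. indicator K x *\<^sub>R f' x" and g="\<lambda>x. indicator K x *\<^sub>R f x"])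
    then show ?thesis by (subst (asm) integrable_completion) auto
  qed
  then show ?thesis using that f' by (auto simp: loc_integrable_def set_integrable_def)
qed

lemma set_integrable_bound_lebesgue:
  fixes f :: "'a::euclidean_space \<Rightarrow> 'b::{banach, second_countable_topology}" and g :: "'a \<Rightarrow> real"
  assumes f: "f \<in> borel_measurable lebesgue" and g: "set_integrable lebesgue K g" and K: "compact K"
    and le: "\<And>x. norm (f x) \<le> g x"
  shows "set_integrable lebesgue K f"
  unfolding set_integrable_def
proof (rule Bochner_Integration.integrable_bound[OF g[unfolded set_integrable_def]])
  have [measurable]: "K \<in> sets lebesgue" using borel_compact[OF K] by simp
  show "(\<lambda>x. indicator K x *\<^sub>R f x) \<in> borel_measurable lebesgue" using f by measurable
  show "AE x in lebesgue. norm (indicator K x *\<^sub>R f x) \<le> norm (indicator K x *\<^sub>R g x)"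
    using order_trans[OF le abs_ge_self] by (intro AE_I2) (auto split: split_indicator)
qed

lemma set_integrable_const_lebesgue: "compact K \<Longrightarrow> set_integrable lebesgue K (\<lambda>_. c :: real)"
  using borel_compact[of K] emeasure_compact_finite[of K]
  by (auto simp: set_integrable_def intro!: integrable_mult_left integrable_real_indicator)

lemma integrable_imp_set_integrable_lebesgue:
  fixes f :: "'a::euclidean_space \<Rightarrow> real"
  assumes "integrable lebesgue f" "compact K"
  shows "set_integrable lebesgue K f"
  unfolding set_integrable_def
  using assms(1) borel_compact[OF assms(2)] by (intro integrable_mult_indicator) auto

section \<open>Local integrability of L^2 functions and of the magnetic term\<close>

lemma le_one_plus_square: "(x::real) \<le> 1 + x\<^sup>2"
proof -
  have "0 \<le> (x - 1/2)\<^sup>2" by simp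
  then show ?thesis by (simp add: power2_eq_square algebra_simps)
qed

lemma mult_le_sum_squares: "(a::real) * b \<le> a\<^sup>2 + b\<^sup>2"
proof -
  have "0 \<le> (a - b/2)\<^sup>2 + 3/4 * b\<^sup>2" by simp
  then show ?thesis by (simp add: power2_eq_square algebra_simps)
qed

lemma norm_powr_2: "norm x powr 2 = (norm x)\<^sup>2"
  by (cases "norm x = 0") (auto simp: powr_numeral)

lemma norm_powr_1: "norm x powr 1 = norm x"
  by (cases "norm x = 0") auto

lemma Lq_space_2_iff:
  "f \<in> Lq_space 2 \<longleftrightarrow> f \<in> borel_measurable lebesgue \<and> integrable lebesgue (\<lambda>x. (norm (f x))\<^sup>2)"
  by (simp add: Lq_space_def norm_powr_2)

lemma Lq_loc_2_D:
  "f \<in> Lq_loc 2 \<Longrightarrow> compact K \<Longrightarrow> set_integrable lebesgue K (\<lambda>x. (norm (f x))\<^sup>2)"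
  by (simp add: Lq_loc_def norm_powr_2)

lemma Lq_loc_1_iff:
  "f \<in> Lq_loc 1 \<longleftrightarrow> f \<in> borel_measurable lebesgue \<and> (\<forall>K. compact K \<longrightarrow> set_integrable lebesgue K (\<lambda>x. norm (f x)))"
  by (simp add: Lq_loc_def norm_powr_1)

lemma Lq_space_2_imp_Lq_loc_1:
  fixes f :: "'a::euclidean_space \<Rightarrow> 'b::{banach, second_countable_topology}"
  assumes "f \<in> Lq_space 2"
  shows "f \<in> Lq_loc 1"
  unfolding Lq_loc_1_iff
proof (intro conjI allI impI)
  show m[measurable]: "f \<in> borel_measurable lebesgue" using assms by (simp add: Lq_space_2_iff)
  fix K :: "'a set" assume K: "compact K"
  show "set_integrable lebesgue K (\<lambda>x. norm (f x))"
  proof (rule set_integrable_bound_lebesgue[OF _ _ K])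
    show "set_integrable lebesgue K (\<lambda>x. 1 + (norm (f x))\<^sup>2)"
      using assms by (intro set_integral_add set_integrable_const_lebesgue K integrable_imp_set_integrable_lebesgue)
        (auto simp: Lq_space_2_iff)
    show "norm (norm (f x)) \<le> 1 + (norm (f x))\<^sup>2" for x
      using le_one_plus_square[of "norm (f x)"] by simp
  qed measurable
qed

lemma vec_nth_measurable_lebesgue:
  fixes f :: "'a::euclidean_space \<Rightarrow> 'b::euclidean_space ^ 'n"
  assumes [measurable]: "f \<in> borel_measurable lebesgue"
  shows "(\<lambda>x. f x $ j) \<in> borel_measurable lebesgue"
proof -
  have "(\<lambda>v :: 'b ^ 'n. v $ j) \<in> borel_measurable borel"
    by (intro borel_measurable_continuous_onI continuous_intros)
  from measurable_compose[OF assms this] show ?thesis .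
qed

lemma Lq_loc_1_component:
  fixes g :: "'a::euclidean_space \<Rightarrow> complex ^ 'n"
  assumes g: "g \<in> Lq_loc 1" and K: "compact K"
  shows "set_integrable lebesgue K (\<lambda>x. g x $ j)"
proof (rule set_integrable_bound_lebesgue[OF _ _ K])
  show "(\<lambda>x. g x $ j) \<in> borel_measurable lebesgue"
    by (rule vec_nth_measurable_lebesgue) (use g in \<open>simp add: Lq_loc_1_iff\<close>)
  show "set_integrable lebesgue K (\<lambda>x. norm (g x))" using g K by (simp add: Lq_loc_1_iff)
qed (rule Finite_Cartesian_Product.norm_nth_le)

text \<open>Pointwise Young inequality: |A| |\<psi>| is at most |A|^2 + |\<psi>|^2, which is
  integrable on compact sets. This makes it legitimate to separate the magnetic term from the
  gradient.\<close>

lemma magnetic_term_loc_integrable: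
  fixes A :: "'a::euclidean_space \<Rightarrow> real ^ 'n" and \<psi> :: "'a \<Rightarrow> complex"
  assumes A: "A \<in> Lq_loc 2" and \<psi>: "\<psi> \<in> Lq_space 2"
  shows "(\<lambda>x. \<i> * of_real (A x $ j) * \<psi> x) \<in> borel_measurable lebesgue"
    "compact K \<Longrightarrow> set_integrable lebesgue K (\<lambda>x. \<i> * of_real (A x $ j) * \<psi> x)"
proof -
  have [measurable]: "A \<in> borel_measurable lebesgue" "\<psi> \<in> borel_measurable lebesgue"
    using A \<psi> by (simp_all add: Lq_loc_def Lq_space_def)
  note [measurable] = vec_nth_measurable_lebesgue[of A j]
  show m: "(\<lambda>x. \<i> * of_real (A x $ j) * \<psi> x) \<in> borel_measurable lebesgue" by measurable
  assume K: "compact K"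
  show "set_integrable lebesgue K (\<lambda>x. \<i> * of_real (A x $ j) * \<psi> x)"
  proof (rule set_integrable_bound_lebesgue[OF m _ K])
    show "set_integrable lebesgue K (\<lambda>x. (norm (A x))\<^sup>2 + (norm (\<psi> x))\<^sup>2)"
      using \<psi> by (intro set_integral_add Lq_loc_2_D[OF A] integrable_imp_set_integrable_lebesgue K)
        (auto simp: Lq_space_2_iff)
    show "norm (\<i> * of_real (A x $ j) * \<psi> x) \<le> (norm (A x))\<^sup>2 + (norm (\<psi> x))\<^sup>2" for x
    proof -
      have "norm (\<i> * of_real (A x $ j) * \<psi> x) = \<bar>A x $ j\<bar> * norm (\<psi> x)" by (simp add: norm_mult)
      also have "\<dots> \<le> norm (A x) * norm (\<psi> x)" by (intro mult_right_mono component_le_norm_cart) simp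
      finally show ?thesis using mult_le_sum_squares[of "norm (A x)" "norm (\<psi> x)"] by linarith
    qed
  qed
qed

lemma integrable_test_lebesgue:
  fixes f :: "real ^ 'n \<Rightarrow> complex"
  assumes f: "f \<in> borel_measurable lebesgue" "\<And>K. compact K \<Longrightarrow> set_integrable lebesgue K f"
    and \<phi>: "\<phi> \<in> test_functions"
  shows "integrable lebesgue (\<lambda>x. f x * of_real (\<phi> x))"
proof -
  obtain f' where f': "loc_integrable f'" "AE x in lebesgue. f x = f' x"
    using loc_integrable_representative[OF f] by metis
  have [measurable]: "\<phi> \<in> borel_measurable lebesgue" "f \<in> borel_measurable lebesgue"
    using test_functions_measurable[OF \<phi>] f by (auto intro: borel_measurable_lebesgueI)
  have int: "integrable lborel (\<lambda>x. \<phi> x *\<^sub>R f' x)" by (rule integrable_test_scaleR[OF f'(1) \<phi>])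
  then have "integrable lebesgue (\<lambda>x. \<phi> x *\<^sub>R f' x)"
    by (subst integrable_completion) (auto simp: borel_measurable_integrable)
  moreover have "AE x in lebesgue. \<phi> x *\<^sub>R f' x = f x * of_real (\<phi> x)"
    using f'(2) by eventually_elim (simp add: scaleR_conv_of_real mult.commute)
  moreover have "(\<lambda>x. f x * of_real (\<phi> x)) \<in> borel_measurable lebesgue" by measurable
  ultimately show ?thesis by (intro integrable_cong_AE_imp[where f="\<lambda>x. f x * of_real (\<phi> x)" and g="\<lambda>x. \<phi> x *\<^sub>R f' x"])
qed

lemma integral_representative:
  fixes f f' :: "real ^ 'n \<Rightarrow> complex"
  assumes f: "f \<in> borel_measurable lebesgue" and f': "f' \<in> borel_measurable borel"
    and eq: "AE x in lebesgue. f x = f' x" and \<phi>: "\<phi> \<in> borel_measurable borel"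
  shows "(LINT x|lebesgue. f x * of_real (\<phi> x)) = (\<integral>x. \<phi> x *\<^sub>R f' x \<partial>lborel)"
proof -
  have [measurable]: "f \<in> borel_measurable lebesgue" "f' \<in> borel_measurable borel" "\<phi> \<in> borel_measurable borel"
    "\<phi> \<in> borel_measurable lebesgue" using f f' \<phi> by (auto intro: borel_measurable_lebesgueI)
  have "(\<lambda>x. \<phi> x *\<^sub>R f' x) \<in> borel_measurable borel" by measurable
  then have "(\<integral>x. \<phi> x *\<^sub>R f' x \<partial>lborel) = (LINT x|lebesgue. \<phi> x *\<^sub>R f' x)"
    by (rule integral_lebesgue_eq_lborel[symmetric])
  also have "\<dots> = (LINT x|lebesgue. f x * of_real (\<phi> x))"
  proof (rule integral_cong_AE)
    show "(\<lambda>x. \<phi> x *\<^sub>R f' x) \<in> borel_measurable lebesgue" by (rule borel_measurable_lebesgueI) measurable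
    show "AE x in lebesgue. \<phi> x *\<^sub>R f' x = f x * of_real (\<phi> x)"
      using eq by eventually_elim (simp add: scaleR_conv_of_real mult.commute)
  qed measurable
  finally show ?thesis by simp
qed

section \<open>Uniqueness of the magnetic gradient and membership in the magnetic Sobolev
  space\<close>

text \<open>Two magnetic gradients of the same function have equal pairings with every test
  function. The lemma frees norms of \<open>mgrad\<close> from the arbitrary choice in its
  definition.\<close>

lemma magnetic_gradient_unique:
  fixes g g' :: "real ^ 'n \<Rightarrow> complex ^ 'n"
  assumes g: "is_magnetic_gradient A \<psi> g" and g': "is_magnetic_gradient A \<psi> g'"
  shows "AE x in lebesgue. g x = g' x"
proof -
  have "AE x in lebesgue. g x $ j = g' x $ j" for j
  proof -
    have g1: "g \<in> Lq_loc 1" "g' \<in> Lq_loc 1" using g g' by (simp_all add: is_magnetic_gradient_def)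
    then have "g \<in> borel_measurable lebesgue" "g' \<in> borel_measurable lebesgue" by (simp_all add: Lq_loc_1_iff)
    then have m: "(\<lambda>x. g x $ j) \<in> borel_measurable lebesgue" "(\<lambda>x. g' x $ j) \<in> borel_measurable lebesgue"
      by (auto dest: vec_nth_measurable_lebesgue)
    have s: "set_integrable lebesgue K (\<lambda>x. g x $ j)" "set_integrable lebesgue K (\<lambda>x. g' x $ j)" if "compact K" for K
      using g1 that by (auto intro: Lq_loc_1_component)
    define d where "d x = g x $ j - g' x $ j" for x
    have dm: "d \<in> borel_measurable lebesgue" unfolding d_def using m by measurable
    have ds: "set_integrable lebesgue K d" if "compact K" for K
      unfolding d_def by (intro set_integral_diff s that)
    obtain f where f: "loc_integrable f" "AE x in lebesgue. d x = f x"
      using loc_integrable_representative[OF dm ds] by metis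
    have "AE x in lborel. f x = 0"
    proof (rule test_functions_separate[OF f(1)])
      fix \<phi> :: "real ^ 'n \<Rightarrow> real" assume \<phi>: "\<phi> \<in> test_functions"
      have "(\<integral>x. \<phi> x *\<^sub>R f x \<partial>lborel) = (LINT x|lebesgue. d x * of_real (\<phi> x))"
        by (rule integral_representative[OF dm loc_integrable_measurable[OF f(1)] f(2) test_functions_measurable[OF \<phi>], symmetric])
      also have "\<dots> = (LINT x|lebesgue. g x $ j * of_real (\<phi> x)) - (LINT x|lebesgue. g' x $ j * of_real (\<phi> x))"
        unfolding d_def left_diff_distrib
        by (intro Bochner_Integration.integral_diff integrable_test_lebesgue[OF m(1) s(1) \<phi>]
            integrable_test_lebesgue[OF m(2) s(2) \<phi>])
      also have "\<dots> = 0" using g g' \<phi> by (simp add: is_magnetic_gradient_def)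
      finally show "(\<integral>x. \<phi> x *\<^sub>R f x \<partial>lborel) = 0" .
    qed
    from AE_completion[OF this] f(2) show ?thesis
      by eventually_elim (simp add: d_def)
  qed
  then have "AE x in lebesgue. \<forall>j. g x $ j = g' x $ j" by (simp add: AE_all_countable)
  then show ?thesis by eventually_elim (simp add: vec_eq_iff)
qed

lemma Lq_norm_cong_AE:
  assumes f: "f \<in> borel_measurable lebesgue" and g: "g \<in> borel_measurable lebesgue"
    and eq: "AE x in lebesgue. f x = g x"
  shows "f \<in> Lq_space q \<longleftrightarrow> g \<in> Lq_space q" "Lq_norm q f = Lq_norm q g"
proof -
  have [measurable]: "f \<in> borel_measurable lebesgue" "g \<in> borel_measurable lebesgue" using f g by auto
  have m: "(\<lambda>x. norm (f x) powr q) \<in> borel_measurable lebesgue" "(\<lambda>x. norm (g x) powr q) \<in> borel_measurable lebesgue"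
    by measurable
  have e: "AE x in lebesgue. norm (f x) powr q = norm (g x) powr q"
    using eq by eventually_elim simp
  show 1: "f \<in> Lq_space q \<longleftrightarrow> g \<in> Lq_space q"
    using integrable_cong_AE[OF m e] f g by (simp add: Lq_space_def)
  show "Lq_norm q f = Lq_norm q g"
    using 1 integral_cong_AE[OF m e] by (simp add: Lq_norm_def)
qed

text \<open>Lets any explicitly given gradient stand in for the chosen one.\<close>

lemma H1_magI:
  assumes \<psi>: "\<psi> \<in> Lq_space 2" and g: "is_magnetic_gradient A \<psi> g" "g \<in> Lq_space 2"
  shows "\<psi> \<in> H1_mag A" "Lq_norm 2 (mgrad A \<psi>) = Lq_norm 2 g"
proof -
  have m: "is_magnetic_gradient A \<psi> (mgrad A \<psi>)"
    unfolding mgrad_def by (rule someI[of _ g]) (rule g(1))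
  have meas: "mgrad A \<psi> \<in> borel_measurable lebesgue" "g \<in> borel_measurable lebesgue"
    using m g by (auto simp: is_magnetic_gradient_def Lq_loc_1_iff)
  note cong = Lq_norm_cong_AE[OF meas magnetic_gradient_unique[OF m g(1)], of 2]
  show "\<psi> \<in> H1_mag A" using \<psi> g cong(1) by (auto simp: H1_mag_def)
  show "Lq_norm 2 (mgrad A \<psi>) = Lq_norm 2 g" by (rule cong(2))
qed

lemma H1_magD:
  assumes "\<psi> \<in> H1_mag A"
  shows "\<psi> \<in> Lq_space 2" "is_magnetic_gradient A \<psi> (mgrad A \<psi>)" "mgrad A \<psi> \<in> Lq_space 2"
proof -
  show "\<psi> \<in> Lq_space 2" "mgrad A \<psi> \<in> Lq_space 2" using assms by (auto simp: H1_mag_def)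
  have "\<exists>g. is_magnetic_gradient A \<psi> g" using assms by (auto simp: H1_mag_def)
  then show "is_magnetic_gradient A \<psi> (mgrad A \<psi>)" unfolding mgrad_def by (rule someI_ex)
qed

lemma Lq_norm_square:
  assumes "f \<in> Lq_space q"
  shows "(Lq_norm q f)\<^sup>2 = ereal ((LINT x|lebesgue. norm (f x) powr q) powr (2 / q))"
proof -
  let ?I = "LINT x|lebesgue. norm (f x) powr q"
  have "(Lq_norm q f)\<^sup>2 = ereal ((?I powr (1 / q))\<^sup>2)" using assms by (simp add: Lq_norm_def)
  also have "(?I powr (1 / q))\<^sup>2 = ?I powr (2 / q)"
    by (simp add: power2_eq_square powr_add[symmetric])
  finally show ?thesis .
qed

lemma Lq_norm_2_square:
  assumes "f \<in> Lq_space 2"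
  shows "(Lq_norm 2 f)\<^sup>2 = ereal (LINT x|lebesgue. (norm (f x))\<^sup>2)"
  using Lq_norm_square[OF assms] by (simp add: norm_powr_2 integral_nonneg_AE)

text \<open>The component \<open>i A \<psi>\<close> of the weak gradient of \<open>\<psi>\<close> is
  orthogonal to \<open>\<psi>\<close> pointwise, so that it does not contribute to \<open>\<nabla>|\<psi>|\<close>.\<close>

lemma diamagnetic:
  fixes A :: "real ^ 'n \<Rightarrow> real ^ 'n"
  assumes A: "A \<in> Lq_loc 2" and \<psi>: "\<psi> \<in> Lq_space 2" and g: "is_magnetic_gradient A \<psi> g"
  obtains u :: "real ^ 'n \<Rightarrow> real" and v :: "'n \<Rightarrow> real ^ 'n \<Rightarrow> real"
  where "loc_integrable u" "\<And>j. loc_integrable (v j)" "\<And>j. weak_deriv j u (v j)"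
    "AE x in lebesgue. u x = norm (\<psi> x)" "AE x in lebesgue. (\<Sum>j\<in>UNIV. (v j x)\<^sup>2) \<le> (norm (g x))\<^sup>2"
proof -
  have \<psi>m: "\<psi> \<in> borel_measurable lebesgue" using \<psi> by (simp add: Lq_space_def)
  have \<psi>s: "set_integrable lebesgue K \<psi>" if K: "compact K" for K
    using Lq_space_2_imp_Lq_loc_1[OF \<psi>] K
    by (intro set_integrable_bound_lebesgue[OF \<psi>m _ K, of "\<lambda>x. norm (\<psi> x)"]) (auto simp: Lq_loc_1_iff)
  obtain f where f: "loc_integrable f" "AE x in lebesgue. \<psi> x = f x"
    using loc_integrable_representative[OF \<psi>m \<psi>s] by metis
  have g1: "g \<in> Lq_loc 1" using g by (simp add: is_magnetic_gradient_def)
  \<comment> \<open>Subtracting the magnetic term leaves the plain weak derivative, for which only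
    local integrability is available.\<close>
  have "\<exists>w. loc_integrable w \<and> weak_deriv j f w \<and>
      (AE x in lebesgue. g x $ j - \<i> * of_real (A x $ j) * \<psi> x = w x)" for j
  proof -
    let ?b = "\<lambda>x. \<i> * of_real (A x $ j) * \<psi> x"
    have gm: "(\<lambda>x. g x $ j) \<in> borel_measurable lebesgue"
      by (rule vec_nth_measurable_lebesgue) (use g1 in \<open>simp add: Lq_loc_1_iff\<close>)
    have gs: "set_integrable lebesgue K (\<lambda>x. g x $ j)" if "compact K" for K
      by (rule Lq_loc_1_component[OF g1 that])
    have bm: "?b \<in> borel_measurable lebesgue" by (rule magnetic_term_loc_integrable(1)[OF A \<psi>])
    have bs: "set_integrable lebesgue K ?b" if "compact K" for K
      by (rule magnetic_term_loc_integrable(2)[OF A \<psi> that])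
    define d where "d x = g x $ j - ?b x" for x
    have dm: "d \<in> borel_measurable lebesgue" unfolding d_def using gm bm by simp
    have ds: "set_integrable lebesgue K d" if "compact K" for K
      unfolding d_def by (rule set_integral_diff(1)[OF gs[OF that] bs[OF that]])
    obtain w where w: "loc_integrable w" "AE x in lebesgue. d x = w x"
      using loc_integrable_representative[OF dm ds] by metis
    have "weak_deriv j f w"
      unfolding weak_deriv_def
    proof
      fix \<phi> :: "real ^ 'n \<Rightarrow> real" assume \<phi>: "\<phi> \<in> test_functions"
      have "(\<integral>x. \<phi> x *\<^sub>R w x \<partial>lborel) = (LINT x|lebesgue. d x * of_real (\<phi> x))"
        by (rule integral_representative[OF dm loc_integrable_measurable[OF w(1)] w(2) test_functions_measurable[OF \<phi>], symmetric])
      also have "\<dots> = (LINT x|lebesgue. g x $ j * of_real (\<phi> x)) - (LINT x|lebesgue. ?b x * of_real (\<phi> x))"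
        unfolding d_def left_diff_distrib
        by (intro Bochner_Integration.integral_diff integrable_test_lebesgue[OF gm gs \<phi>] integrable_test_lebesgue[OF bm bs \<phi>])
      also have "\<dots> = - (LINT x|lebesgue. \<psi> x * of_real (pderiv_at j \<phi> x))"
        using g[unfolded is_magnetic_gradient_def, THEN conjunct2, rule_format, OF \<phi>, of j] by (simp only: diff_eq_eq)
      also have "(LINT x|lebesgue. \<psi> x * of_real (pderiv_at j \<phi> x)) = (\<integral>x. pderiv_at j \<phi> x *\<^sub>R f x \<partial>lborel)"
        by (rule integral_representative[OF \<psi>m loc_integrable_measurable[OF f(1)] f(2)
              test_functions_measurable[OF pderiv_test_function[OF \<phi>]]])
      finally show "(\<integral>x. \<phi> x *\<^sub>R w x \<partial>lborel) = - (\<integral>x. pderiv_at j \<phi> x *\<^sub>R f x \<partial>lborel)" .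
    qed
    with w show ?thesis unfolding d_def by (intro exI[of _ w] conjI)
  qed
  then have "\<exists>w. \<forall>j. loc_integrable (w j) \<and> weak_deriv j f (w j) \<and>
      (AE x in lebesgue. g x $ j - \<i> * of_real (A x $ j) * \<psi> x = w j x)"
    by (intro choice allI)
  then obtain w where w': "\<forall>j. loc_integrable (w j) \<and> weak_deriv j f (w j) \<and>
      (AE x in lebesgue. g x $ j - \<i> * of_real (A x $ j) * \<psi> x = w j x)" ..
  have w: "loc_integrable (w j)" "weak_deriv j f (w j)"
    "AE x in lebesgue. g x $ j - \<i> * of_real (A x $ j) * \<psi> x = w j x" for j
    by (rule conjunct1[OF spec[OF w']], rule conjunct1[OF conjunct2[OF spec[OF w']]], rule conjunct2[OF conjunct2[OF spec[OF w']]])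
  note [measurable] = loc_integrable_measurable[OF f(1)] loc_integrable_measurable[OF w(1)]
  define v where "v j x = Re (cnj (f x) / of_real (norm (f x)) * w j x)" for j x
  have sgn: "norm (cnj z / of_real (norm z)) \<le> 1" for z :: complex by (simp add: norm_divide)
  have v_le: "\<bar>Re (cnj z / of_real (norm z) * y)\<bar> \<le> norm y" for z y :: complex
  proof -
    have "\<bar>Re (cnj z / of_real (norm z) * y)\<bar> \<le> norm (cnj z / of_real (norm z)) * norm y"
      using abs_Re_le_cmod[of "cnj z / of_real (norm z) * y"] by (simp only: norm_mult)
    also have "\<dots> \<le> norm y" by (intro mult_left_le_one_le sgn) auto
    finally show ?thesis .
  qed
  show ?thesis
  proof
    show "loc_integrable (\<lambda>x. norm (f x))" by (rule loc_integrable_bound[OF f(1)]) auto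
    show "loc_integrable (v j)" for j
    proof (rule loc_integrable_bound[OF w(1)[of j]])
      show "v j \<in> borel_measurable borel" unfolding v_def by measurable
      show "norm (v j x) \<le> norm (w j x)" for x unfolding v_def real_norm_def by (rule v_le)
    qed
    show "weak_deriv j (\<lambda>x. norm (f x)) (v j)" for j
      unfolding v_def by (rule weak_deriv_norm[OF f(1) w(1,2)])
    show "AE x in lebesgue. norm (f x) = norm (\<psi> x)" using f(2) by eventually_elim simp
    have "AE x in lebesgue. \<forall>j. g x $ j - \<i> * of_real (A x $ j) * \<psi> x = w j x"
      using w(3) by (simp add: AE_all_countable)
    with f(2) show "AE x in lebesgue. (\<Sum>j\<in>UNIV. (v j x)\<^sup>2) \<le> (norm (g x))\<^sup>2"
    proof eventually_elim
      case (elim x)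
      have "v j x = Re (cnj (f x) / of_real (norm (f x)) * g x $ j)" for j
      proof -
        have "cnj (f x) / of_real (norm (f x)) * (\<i> * of_real (A x $ j) * f x) =
          \<i> * of_real (A x $ j) * (f x * cnj (f x) / of_real (norm (f x)))" by simp
        also have "f x * cnj (f x) / of_real (norm (f x)) = of_real ((norm (f x))\<^sup>2 / norm (f x))"
          by (simp only: complex_norm_square[symmetric] of_real_divide of_real_power)
        finally have "Re (cnj (f x) / of_real (norm (f x)) * (\<i> * of_real (A x $ j) * f x)) = 0" 
          by (simp del: of_real_divide of_real_power)
        moreover have "w j x = g x $ j - \<i> * of_real (A x $ j) * f x" using elim(2)[rule_format, of j] unfolding elim(1) by (rule sym)
        ultimately show ?thesis unfolding v_def by (simp only: right_diff_distrib minus_complex.simps)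
      qed
      then have "\<bar>v j x\<bar> \<le> norm (g x $ j)" for j by (simp only: v_le)
      then have "(\<Sum>j\<in>UNIV. (v j x)\<^sup>2) \<le> (\<Sum>j\<in>UNIV. (norm (g x $ j))\<^sup>2)"
        by (intro sum_mono) (simp add: abs_le_square_iff[symmetric])
      also have "\<dots> = (norm (g x))\<^sup>2"
        by (simp add: norm_vec_def L2_set_def sum_nonneg)
      finally show ?case .
    qed
  qed
qed

section \<open>The interpolated bound\<close>

text \<open>By the conventions \<open>inverse 0 = 0\<close> and \<open>0 powr a = 0\<close>,
  \<open>beta_star\<close> is 0 here, so the first branch applies.\<close>

lemma nu_interp_0: "\<beta> > 0 \<Longrightarrow> nu_interp d p \<Lambda> 0 \<beta> = 0"
  by (simp add: nu_interp_def beta_star_def)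

text \<open>The scalar core of the argument. M, P and K' stand for the squared 2-norm, squared
  p-norm and magnetic energy of \<open>\<psi>\<close>; K is the gradient energy of its modulus, and
  \<open>scaled\<close> is the inequality for that modulus dilated by l.\<close>

lemma nu_interp_le:
  fixes d p \<Lambda> C \<beta> K K' P M :: real
  assumes d: "d > 0" and p: "0 < p" "p < 2" and C: "C > 0" and \<Lambda>: "\<Lambda> > 0" and \<beta>: "\<beta> > 0" and M: "M \<ge> 0"
    and scaled: "\<And>l. l > 0 \<Longrightarrow> C * l powr (- d) * M \<le> l powr (2 - d) * K + l powr (- (2 * d / p)) * P"
    and K': "K \<le> K'" "\<Lambda> * M \<le> K'"
  shows "nu_interp d p \<Lambda> C \<beta> * M \<le> K' + \<beta> * P"
proof -
  define D where "D = 2 * p + d * (2 - p)"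
  have dp: "d * (2 - p) > 0" using d p by simp
  have D: "D > 0" using dp p by (simp add: D_def)
  have opt: "C * \<mu> powr (2 * p / D) * M \<le> K + \<mu> * P" if \<mu>: "\<mu> > 0" for \<mu>
  proof -
    \<comment> \<open>Normalizing the coefficient of K to 1 leaves l^(d - 2 - 2d/p) = l^(-D/p) in
      front of P; this choice of l makes it \<open>\<mu>\<close>, and l^(-2) becomes the power of
      \<open>\<mu>\<close> in front of M.\<close>
    define l where "l = \<mu> powr (- (p / D))"
    have l: "l > 0" using \<mu> by (simp add: l_def)
    have e1: "l powr (d - 2) * l powr (- d) = \<mu> powr (2 * p / D)"
    proof -
      have "l powr (d - 2) * l powr (- d) = l powr (- 2)" by (simp add: powr_add[symmetric])
      also have "\<dots> = \<mu> powr (- (p / D) * - 2)" by (simp only: l_def powr_powr)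
      finally show ?thesis by (simp add: mult.commute)
    qed
    have e2: "l powr (d - 2) * l powr (2 - d) = 1"
      using l by (simp add: powr_add[symmetric])
    have e3: "l powr (d - 2) * l powr (- (2 * d / p)) = \<mu>"
    proof -
      have "l powr (d - 2) * l powr (- (2 * d / p)) = l powr (d - 2 - 2 * d / p)"
        by (simp add: powr_add[symmetric])
      also have "\<dots> = \<mu> powr (- (p / D) * (d - 2 - 2 * d / p))"
        by (simp add: l_def powr_powr)
      also have "- (p / D) * (d - 2 - 2 * d / p) = 1"
        using p D by (simp add: field_simps) (simp add: D_def algebra_simps)
      finally show ?thesis using \<mu> by simp
    qed
    have "l powr (d - 2) * (C * l powr (- d) * M) \<le>
      l powr (d - 2) * (l powr (2 - d) * K + l powr (- (2 * d / p)) * P)"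
      by (rule mult_left_mono[OF scaled[OF l]]) simp
    then have "C * (l powr (d - 2) * l powr (- d)) * M \<le>
      (l powr (d - 2) * l powr (2 - d)) * K + (l powr (d - 2) * l powr (- (2 * d / p))) * P"
      by (simp add: algebra_simps)
    then show ?thesis unfolding e1 e2 e3 by simp
  qed
  \<comment> \<open>Taking \<open>\<mu> = \<beta> / t\<close> makes the weight t cancel in the
    p-norm term, so the same right-hand side serves for every t.\<close>
  have split: "((1 - t) * \<Lambda> + t * (C * (\<beta> / t) powr (2 * p / D))) * M \<le> K' + \<beta> * P" if t: "0 < t" "t \<le> 1" for t
  proof -
    have "(1 - t) * (\<Lambda> * M) \<le> (1 - t) * K'" using t K' by (intro mult_left_mono) auto
    moreover have "t * (C * (\<beta> / t) powr (2 * p / D) * M) \<le> t * (K + \<beta> / t * P)"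
      using t \<beta> by (intro mult_left_mono opt) auto
    moreover have "t * (K + \<beta> / t * P) \<le> t * K' + \<beta> * P"
      using t K' by (simp add: algebra_simps)
    ultimately show ?thesis by (simp add: algebra_simps)
  qed
  \<comment> \<open>X is \<open>beta_star\<close> raised to the power 2p/D, so C X is the height of
    the interpolation curve at \<open>beta_star\<close>.\<close>
  define X where "X = D / (d * (2 - p)) * \<Lambda> * inverse C"
  have X: "X > 0" using D dp \<Lambda> C by (simp add: X_def)
  define bs where "bs = beta_star d p \<Lambda> C"
  have bs_eq: "bs = X powr (D / (2 * p))" by (simp add: bs_def beta_star_def X_def D_def)
  have bs: "bs > 0" using X by (simp add: bs_eq)
  show ?thesis
  proof (cases "\<beta> \<ge> bs")
    case True
    then show ?thesis using split[of 1] by (simp add: nu_interp_def bs_def[symmetric] D_def[symmetric])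
  next
    case False
    \<comment> \<open>The linear branch is the chord from height \<Lambda> at 0 to height C X at
      \<open>beta_star\<close>; t is the relative position of \<open>\<beta>\<close> on it.\<close>
    define t where "t = \<beta> / bs"
    have t: "0 < t" "t \<le> 1" using False bs \<beta> by (simp_all add: t_def)
    have "\<beta> / t = bs" using \<beta> bs by (simp add: t_def)
    moreover have "bs powr (2 * p / D) = X" using X D p by (simp add: bs_eq powr_powr)
    moreover have "C * X = \<Lambda> + \<Lambda> * (2 * p / (d * (2 - p)))"
    proof -
      have "C * X = \<Lambda> * (D / (d * (2 - p)))" using C by (simp add: X_def)
      also have "D / (d * (2 - p)) = 2 * p / (d * (2 - p)) + 1" using d p by (simp add: D_def add_divide_distrib)
      finally show ?thesis by (simp add: algebra_simps)
    qed
    ultimately have "(1 - t) * \<Lambda> + t * (C * (\<beta> / t) powr (2 * p / D)) = \<Lambda> + t * \<Lambda> * (2 * p / (d * (2 - p)))"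
      by (simp add: algebra_simps)
    \<comment> \<open>What remains is to expand 1/\<open>bs\<close>: the power of \<Lambda> in it
      combines with the extra factor \<Lambda>, since 1 - D/(2p) = d(p - 2)/(2p).\<close>
    also have "t * \<Lambda> = \<beta> * (\<Lambda> powr (d * (p - 2) / (2 * p)) * (d * (2 - p) / D) powr (D / (2 * p)) * C powr (D / (2 * p)))"
    proof -
      let ?r = "D / (2 * p)"
      have "inverse bs = inverse X powr ?r" using X by (simp add: bs_eq inverse_powr)
      also have "inverse X = d * (2 - p) / D * inverse \<Lambda> * C" by (simp add: X_def divide_inverse mult_ac)
      also have "(d * (2 - p) / D * inverse \<Lambda> * C) powr ?r =
          (d * (2 - p) / D) powr ?r * inverse \<Lambda> powr ?r * C powr ?r"
        by (simp only: powr_mult)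
      also have "inverse \<Lambda> powr ?r = \<Lambda> powr (- ?r)" using \<Lambda> by (simp add: inverse_powr powr_minus)
      finally have inv: "inverse bs = (d * (2 - p) / D) powr ?r * \<Lambda> powr (- ?r) * C powr ?r" .
      have "\<Lambda> * \<Lambda> powr (- ?r) = \<Lambda> powr (1 + - ?r)" using \<Lambda> by (simp only: powr_add powr_one)
      also have "1 + - ?r = d * (p - 2) / (2 * p)" using p by (simp add: D_def field_simps)
      finally have "\<Lambda> powr (d * (p - 2) / (2 * p)) = \<Lambda> * \<Lambda> powr (- ?r)" ..
      then show ?thesis unfolding t_def divide_inverse[of \<beta> bs] inv by (simp only: mult_ac)
    qed
    finally have "nu_interp d p \<Lambda> C \<beta> = (1 - t) * \<Lambda> + t * (C * (\<beta> / t) powr (2 * p / D))"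
      using False by (simp add: nu_interp_def bs_def[symmetric] D_def[symmetric])
    then show ?thesis using split[OF t] by simp
  qed
qed

text \<open>\<open>real_of_ereal\<close> sends infinite values to 0, so a nonzero value certifies
  that the infimum is finite and equal to \<open>C_opt\<close>. The alternative 0 is harmless by
  \<open>nu_interp_0\<close>.\<close>

lemma C_opt_INF:
  fixes p :: real
  obtains "C_opt TYPE('n::finite) p = 0"
  | "C_opt TYPE('n) p > 0" "\<And>u :: real ^ 'n \<Rightarrow> complex. u \<in> H1 \<Longrightarrow> \<not> (AE x in lebesgue. u x = 0) \<Longrightarrow>
      ereal (C_opt TYPE('n) p) \<le> ((Lq_norm 2 (grad u))\<^sup>2 + (Lq_norm p u)\<^sup>2) / (Lq_norm 2 u)\<^sup>2"
proof -
  define Q where "Q u = ((Lq_norm 2 (grad u))\<^sup>2 + (Lq_norm p u)\<^sup>2) / (Lq_norm 2 u)\<^sup>2" for u :: "real ^ 'n \<Rightarrow> complex"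
  define S where "S = {u \<in> H1 :: (real ^ 'n \<Rightarrow> complex) set. \<not> (AE x in lebesgue. u x = 0)}"
  have C: "C_opt TYPE('n) p = real_of_ereal (INF u\<in>S. Q u)" by (simp add: C_opt_def Q_def S_def)
  have Lq0: "Lq_norm q f \<ge> 0" for q and f :: "real ^ 'n \<Rightarrow> 'b::real_normed_vector"
    by (simp add: Lq_norm_def)
  have "0 \<le> Q u" for u
    unfolding Q_def divide_ereal_def
    by (intro ereal_0_le_mult add_nonneg_nonneg) (auto simp: power2_eq_square Lq0 ereal_inverse_nonneg_iff)
  then have INF0: "0 \<le> (INF u\<in>S. Q u)" by (intro INF_greatest)
  then have C0: "C_opt TYPE('n) p \<ge> 0" unfolding C by (simp add: real_of_ereal_pos)
  show ?thesis
  proof (cases "C_opt TYPE('n) p = 0")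
    case False
    then have pos: "C_opt TYPE('n) p > 0" using C0 by simp
    have "ereal (C_opt TYPE('n) p) = (INF u\<in>S. Q u)"
      unfolding C using False INF0 by (cases "INF u\<in>S. Q u") (auto simp: C)
    then have "ereal (C_opt TYPE('n) p) \<le> Q u" if "u \<in> S" for u using INF_lower[OF that, of Q] by simp
    then show ?thesis using pos that(2) by (auto simp: S_def Q_def)
  qed (use that(1) in simp)
qed

section \<open>Dilation of the interpolation inequality\<close>

text \<open>The dilated pair is tested against \<open>\<phi>\<close> by testing the original pair
  against \<open>\<phi>\<close> dilated by 1/l; the Jacobian l^d cancels, and the chain rule factor
  1/l remains.\<close>

lemma weak_deriv_dilate:
  fixes u v :: "real ^ 'n \<Rightarrow> real"
  assumes uv: "weak_deriv j u v" and l: "l > 0"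
    and [measurable]: "u \<in> borel_measurable borel" "v \<in> borel_measurable borel"
  shows "weak_deriv j (\<lambda>x. u (l *\<^sub>R x)) (\<lambda>x. l * v (l *\<^sub>R x))"
  unfolding weak_deriv_def
proof
  fix \<phi> :: "real ^ 'n \<Rightarrow> real" assume \<phi>: "\<phi> \<in> test_functions"
  define \<eta> where "\<eta> y = \<phi> ((1 / l) *\<^sub>R y + 0)" for y
  have \<eta>: "\<eta> \<in> test_functions" unfolding \<eta>_def by (rule test_functions_affine[OF \<phi>]) (use l in simp)
  have d\<eta>: "pderiv_at j \<eta> y = (1 / l) * pderiv_at j \<phi> ((1 / l) *\<^sub>R y)" for y
    using pderiv_at_affine[OF test_functions_differentiable[OF \<phi>], of j "1 / l" 0 y] by (simp add: \<eta>_def[abs_def])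
  note [measurable] = test_functions_measurable[OF \<eta>] test_functions_measurable[OF pderiv_test_function[OF \<eta>]]
  let ?c = "l ^ DIM(real ^ 'n)"
  have sc: "(\<integral>x. f x \<partial>lborel) = ?c * (\<integral>x. f (l *\<^sub>R x) \<partial>lborel)"
    if "f \<in> borel_measurable borel" for f :: "real ^ 'n \<Rightarrow> real"
    using integral_lborel_affine[OF that, of l 0] l by simp
  have "(\<integral>x. \<eta> x *\<^sub>R v x \<partial>lborel) = ?c * (\<integral>x. \<phi> x * v (l *\<^sub>R x) \<partial>lborel)"
  proof -
    have "(\<integral>x. \<eta> x *\<^sub>R v x \<partial>lborel) = ?c * (\<integral>x. \<eta> (l *\<^sub>R x) *\<^sub>R v (l *\<^sub>R x) \<partial>lborel)" by (rule sc) measurable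
    then show ?thesis using l by (simp add: \<eta>_def)
  qed
  moreover have "(\<integral>x. pderiv_at j \<eta> x *\<^sub>R u x \<partial>lborel) = ?c * ((1 / l) * (\<integral>x. pderiv_at j \<phi> x * u (l *\<^sub>R x) \<partial>lborel))"
  proof -
    have "(\<integral>x. pderiv_at j \<eta> x *\<^sub>R u x \<partial>lborel) = ?c * (\<integral>x. pderiv_at j \<eta> (l *\<^sub>R x) *\<^sub>R u (l *\<^sub>R x) \<partial>lborel)"
      by (rule sc) measurable
    then show ?thesis using l by (simp add: d\<eta>)
  qed
  moreover have "(\<integral>x. \<eta> x *\<^sub>R v x \<partial>lborel) = - (\<integral>x. pderiv_at j \<eta> x *\<^sub>R u x \<partial>lborel)"
    using uv \<eta> by (simp add: weak_deriv_def)
  ultimately have "?c * (\<integral>x. \<phi> x * v (l *\<^sub>R x) \<partial>lborel) = ?c * (- ((1 / l) * (\<integral>x. pderiv_at j \<phi> x * u (l *\<^sub>R x) \<partial>lborel)))"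
    by simp
  then have "(\<integral>x. \<phi> x * v (l *\<^sub>R x) \<partial>lborel) = - ((1 / l) * (\<integral>x. pderiv_at j \<phi> x * u (l *\<^sub>R x) \<partial>lborel))"
    using l by (subst (asm) mult_left_cancel) auto
  then have "l * (\<integral>x. \<phi> x * v (l *\<^sub>R x) \<partial>lborel) = - (\<integral>x. pderiv_at j \<phi> x * u (l *\<^sub>R x) \<partial>lborel)"
    using l by simp
  then show "(\<integral>x. \<phi> x *\<^sub>R (l * v (l *\<^sub>R x)) \<partial>lborel) = - (\<integral>x. pderiv_at j \<phi> x *\<^sub>R u (l *\<^sub>R x) \<partial>lborel)"
    by (simp add: mult.left_commute)
qed

lemma lebesgue_integral_complex_of_real_mult:
  fixes a b :: "real ^ 'n \<Rightarrow> real"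
  assumes [measurable]: "a \<in> borel_measurable borel" "b \<in> borel_measurable borel"
  shows "(LINT x|lebesgue. complex_of_real (a x) * of_real (b x)) = of_real (\<integral>x. b x *\<^sub>R a x \<partial>lborel)"
proof -
  have "(LINT x|lebesgue. complex_of_real (a x) * of_real (b x)) = (LINT x|lebesgue. of_real (b x *\<^sub>R a x))"
    by (simp add: mult.commute)
  also have "\<dots> = of_real (LINT x|lebesgue. b x *\<^sub>R a x)" by (rule integral_complex_of_real)
  also have "(LINT x|lebesgue. b x *\<^sub>R a x) = (\<integral>x. b x *\<^sub>R a x \<partial>lborel)"
    by (rule integral_lebesgue_eq_lborel) measurable
  finally show ?thesis .
qed

lemma is_gradient_of_real:
  fixes u :: "real ^ 'n \<Rightarrow> real"
  assumes u: "u \<in> borel_measurable borel" and v: "\<And>j. v j \<in> borel_measurable borel"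
    and uv: "\<And>j. weak_deriv j u (v j)"
    and L: "(\<lambda>x. (\<chi> j. complex_of_real (v j x))) \<in> Lq_loc 1"
  shows "is_magnetic_gradient (\<lambda>_. 0) (\<lambda>x. of_real (u x)) (\<lambda>x. (\<chi> j. of_real (v j x)))"
  unfolding is_magnetic_gradient_def
proof (intro conjI ballI allI L)
  fix \<phi> :: "real ^ 'n \<Rightarrow> real" and j assume \<phi>: "\<phi> \<in> test_functions"
  note [measurable] = u v test_functions_measurable[OF \<phi>] test_functions_measurable[OF pderiv_test_function[OF \<phi>]]
  have "(\<integral>x. \<phi> x *\<^sub>R v j x \<partial>lborel) = - (\<integral>x. pderiv_at j \<phi> x *\<^sub>R u x \<partial>lborel)"
    using uv \<phi> by (simp add: weak_deriv_def)
  then show "(LINT x|lebesgue. (\<chi> j. complex_of_real (v j x)) $ j * of_real (\<phi> x)) =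
     - (LINT x|lebesgue. of_real (u x) * of_real (pderiv_at j \<phi> x)) +
     (LINT x|lebesgue. \<i> * of_real ((0 :: real ^ 'n) $ j) * of_real (u x) * of_real (\<phi> x))"
    by (simp add: lebesgue_integral_complex_of_real_mult del: of_real_mult)
qed

text \<open>The vector is a finite sum of continuous images of its components under
  \<open>axis j\<close>.\<close>

lemma vec_lambda_measurable:
  fixes f :: "'n::finite \<Rightarrow> 'a \<Rightarrow> complex"
  assumes f: "\<And>j. f j \<in> borel_measurable M"
  shows "(\<lambda>x. (\<chi> j. f j x) :: complex ^ 'n) \<in> borel_measurable M"
proof -
  have "axis j \<in> borel_measurable (borel :: complex measure)" for j :: 'n
    unfolding axis_def[abs_def]
    by (intro borel_measurable_continuous_onI continuous_on_vec_lambda)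
      (rename_tac i, case_tac "i = j", simp_all)
  then have "(\<lambda>x. \<Sum>j\<in>UNIV. axis j (f j x) :: complex ^ 'n) \<in> borel_measurable M"
    by (intro borel_measurable_sum measurable_compose[OF f])
  moreover have "(\<Sum>j\<in>UNIV. axis j (f j x)) = (\<chi> j. f j x)" for x
    by (simp add: vec_eq_iff axis_def if_distrib sum.delta cong: if_cong)
  ultimately show ?thesis by simp
qed

lemma norm_vec_square: "(norm (x :: complex ^ 'n))\<^sup>2 = (\<Sum>j\<in>UNIV. (norm (x $ j))\<^sup>2)"
  by (simp add: norm_vec_def L2_set_def sum_nonneg)

lemma integrable_lebesgue_iff_lborel:
  fixes f :: "'a::euclidean_space \<Rightarrow> 'b::{banach, second_countable_topology}"
  shows "f \<in> borel_measurable borel \<Longrightarrow> integrable lebesgue f \<longleftrightarrow> integrable lborel f"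
  by (simp add: integrable_completion)

text \<open>The competitor x -> u (l x) has mass scaled by l^(-d), gradient energy by l^(2 - d), and
  squared p-norm by (l^(-d))^(2/p). Positive mass makes it a nonzero competitor and allows clearing
  the denominator.\<close>

lemma scaled_interpolation:
  fixes u :: "real ^ 'n \<Rightarrow> real" and v :: "'n \<Rightarrow> real ^ 'n \<Rightarrow> real"
  assumes C: "\<And>f :: real ^ 'n \<Rightarrow> complex. f \<in> H1 \<Longrightarrow> \<not> (AE x in lebesgue. f x = 0) \<Longrightarrow>
      ereal C \<le> ((Lq_norm 2 (grad f))\<^sup>2 + (Lq_norm p f)\<^sup>2) / (Lq_norm 2 f)\<^sup>2"
    and p: "p > 0" and l: "l > 0"
    and u[measurable]: "u \<in> borel_measurable borel" and v[measurable]: "\<And>j. v j \<in> borel_measurable borel"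
    and uv: "\<And>j. weak_deriv j u (v j)"
    and int2: "integrable lborel (\<lambda>x. (u x)\<^sup>2)" and intp: "integrable lborel (\<lambda>x. \<bar>u x\<bar> powr p)"
    and intv: "integrable lborel (\<lambda>x. \<Sum>j\<in>UNIV. (v j x)\<^sup>2)"
    and pos: "(\<integral>x. (u x)\<^sup>2 \<partial>lborel) > 0"
  shows "C * l powr (- real CARD('n)) * (\<integral>x. (u x)\<^sup>2 \<partial>lborel) \<le>
    l powr (2 - real CARD('n)) * (\<integral>x. (\<Sum>j\<in>UNIV. (v j x)\<^sup>2) \<partial>lborel) +
    l powr (- (2 * real CARD('n) / p)) * (\<integral>x. \<bar>u x\<bar> powr p \<partial>lborel) powr (2 / p)"
proof -
  define c where "c = l powr (- real CARD('n))"
  have c: "c > 0" using l by (simp add: c_def)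
  have dil: "(\<integral>x. f (l *\<^sub>R x) \<partial>lborel) = c * (\<integral>x. f x \<partial>lborel)"
    if "f \<in> borel_measurable borel" for f :: "real ^ 'n \<Rightarrow> real"
    using integral_lborel_affine[OF that, of l 0] l by (simp add: c_def powr_minus powr_realpow)
  have dili: "integrable lborel (\<lambda>x. f (l *\<^sub>R x))" if "integrable lborel f" for f :: "real ^ 'n \<Rightarrow> real"
    using integrable_lborel_affine[OF that, of l 0] l by simp
  define U where "U x = complex_of_real (u (l *\<^sub>R x))" for x
  define G where "G x = ((\<chi> j. complex_of_real (l * v j (l *\<^sub>R x))) :: complex ^ 'n)" for x
  have Um: "U \<in> borel_measurable borel" unfolding U_def by measurable
  have Gm: "G \<in> borel_measurable borel" unfolding G_def by (intro vec_lambda_measurable) measurable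
  have Gn: "(norm (G x))\<^sup>2 = l\<^sup>2 * (\<Sum>j\<in>UNIV. (v j (l *\<^sub>R x))\<^sup>2)" for x
    by (simp add: norm_vec_square G_def norm_mult power_mult_distrib sum_distrib_left del: of_real_mult)
  have iG: "integrable lborel (\<lambda>x. (norm (G x))\<^sup>2)"
    unfolding Gn by (intro integrable_mult_right dili[OF intv])
  have iU: "integrable lborel (\<lambda>x. (norm (U x))\<^sup>2)" using dili[OF int2] by (simp add: U_def)
  have iUp: "integrable lborel (\<lambda>x. norm (U x) powr p)" using dili[OF intp] by (simp add: U_def)
  have [measurable]: "U \<in> borel_measurable borel" "G \<in> borel_measurable borel" by fact+
  have U2: "U \<in> Lq_space 2" and G2: "G \<in> Lq_space 2"
    using iU iG by (simp_all add: Lq_space_2_iff integrable_lebesgue_iff_lborel borel_measurable_lebesgueI)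
  have Up: "U \<in> Lq_space p"
    using iUp by (simp add: Lq_space_def integrable_lebesgue_iff_lborel borel_measurable_lebesgueI)
  have grad: "is_magnetic_gradient (\<lambda>_. 0) U G"
    unfolding U_def G_def
  proof (rule is_gradient_of_real)
    show "weak_deriv j (\<lambda>x. u (l *\<^sub>R x)) (\<lambda>x. l * v j (l *\<^sub>R x))" for j
      by (rule weak_deriv_dilate[OF uv l u v])
    show "(\<lambda>x. \<chi> j. complex_of_real (l * v j (l *\<^sub>R x))) \<in> Lq_loc 1"
      using Lq_space_2_imp_Lq_loc_1[OF G2] by (simp add: G_def[abs_def])
  qed measurable
  note H = H1_magI[OF U2 grad G2]
  have vM: "(LINT x|lebesgue. (norm (U x))\<^sup>2) = c * (\<integral>x. (u x)\<^sup>2 \<partial>lborel)"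
    by (subst integral_lebesgue_eq_lborel) (simp_all add: U_def dil[of "\<lambda>x. (u x)\<^sup>2"])
  have vG: "(LINT x|lebesgue. (norm (G x))\<^sup>2) = l\<^sup>2 * (c * (\<integral>x. (\<Sum>j\<in>UNIV. (v j x)\<^sup>2) \<partial>lborel))"
    by (subst integral_lebesgue_eq_lborel) (simp_all add: Gn dil[of "\<lambda>x. \<Sum>j\<in>UNIV. (v j x)\<^sup>2"])
  have vP: "(LINT x|lebesgue. norm (U x) powr p) = c * (\<integral>x. \<bar>u x\<bar> powr p \<partial>lborel)"
    by (subst integral_lebesgue_eq_lborel) (simp_all add: U_def dil[of "\<lambda>x. \<bar>u x\<bar> powr p"])
  let ?M = "\<integral>x. (u x)\<^sup>2 \<partial>lborel" and ?K = "\<integral>x. (\<Sum>j\<in>UNIV. (v j x)\<^sup>2) \<partial>lborel"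
    and ?P = "\<integral>x. \<bar>u x\<bar> powr p \<partial>lborel"
  have "\<not> (AE x in lebesgue. U x = 0)"
  proof
    assume "AE x in lebesgue. U x = 0"
    then have "(LINT x|lebesgue. (norm (U x))\<^sup>2) = 0"
      by (intro integral_eq_zero_AE) (auto elim: eventually_mono)
    with vM pos c show False by simp
  qed
  from C[OF H(1) this]
  have "ereal C \<le> (ereal (l\<^sup>2 * (c * ?K)) + ereal ((c * ?P) powr (2 / p))) / ereal (c * ?M)"
    unfolding H(2) Lq_norm_2_square[OF G2] Lq_norm_2_square[OF U2] Lq_norm_square[OF Up] vM vG vP .
  then have "C \<le> (l\<^sup>2 * (c * ?K) + (c * ?P) powr (2 / p)) / (c * ?M)"
    using c pos by (simp add: ereal_divide)
  then have "C * (c * ?M) \<le> l\<^sup>2 * (c * ?K) + (c * ?P) powr (2 / p)"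
    using c pos by (simp add: pos_le_divide_eq)
  moreover have "(c * ?P) powr (2 / p) = l powr (- (2 * real CARD('n) / p)) * ?P powr (2 / p)"
    by (simp add: powr_mult c_def powr_powr mult.commute)
  moreover have "l\<^sup>2 * c = l powr (2 - real CARD('n))"
  proof -
    have "l\<^sup>2 = l powr 2" using l by (simp add: powr_numeral)
    then show ?thesis by (simp add: c_def powr_add[symmetric])
  qed
  ultimately show ?thesis by (simp add: c_def mult.assoc[symmetric])
qed

section \<open>The energy inequality with the interpolated constant\<close>

lemma H1_mag_energy_bound:
  fixes A :: "real ^ 'n \<Rightarrow> real ^ 'n"
  assumes A: "A \<in> Lq_loc 2" and \<Lambda>: "\<Lambda> > 0"
    and spec: "\<forall>\<psi>\<in>H1_mag A. (Lq_norm 2 (mgrad A \<psi>))\<^sup>2 \<ge> ereal \<Lambda> * (Lq_norm 2 \<psi>)\<^sup>2"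
    and p: "1 < p" "p < 2" and \<beta>: "\<beta> > 0" and \<psi>: "\<psi> \<in> H1_mag A"
  shows "ereal (nu_interp (real CARD('n)) p \<Lambda> (C_opt TYPE('n) p) \<beta>) * (Lq_norm 2 \<psi>)\<^sup>2 \<le>
    (Lq_norm 2 (mgrad A \<psi>))\<^sup>2 + ereal \<beta> * (Lq_norm p \<psi>)\<^sup>2"
proof (cases "\<psi> \<in> Lq_space p")
  case False
  \<comment> \<open>Outside L^p the right-hand side is infinite, because \<open>\<beta>\<close> is
    positive.\<close>
  then have "(Lq_norm p \<psi>)\<^sup>2 = \<infinity>" by (simp add: Lq_norm_def power2_eq_square)
  then show ?thesis using \<beta> Lq_norm_2_square[OF H1_magD(3)[OF \<psi>]] by simp
next
  case True
  note \<psi>2 = H1_magD(1)[OF \<psi>] and g = H1_magD(2)[OF \<psi>] and g2 = H1_magD(3)[OF \<psi>]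
  define M where "M = (LINT x|lebesgue. (norm (\<psi> x))\<^sup>2)"
  define K' where "K' = (LINT x|lebesgue. (norm (mgrad A \<psi> x))\<^sup>2)"
  define P where "P = (LINT x|lebesgue. norm (\<psi> x) powr p) powr (2 / p)"
  have M0: "M \<ge> 0" and K'0: "K' \<ge> 0" and P0: "P \<ge> 0"
    by (simp_all add: M_def K'_def P_def integral_nonneg_AE)
  have "\<Lambda> * M \<le> K'"
    using spec[rule_format, OF \<psi>] by (simp add: Lq_norm_2_square[OF \<psi>2] Lq_norm_2_square[OF g2] M_def K'_def)
  have "nu_interp (real CARD('n)) p \<Lambda> (C_opt TYPE('n) p) \<beta> * M \<le> K' + \<beta> * P"
  \<comment> \<open>In both degenerate cases the left-hand side is 0. Otherwise the modulus has
    positive mass and the infimum defining \<open>C_opt\<close> is finite.\<close>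
  proof (cases "C_opt TYPE('n) p = 0 \<or> M = 0")
    case True
    then show ?thesis using K'0 P0 \<beta> by (auto simp: nu_interp_0)
  next
    case nz: False
    then have Mpos: "M > 0" using M0 by simp
    obtain u :: "real ^ 'n \<Rightarrow> real" and v :: "'n \<Rightarrow> real ^ 'n \<Rightarrow> real"
      where u: "loc_integrable u" and v: "\<And>j. loc_integrable (v j)" and uv: "\<And>j. weak_deriv j u (v j)"
        and u_eq: "AE x in lebesgue. u x = norm (\<psi> x)"
        and v_le: "AE x in lebesgue. (\<Sum>j\<in>UNIV. (v j x)\<^sup>2) \<le> (norm (mgrad A \<psi> x))\<^sup>2"
      using diamagnetic[OF A \<psi>2 g] by blast
    note um[measurable] = loc_integrable_measurable[OF u] and vm[measurable] = loc_integrable_measurable[OF v]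
    have [measurable]: "\<psi> \<in> borel_measurable lebesgue" using \<psi>2 by (simp add: Lq_space_def)
    \<comment> \<open>Carries Lebesgue integrals of the modulus of \<open>\<psi>\<close> over to its
      Borel representative u.\<close>
    have transfer: "integrable lborel f" "(\<integral>x. f x \<partial>lborel) = integral\<^sup>L lebesgue f'"
      if f: "f \<in> borel_measurable borel" and f': "integrable lebesgue f'" and eq: "AE x in lebesgue. f' x = f x"
      for f f' :: "real ^ 'n \<Rightarrow> real"
    proof -
      have fl: "f \<in> borel_measurable lebesgue" by (rule borel_measurable_lebesgueI[OF f])
      show "integrable lborel f"
        using integrable_cong_AE_imp[OF f' fl eq] by (simp add: integrable_lebesgue_iff_lborel[OF f])
      show "(\<integral>x. f x \<partial>lborel) = integral\<^sup>L lebesgue f'"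
        using integral_cong_AE[OF borel_measurable_integrable[OF f'] fl eq] integral_lebesgue_eq_lborel[OF f] by simp
    qed
    have e2: "AE x in lebesgue. (norm (\<psi> x))\<^sup>2 = (u x)\<^sup>2" using u_eq by eventually_elim simp
    have ep: "AE x in lebesgue. norm (\<psi> x) powr p = \<bar>u x\<bar> powr p" using u_eq by eventually_elim simp
    have i2: "integrable lebesgue (\<lambda>x. (norm (\<psi> x))\<^sup>2)" using \<psi>2 by (simp add: Lq_space_2_iff)
    have ip: "integrable lebesgue (\<lambda>x. norm (\<psi> x) powr p)" using True by (simp add: Lq_space_def)
    have ig: "integrable lebesgue (\<lambda>x. (norm (mgrad A \<psi> x))\<^sup>2)" using g2 by (simp add: Lq_space_2_iff)
    have m2: "(\<lambda>x. (u x)\<^sup>2) \<in> borel_measurable borel" and mp: "(\<lambda>x. \<bar>u x\<bar> powr p) \<in> borel_measurable borel"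
      and mv: "(\<lambda>x. \<Sum>j\<in>UNIV. (v j x)\<^sup>2) \<in> borel_measurable borel" by measurable
    note t2 = transfer[OF m2 i2 e2] and tp = transfer[OF mp ip ep]
    \<comment> \<open>Square integrability of the derivatives of the modulus is inherited from the
      magnetic gradient through the pointwise diamagnetic bound.\<close>
    have iv: "integrable lebesgue (\<lambda>x. \<Sum>j\<in>UNIV. (v j x)\<^sup>2)"
      by (rule Bochner_Integration.integrable_bound[OF ig borel_measurable_lebesgueI[OF mv]])
        (use v_le in eventually_elim, simp add: sum_nonneg)
    then have iv': "integrable lborel (\<lambda>x. \<Sum>j\<in>UNIV. (v j x)\<^sup>2)" by (simp only: integrable_lebesgue_iff_lborel[OF mv])
    have KK': "(\<integral>x. (\<Sum>j\<in>UNIV. (v j x)\<^sup>2) \<partial>lborel) \<le> K'"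
      unfolding K'_def integral_lebesgue_eq_lborel[OF mv, symmetric] by (rule integral_mono_AE[OF iv ig v_le])
    show ?thesis
    proof (rule C_opt_INF[where 'n='n and p=p])
      assume "C_opt TYPE('n) p = 0"
      with nz show ?thesis by simp
    next
      assume Cpos: "C_opt TYPE('n) p > 0" and C: "\<And>f :: real ^ 'n \<Rightarrow> complex. f \<in> H1 \<Longrightarrow> \<not> (AE x in lebesgue. f x = 0) \<Longrightarrow>
        ereal (C_opt TYPE('n) p) \<le> ((Lq_norm 2 (grad f))\<^sup>2 + (Lq_norm p f)\<^sup>2) / (Lq_norm 2 f)\<^sup>2"
      have pos: "(\<integral>x. (u x)\<^sup>2 \<partial>lborel) > 0" using Mpos t2(2) by (simp add: M_def)
      have "C_opt TYPE('n) p * l powr (- real CARD('n)) * M \<le>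
        l powr (2 - real CARD('n)) * (\<integral>x. (\<Sum>j\<in>UNIV. (v j x)\<^sup>2) \<partial>lborel) +
        l powr (- (2 * real CARD('n) / p)) * P" if l: "l > 0" for l
        using scaled_interpolation[OF C _ l um vm uv t2(1) tp(1) iv' pos] p
        by (simp add: t2(2) tp(2) M_def P_def)
      from nu_interp_le[OF _ _ p(2) Cpos \<Lambda> \<beta> M0 this KK' \<open>\<Lambda> * M \<le> K'\<close>] p
      show ?thesis by simp
    qed
  qed
  then show ?thesis
    by (simp add: Lq_norm_2_square[OF \<psi>2] Lq_norm_2_square[OF g2] Lq_norm_square[OF True] M_def K'_def P_def)
qed

section \<open>The optimal constant\<close>

text \<open>By translation invariance every difference quotient of \<open>\<phi>\<close> integrates
  to 0, and the integral of the derivative is the limit of these integrals.\<close>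

lemma integral_pderiv_test_function:
  fixes \<phi> :: "real ^ 'n \<Rightarrow> real"
  assumes \<phi>: "\<phi> \<in> test_functions"
  shows "(\<integral>x. pderiv_at j \<phi> x \<partial>lborel) = 0"
proof -
  let ?e = "axis j 1 :: real ^ 'n"
  have one: "loc_integrable (\<lambda>_ :: real ^ 'n. 1 :: real)" by (rule continuous_loc_integrable) simp
  have int: "integrable lborel \<phi>" using integrable_test_scaleR[OF one \<phi>] by simp
  note [measurable] = test_functions_measurable[OF \<phi>]
  have eq: "(\<integral>x. ((\<phi> (x + h *\<^sub>R ?e) - \<phi> x) / h) *\<^sub>R (1::real) \<partial>lborel) = 0" for h
    using int integrable_lborel_translate[OF int, of "h *\<^sub>R ?e"] integral_lborel_translate[of \<phi> "h *\<^sub>R ?e"] by simp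
  then show ?thesis
    using test_function_difference_quotient[OF one \<phi>, of j] unfolding eq by (simp add: tendsto_const_iff)
qed

lemma test_functions_mult:
  fixes \<phi> \<eta> :: "real ^ 'n \<Rightarrow> real"
  assumes "\<phi> \<in> test_functions" "\<eta> \<in> test_functions"
  shows "(\<lambda>x. \<phi> x * \<eta> x) \<in> test_functions"
proof -
  obtain K where K: "compact K" "\<And>x. x \<notin> K \<Longrightarrow> \<phi> x = 0" using test_function_support[OF assms(1)] by metis
  show ?thesis
  proof (rule test_functionsI)
    show "C_order k (\<lambda>x. \<phi> x * \<eta> x)" for k
      using assms by (intro C_order_mult) (simp_all add: test_functions_def)
    show "x \<in> K" if "\<phi> x * \<eta> x \<noteq> 0" for x using that K(2) by force
    show "bounded K" by (rule compact_imp_bounded[OF K(1)])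
  qed
qed

text \<open>Integration by parts: the derivative of the product \<open>\<phi> \<eta>\<close> has
  integral zero.\<close>

lemma weak_deriv_test_function:
  fixes \<eta> :: "real ^ 'n \<Rightarrow> real"
  assumes \<eta>: "\<eta> \<in> test_functions"
  shows "weak_deriv j \<eta> (pderiv_at j \<eta>)"
  unfolding weak_deriv_def
proof
  fix \<phi> :: "real ^ 'n \<Rightarrow> real" assume \<phi>: "\<phi> \<in> test_functions"
  have i1: "integrable lborel (\<lambda>x. \<phi> x * pderiv_at j \<eta> x)"
    using integrable_test_scaleR[OF continuous_loc_integrable[OF test_functions_continuous[OF pderiv_test_function[OF \<eta>]]] \<phi>]
    by simp
  have i2: "integrable lborel (\<lambda>x. pderiv_at j \<phi> x * \<eta> x)"
    using integrable_test_scaleR[OF continuous_loc_integrable[OF test_functions_continuous[OF \<eta>]] pderiv_test_function[OF \<phi>]]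
    by simp
  have "0 = (\<integral>x. pderiv_at j (\<lambda>x. \<phi> x * \<eta> x) x \<partial>lborel)"
    using integral_pderiv_test_function[OF test_functions_mult[OF \<phi> \<eta>]] by simp
  also have "\<dots> = (\<integral>x. \<phi> x * pderiv_at j \<eta> x + pderiv_at j \<phi> x * \<eta> x \<partial>lborel)"
    using pderiv_at_mult[OF test_functions_differentiable[OF \<phi>] test_functions_differentiable[OF \<eta>]] by simp
  also have "\<dots> = (\<integral>x. \<phi> x * pderiv_at j \<eta> x \<partial>lborel) + (\<integral>x. pderiv_at j \<phi> x * \<eta> x \<partial>lborel)"
    by (rule Bochner_Integration.integral_add[OF i1 i2])
  finally show "(\<integral>x. \<phi> x *\<^sub>R pderiv_at j \<eta> x \<partial>lborel) = - (\<integral>x. pderiv_at j \<phi> x *\<^sub>R \<eta> x \<partial>lborel)"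
    by simp
qed

lemma test_function_in_Lq_space:
  fixes \<eta> :: "real ^ 'n \<Rightarrow> real"
  assumes \<eta>: "\<eta> \<in> test_functions" and q: "q > 0"
  shows "(\<lambda>x. complex_of_real (\<eta> x)) \<in> Lq_space q"
proof -
  note [measurable] = test_functions_measurable[OF \<eta>]
  obtain B where B: "B > 0" "\<And>x. \<bar>\<eta> x\<bar> \<le> B" using test_function_bound[OF \<eta>] by metis
  obtain K where K: "compact K" "\<And>x. x \<notin> K \<Longrightarrow> \<eta> x = 0" using test_function_support[OF \<eta>] by metis
  have [measurable]: "K \<in> sets borel" by (rule borel_compact[OF K(1)])
  have "integrable lborel (\<lambda>x. \<bar>\<eta> x\<bar> powr q)"
  proof (rule integrableI_bounded_set[of K])
    show "emeasure lborel K < \<infinity>" by (rule emeasure_compact_finite[OF K(1)])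
    show "AE x in lborel. x \<in> K \<longrightarrow> norm (\<bar>\<eta> x\<bar> powr q) \<le> B powr q"
      using B(2) q by (auto intro!: AE_I2 powr_mono2)
  qed (use K in auto)
  then have "integrable lebesgue (\<lambda>x. norm (complex_of_real (\<eta> x)) powr q)"
    by (subst integrable_lebesgue_iff_lborel) auto
  moreover have "(\<lambda>x. complex_of_real (\<eta> x)) \<in> borel_measurable lebesgue"
    by (rule borel_measurable_lebesgueI) measurable
  ultimately show ?thesis by (simp add: Lq_space_def)
qed

text \<open>The magnetic gradient is that of \<open>\<eta>\<close> plus the term i A
  \<open>\<eta>\<close>. The latter is square integrable because \<open>\<eta>\<close> is bounded
  with compact support, where |A|^2 is integrable.\<close>

lemma test_function_in_H1_mag:
  fixes \<eta> :: "real ^ 'n \<Rightarrow> real" and A :: "real ^ 'n \<Rightarrow> real ^ 'n"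
  assumes A: "A \<in> Lq_loc 2" and \<eta>: "\<eta> \<in> test_functions"
  shows "(\<lambda>x. complex_of_real (\<eta> x)) \<in> H1_mag A"
proof -
  define \<psi> where "\<psi> x = complex_of_real (\<eta> x)" for x
  define a where "a j x = \<i> * of_real (A x $ j) * \<psi> x" for j x
  define d where "d j x = complex_of_real (pderiv_at j \<eta> x)" for j x
  define g where "g x = ((\<chi> j. d j x + a j x) :: complex ^ 'n)" for x
  have \<psi>: "\<psi> \<in> Lq_space 2" unfolding \<psi>_def by (rule test_function_in_Lq_space[OF \<eta>]) simp
  have am: "a j \<in> borel_measurable lebesgue" for j
    unfolding a_def by (rule magnetic_term_loc_integrable(1)[OF A \<psi>])
  have as: "set_integrable lebesgue K (a j)" if "compact K" for K j
    unfolding a_def by (rule magnetic_term_loc_integrable(2)[OF A \<psi> that])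
  have d2: "d j \<in> Lq_space 2" for j
    unfolding d_def by (rule test_function_in_Lq_space[OF pderiv_test_function[OF \<eta>]]) simp
  then have dm: "d j \<in> borel_measurable lebesgue" for j by (simp add: Lq_space_def)
  have ds: "set_integrable lebesgue K (d j)" if K: "compact K" for K j
    using Lq_space_2_imp_Lq_loc_1[OF d2[of j]] K
    by (intro set_integrable_bound_lebesgue[OF dm _ K, of "\<lambda>x. norm (d j x)"]) (auto simp: Lq_loc_1_iff)
  have gm: "g \<in> borel_measurable lebesgue"
    unfolding g_def using dm am by (intro vec_lambda_measurable borel_measurable_add)
  obtain B where B: "B > 0" "\<And>x. \<bar>\<eta> x\<bar> \<le> B" using test_function_bound[OF \<eta>] by metis
  obtain K where K: "compact K" "\<And>x. x \<notin> K \<Longrightarrow> \<eta> x = 0" using test_function_support[OF \<eta>] by metis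
  have a2: "integrable lebesgue (\<lambda>x. (norm (a j x))\<^sup>2)" for j
  proof (rule Bochner_Integration.integrable_bound)
    show "integrable lebesgue (\<lambda>x. B\<^sup>2 * (indicator K x *\<^sub>R (norm (A x))\<^sup>2))"
      using Lq_loc_2_D[OF A K(1)] by (intro integrable_mult_right) (simp add: set_integrable_def)
    show "(\<lambda>x. (norm (a j x))\<^sup>2) \<in> borel_measurable lebesgue" using am by measurable
    show "AE x in lebesgue. norm ((norm (a j x))\<^sup>2) \<le> norm (B\<^sup>2 * (indicator K x *\<^sub>R (norm (A x))\<^sup>2))"
    proof (rule AE_I2)
      fix x
      show "norm ((norm (a j x))\<^sup>2) \<le> norm (B\<^sup>2 * (indicator K x *\<^sub>R (norm (A x))\<^sup>2))"
      proof (cases "x \<in> K")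
        case True
        have "norm (a j x) \<le> norm (A x) * B"
          using component_le_norm_cart[of "A x" j] B(2)[of x]
          by (simp add: a_def \<psi>_def norm_mult mult_mono)
        then have "(norm (a j x))\<^sup>2 \<le> (norm (A x) * B)\<^sup>2" by (rule power_mono) simp
        then show ?thesis using True by (simp add: power_mult_distrib mult.commute)
      qed (simp add: a_def \<psi>_def K(2))
    qed
  qed
  have "integrable lebesgue (\<lambda>x. \<Sum>j\<in>UNIV. 2 * (norm (d j x))\<^sup>2 + 2 * (norm (a j x))\<^sup>2)"
    using d2 a2 by (intro Bochner_Integration.integrable_sum Bochner_Integration.integrable_add integrable_mult_right)
      (simp_all add: Lq_space_2_iff)
  then have "integrable lebesgue (\<lambda>x. (norm (g x))\<^sup>2)"
  proof (rule Bochner_Integration.integrable_bound)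
    show "(\<lambda>x. (norm (g x))\<^sup>2) \<in> borel_measurable lebesgue" using gm by measurable
    show "AE x in lebesgue. norm ((norm (g x))\<^sup>2) \<le> norm (\<Sum>j\<in>UNIV. 2 * (norm (d j x))\<^sup>2 + 2 * (norm (a j x))\<^sup>2)"
    proof (rule AE_I2)
      fix x
      have "(norm (d j x + a j x))\<^sup>2 \<le> 2 * (norm (d j x))\<^sup>2 + 2 * (norm (a j x))\<^sup>2" for j
      proof -
        have "(norm (d j x + a j x))\<^sup>2 \<le> (norm (d j x) + norm (a j x))\<^sup>2"
          by (intro power_mono norm_triangle_ineq) simp
        moreover have "0 \<le> (norm (d j x) - norm (a j x))\<^sup>2" by simp
        ultimately show ?thesis by (simp add: power2_eq_square algebra_simps)
      qed
      then have "(norm (g x))\<^sup>2 \<le> (\<Sum>j\<in>UNIV. 2 * (norm (d j x))\<^sup>2 + 2 * (norm (a j x))\<^sup>2)"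
        unfolding norm_vec_square g_def by (auto intro!: sum_mono)
      then show "norm ((norm (g x))\<^sup>2) \<le> norm (\<Sum>j\<in>UNIV. 2 * (norm (d j x))\<^sup>2 + 2 * (norm (a j x))\<^sup>2)"
        by simp
    qed
  qed
  then have g2: "g \<in> Lq_space 2" using gm by (simp add: Lq_space_2_iff)
  have "is_magnetic_gradient A \<psi> g"
    unfolding is_magnetic_gradient_def
  proof (intro conjI ballI allI)
    show "g \<in> Lq_loc 1" by (rule Lq_space_2_imp_Lq_loc_1[OF g2])
    fix \<phi> :: "real ^ 'n \<Rightarrow> real" and j assume \<phi>: "\<phi> \<in> test_functions"
    note [measurable] = test_functions_measurable[OF \<eta>] test_functions_measurable[OF \<phi>]
      test_functions_measurable[OF pderiv_test_function[OF \<eta>]] test_functions_measurable[OF pderiv_test_function[OF \<phi>]]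
    have "(LINT x|lebesgue. g x $ j * of_real (\<phi> x)) =
      (LINT x|lebesgue. d j x * of_real (\<phi> x)) + (LINT x|lebesgue. a j x * of_real (\<phi> x))"
      unfolding g_def vec_lambda_beta distrib_right
      by (rule Bochner_Integration.integral_add[OF integrable_test_lebesgue[OF dm ds \<phi>] integrable_test_lebesgue[OF am as \<phi>]])
    also have "(LINT x|lebesgue. d j x * of_real (\<phi> x)) = - (LINT x|lebesgue. \<psi> x * of_real (pderiv_at j \<phi> x))"
      using weak_deriv_test_function[OF \<eta>, of j] \<phi>
      by (simp add: d_def \<psi>_def lebesgue_integral_complex_of_real_mult weak_deriv_def del: of_real_mult)
    finally show "(LINT x|lebesgue. g x $ j * of_real (\<phi> x)) = - (LINT x|lebesgue. \<psi> x * of_real (pderiv_at j \<phi> x)) +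
       (LINT x|lebesgue. \<i> * of_real (A x $ j) * \<psi> x * of_real (\<phi> x))" by (simp add: a_def)
  qed
  from H1_magI(1)[OF \<psi> this g2] show ?thesis by (simp add: \<psi>_def[abs_def])
qed

text \<open>A bump that is nonzero exactly on the unit box cannot vanish almost everywhere, since a
  nonempty open set is not negligible.\<close>

lemma nonzero_test_function:
  obtains \<eta> :: "real ^ 'n \<Rightarrow> real" where "\<eta> \<in> test_functions" "(LINT x|lebesgue. (\<eta> x)\<^sup>2) > 0"
proof -
  let ?B = "box 0 (\<chi> i. 1) :: (real ^ 'n) set"
  obtain \<phi> :: "nat \<Rightarrow> real ^ 'n \<Rightarrow> real" where \<phi>: "\<And>n. \<phi> n \<in> test_functions"
    "\<And>n x. \<phi> n x \<noteq> 0 \<longleftrightarrow> x \<in> ?B" using bump_function[of 0 "\<chi> i. 1"] by metis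
  let ?\<eta> = "\<phi> 0"
  note [measurable] = test_functions_measurable[OF \<phi>(1)]
  have int: "integrable lborel (\<lambda>x. (?\<eta> x)\<^sup>2)"
    using integrable_test_scaleR[OF continuous_loc_integrable[OF test_functions_continuous[OF \<phi>(1)[of 0]]] \<phi>(1)[of 0]]
    by (simp add: power2_eq_square)
  have "(\<integral>x. (?\<eta> x)\<^sup>2 \<partial>lborel) \<noteq> 0"
  proof
    assume "(\<integral>x. (?\<eta> x)\<^sup>2 \<partial>lborel) = 0"
    then have "AE x in lborel. (?\<eta> x)\<^sup>2 = 0" using integral_nonneg_eq_0_iff_AE[OF int] by simp
    then have "AE x in lborel. x \<notin> ?B" by eventually_elim (simp add: \<phi>(2)[of 0, symmetric])
    then have "emeasure lborel ?B = 0" by (subst (asm) AE_iff_measurable[of ?B]) auto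
    moreover have "(\<chi> i. 1 / 2) \<in> ?B" by (simp add: mem_box_cart)
    then have "emeasure lborel ?B \<noteq> 0" using open_not_negligible[of ?B] by (auto simp: negligible_iff_emeasure0)
    ultimately show False by simp
  qed
  moreover have "(\<integral>x. (?\<eta> x)\<^sup>2 \<partial>lborel) \<ge> 0" by (simp add: integral_nonneg_AE)
  moreover have "(LINT x|lebesgue. (?\<eta> x)\<^sup>2) = (\<integral>x. (?\<eta> x)\<^sup>2 \<partial>lborel)"
    by (rule integral_lebesgue_eq_lborel) measurable
  ultimately show ?thesis by (intro that[OF \<phi>(1)[of 0]]) linarith
qed

text \<open>The greatest constant in \<open>nu_mag\<close> exists: the admissible constants form a closed half-line, which is bounded
  above because \<open>H1_mag A\<close> contains a nonzero function of \<open>L\<^sup>p\<close>.\<close>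

lemma nu_mag_ge:
  fixes A :: "real ^ 'n \<Rightarrow> real ^ 'n"
  assumes A: "A \<in> Lq_loc 2" and p: "p > 0"
    and c: "\<And>\<psi>. \<psi> \<in> H1_mag A \<Longrightarrow>
      ereal c * (Lq_norm 2 \<psi>)\<^sup>2 \<le> (Lq_norm 2 (mgrad A \<psi>))\<^sup>2 + ereal \<beta> * (Lq_norm p \<psi>)\<^sup>2"
  shows "c \<le> nu_mag A p \<beta>"
proof -
  define E where "E \<psi> = (Lq_norm 2 (mgrad A \<psi>))\<^sup>2 + ereal \<beta> * (Lq_norm p \<psi>)\<^sup>2" for \<psi>
  define S where "S = {c. \<forall>\<psi>\<in>H1_mag A. ereal c * (Lq_norm 2 \<psi>)\<^sup>2 \<le> E \<psi>}"
  have cS: "c \<in> S" using c by (simp add: S_def E_def)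
  obtain \<eta> :: "real ^ 'n \<Rightarrow> real" where \<eta>: "\<eta> \<in> test_functions" "(LINT x|lebesgue. (\<eta> x)\<^sup>2) > 0"
    using nonzero_test_function by blast
  let ?\<psi> = "\<lambda>x. complex_of_real (\<eta> x)"
  have H: "?\<psi> \<in> H1_mag A" by (rule test_function_in_H1_mag[OF A \<eta>(1)])
  \<comment> \<open>The energy of this competitor is a real number, which bounds every admissible
    constant after division by its mass.\<close>
  obtain e where e: "E ?\<psi> = ereal e"
    using Lq_norm_square[OF test_function_in_Lq_space[OF \<eta>(1) p]] Lq_norm_2_square[OF H1_magD(3)[OF H]]
    by (simp add: E_def)
  have "b \<le> e / (LINT x|lebesgue. (\<eta> x)\<^sup>2)" if "b \<in> S" for b
  proof -
    have "ereal b * (Lq_norm 2 ?\<psi>)\<^sup>2 \<le> E ?\<psi>" using that H by (auto simp: S_def)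
    then have "b * (LINT x|lebesgue. (\<eta> x)\<^sup>2) \<le> e"
      using Lq_norm_2_square[OF H1_magD(1)[OF H]] by (simp add: e)
    then show ?thesis using \<eta>(2) by (simp add: pos_le_divide_eq)
  qed
  then have bdd: "bdd_above S" by (auto simp: bdd_above_def)
  have "\<forall>\<psi>\<in>H1_mag A. ereal (Sup S) * (Lq_norm 2 \<psi>)\<^sup>2 \<le> E \<psi>"
  proof
    fix \<psi> assume \<psi>: "\<psi> \<in> H1_mag A"
    define n where "n = (LINT x|lebesgue. (norm (\<psi> x))\<^sup>2)"
    have n: "(Lq_norm 2 \<psi>)\<^sup>2 = ereal n" "n \<ge> 0"
      using Lq_norm_2_square[OF H1_magD(1)[OF \<psi>]] by (simp_all add: n_def integral_nonneg_AE)
    have le: "ereal (b * n) \<le> E \<psi>" if "b \<in> S" for b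
      using that \<psi> n(1) by (auto simp: S_def)
    show "ereal (Sup S) * (Lq_norm 2 \<psi>)\<^sup>2 \<le> E \<psi>"
    proof (cases "E \<psi>")
      case (real r)
      show ?thesis
      proof (cases "n = 0")
        \<comment> \<open>For zero mass the constant disappears from the inequality, so the one for
          c already gives the claim.\<close>
        case True
        then show ?thesis using le[OF cS] n(1) by simp
      next
        case False
        then have "Sup S \<le> r / n"
          using le n(2) real cS by (intro cSup_least) (auto simp: pos_le_divide_eq)
        then show ?thesis using n real False by (simp add: pos_le_divide_eq)
      qed
    next
      case PInf then show ?thesis by simp
    next
      \<comment> \<open>The sign of \<open>\<beta>\<close> is left open here, so this value is
        excluded by the admissibility of c.\<close>
      case MInf then show ?thesis using le[OF cS] by simp
    qed
  qed
  then have "Sup S \<in> S" by (simp add: S_def)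
  then have "(GREATEST b. b \<in> S) = Sup S" by (rule Greatest_equality) (rule cSup_upper[OF _ bdd])
  moreover have "nu_mag A p \<beta> = (GREATEST b. b \<in> S)" by (simp add: nu_mag_def S_def E_def)
  ultimately have "nu_mag A p \<beta> = Sup S" by simp
  then show ?thesis using cSup_upper[OF cS bdd] by simp
qed

theorem proposition3p4:
  fixes A :: "real ^ 'n \<Rightarrow> real ^ 'n"
    and B :: "(real ^ 'n \<Rightarrow> real) \<Rightarrow> real ^ 'n ^ 'n"
    and \<Lambda> p \<beta> :: real
  assumes "CARD('n) \<in> {2, 3}"
    and "A \<in> Lq_loc 2"
    and "\<forall>\<phi>\<in>test_functions. B \<phi> = curl A \<phi>"
    and "\<Lambda> > 0"
    and "\<forall>\<psi>\<in>H1_mag A. (Lq_norm 2 (mgrad A \<psi>))\<^sup>2 \<ge> ereal \<Lambda> * (Lq_norm 2 \<psi>)\<^sup>2"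
    and "\<exists>\<psi>\<in>H1_mag A. \<not> (AE x in lebesgue. \<psi> x = 0) \<and>
           (Lq_norm 2 (mgrad A \<psi>))\<^sup>2 = ereal \<Lambda> * (Lq_norm 2 \<psi>)\<^sup>2"
    and "1 < p" and "p < 2"
    and "\<beta> > 0"
  shows "nu_mag A p \<beta> \<ge> nu_interp (real CARD('n)) p \<Lambda> (C_opt TYPE('n) p) \<beta>"
  using assms by (intro nu_mag_ge H1_mag_energy_bound) auto

end
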